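(* Let $(\mathcal{X},\rho,\mu)$ be a space of homogeneous type satisfying the weak reverse doubling (WRD) condition and let $\Omega\subseteq\mathcal{X}$ be an open set satisfying the weak measure density (WMD) condition. Let $\Phi$ be an Orlicz function with positive lower type $r_\Phi^-$ and positive upper type $r_\Phi^+$, and let $\varphi\in\mathcal{G}^{\rm dec}_1$ satisfy both the nearness condition and that there exists a positive constant $C_1$ such that, for any $x\in\mathcal{X}$ and $r\in(0,\infty)$, $\int_r^\infty\frac{\varphi(x,t)}{t}\,dt\le C_1\varphi(x,r)$. Assume either that there exists a positive constant $C_*$ such that, for any ball $B$, $\frac1{C_*}\le\varphi(B)\mu(B)\le C_*$, or that both $\lim_{r\to0^+}\inf_{x\in B}\varphi(x,r)=\infty$ for any ball $B\subset\mathcal{X}$ and $\lim_{r\to\infty}\varphi(x,r)\mu(B(x,r))=\infty$ for any $x\in\mathcal{X}$. Let $0<q<r_\Phi^-$. Then there exist $C,\widetilde C\in(0,\infty)$ such that, for any $f\in[L^{(\Phi,\varphi)}(\Omega)/\mathbb{R}]\cap\bigcup_{s\in(0,1)}\dot W^{s,q}_{L^{(\Phi,\varphi)}}(\Omega)$, $$C\|f\|_{L^{(\Phi,\varphi)}(\Omega)/\mathbb{R}}\le\liminf_{s\to0^+}s^{\frac1q}\left\|\left\{\int_\Omega\frac{|f(\cdot)-f(y)|^q}{U(\cdot,y)[\rho(\cdot,y)]^{sq}}\,d\mu(y)\right\}^{\frac1q}\right\|_{L^{(\Phi,\varphi)}(\Omega)}\le\limsup_{s\to0^+}s^{\frac1q}\left\|\left\{\int_\Omega\frac{|f(\cdot)-f(y)|^q}{U(\cdot,y)[\rho(\cdot,y)]^{sq}}\,d\mu(y)\right\}^{\frac1q}\right\|_{L^{(\Phi,\varphi)}(\Omega)}\le\widetilde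 C\|f\|_{L^{(\Phi,\varphi)}(\Omega)/\mathbb{R}}.$$
   Context: A quasi-metric on a nonempty set $\mathcal{X}$ is $\rho:\mathcal{X}\times\mathcal{X}\to[0,\infty)$ with $\rho(x,y)=0$ iff $x=y$, $\rho(x,y)=\rho(y,x)$, and $\rho(x,z)\le K_0[\rho(x,y)+\rho(y,z)]$ for some constant $K_0\in[1,\infty)$. Balls: $B(x,r):=\{y:\rho(x,y)<r\}$. $(\mathcal{X},\rho,\mu)$ is a space of homogeneous type if $\rho$ is a quasi-metric, $\mu$ is a nonnegative measure on a $\sigma$-algebra containing all balls, and there is $L_{(\mu)}\in[1,\infty)$ with $0<\mu(B(x,2r))\le L_{(\mu)}\mu(B(x,r))<\infty$ for all $x,r$. WRD condition: there exist $x_0\in\mathcal{X}$ and $\lambda,C_{(\mu)}\in(1,\infty)$ with $\liminf_{r\to\infty}\frac{\mu(B(x_0,\lambda r))}{\mu(B(x_0,r))}\ge C_{(\mu)}$. WMD condition for $\Omega$: there exist $x_0\in\mathcal{X}$ and $C_0\in(0,1]$ with $\liminf_{r\to\infty}\frac{\mu(B(x_0,r)\cap\Omega)}{\mu(B(x_0,r))}\ge C_0$. $U(x,y):=\min\{\mu(B(x,\rho(x,y))),\mu(B(y,\rho(x,y)))\}$. The integrand $|f(x)-f(y)|^q/(U(x,y)[\rho(x,y)]^{sq})$ is read as $0$ at $y=x$. For $\varphi:\mathcal{X}\times(0,\infty)\to(0,\infty)$ and $B=B(x,r)$, write $\varphi(B):=\varphi(x,r)$. Nearness condition: there is $C>0$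 with $\frac1C\le\frac{\varphi(x,r)}{\varphi(y,r)}\le C$ whenever $\rho(x,y)\le r$. $\mathcal{G}^{\rm dec}_1$: functions $\varphi:\mathcal{X}\times(0,\infty)\to(0,\infty)$ for which there is $C>0$ with $\mu(B(x,r))\varphi(x,r)\le C\mu(B(x,s))\varphi(x,s)$ and $\varphi(x,s)\le C\varphi(x,r)$ for all $x\in\mathcal{X}$, $0<r<s<\infty$. An Orlicz function is a non-decreasing $\Phi:[0,\infty)\to[0,\infty)$ with $\Phi(0)=0$, $\Phi(t)>0$ for $t>0$, $\lim_{t\to\infty}\Phi(t)=\infty$. It is of lower (resp. upper) type $r$ if there is $C_{(r)}\in[1,\infty)$ with $\Phi(st)\le C_{(r)}s^r\Phi(t)$ for all $t\in(0,\infty)$ and $s\in(0,1)$ (resp. $s\in(1,\infty)$). Standing assumption: $\Phi$ is strictly increasing, and convex when $1\le r_\Phi^-\le r_\Phi^+<\infty$. $\|f\|_{L^\Phi(\mathcal{X})}:=\inf\{\lambda>0:\int_{\mathcal{X}}\Phi(|f|/\lambda)\,d\mu\le1\}$; $L^\Phi_{\mathrm{loc}}(\mathcal{X})$: measurable $f$ such that each $x$ has some $r_x>0$ with $\|f\mathbf{1}_{B(x,r_x)}\|_{L^\Phi(\mathcal{X})}<\infty$. $L^{(\Phi,\varphi)}(\mathcal{X})$: all $f\in L^\Phi_{\mathrm{loc}}(\mathcal{X})$ with $\|f\|_{L^{(\Phi,\varphi)}(\mathcal{X})}:=\sup_B\|f\|_{\Phi,\varphi,B}<\infty$, supremum over all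 balls, where $\|f\|_{\Phi,\varphi,B}:=\inf\{\lambda\in(0,\infty):\frac1{\mu(B)}\int_B\Phi(\frac{|f|}{\lambda})\,d\mu\le\varphi(B)\}$. For $Y=L^{(\Phi,\varphi)}$: $Y(\Omega)$ is the set of measurable $f$ on $\Omega$ that are restrictions of some $g\in Y(\mathcal{X})$, with $\|f\|_{Y(\Omega)}:=\inf\{\|g\|_{Y(\mathcal{X})}:g\in Y(\mathcal{X}),g|_\Omega=f\}$ (and $\infty$ if no such $g$); $\dot W^{s,q}_Y(\Omega)$ is the set of measurable $f$ on $\Omega$ with $\big\|\{\int_\Omega\frac{|f(\cdot)-f(y)|^q}{U(\cdot,y)[\rho(\cdot,y)]^{sq}}d\mu(y)\}^{1/q}\big\|_{Y(\Omega)}<\infty$; $Y(\Omega)/\mathbb{R}$ is the set of measurable $f$ on $\Omega$ (modulo additive real constants) with $\|f\|_{Y(\Omega)/\mathbb{R}}:=\inf_{a\in\mathbb{R}}\|f+a\|_{Y(\Omega)}<\infty$. $s\to0^+$ means $s\in(0,1)$, $s\to0$.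
   Formalization: The estimate is stated for those f whose function x ↦ {∫_Ω |f(x)-f(y)|^q/(U(x,y)ρ(x,y)^{sq}) dμ(y)}^{1/q} is a.e. equal on Ω to a measurable function for every s in (0,1), so that its norm is defined; this is automatic when ρ is jointly measurable. *)

theory Defs
  imports "HOL-Analysis.Analysis"
begin

section \<open>Spaces of homogeneous type\<close>

text \<open>The underlying set of the space is \<open>space M\<close>, and \<open>\<rho>\<close> is only constrained there.\<close>

definition quasi_metric_on :: "'a set \<Rightarrow> ('a \<Rightarrow> 'a \<Rightarrow> real) \<Rightarrow> bool" where
  "quasi_metric_on X \<rho> \<longleftrightarrow>
     X \<noteq> {} \<and>
     (\<forall>x\<in>X. \<forall>y\<in>X. 0 \<le> \<rho> x y \<and> (\<rho> x y = 0 \<longleftrightarrow> x = y) \<and> \<rho> x y = \<rho> y x) \<and>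
     (\<exists>K\<ge>1. \<forall>x\<in>X. \<forall>y\<in>X. \<forall>z\<in>X. \<rho> x z \<le> K * (\<rho> x y + \<rho> y z))"

definition qball :: "'a measure \<Rightarrow> ('a \<Rightarrow> 'a \<Rightarrow> real) \<Rightarrow> 'a \<Rightarrow> real \<Rightarrow> 'a set" where
  "qball M \<rho> x r = {y \<in> space M. \<rho> x y < r}"

definition homogeneous_type :: "'a measure \<Rightarrow> ('a \<Rightarrow> 'a \<Rightarrow> real) \<Rightarrow> bool" where
  "homogeneous_type M \<rho> \<longleftrightarrow>
     quasi_metric_on (space M) \<rho> \<and>
     (\<forall>x\<in>space M. \<forall>r>0. qball M \<rho> x r \<in> sets M) \<and>
     (\<exists>L\<ge>1. \<forall>x\<in>space M. \<forall>r>0.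
        0 < emeasure M (qball M \<rho> x (2 * r)) \<and>
        emeasure M (qball M \<rho> x (2 * r)) \<le> ennreal L * emeasure M (qball M \<rho> x r) \<and>
        ennreal L * emeasure M (qball M \<rho> x r) < \<infinity>)"

text \<open>Openness in the topology induced by \<open>\<rho>\<close>; the balls themselves need not be open.\<close>

definition qopen :: "'a measure \<Rightarrow> ('a \<Rightarrow> 'a \<Rightarrow> real) \<Rightarrow> 'a set \<Rightarrow> bool" where
  "qopen M \<rho> \<Omega> \<longleftrightarrow> \<Omega> \<subseteq> space M \<and> (\<forall>x\<in>\<Omega>. \<exists>r>0. qball M \<rho> x r \<subseteq> \<Omega>)"

definition WRD :: "'a measure \<Rightarrow> ('a \<Rightarrow> 'a \<Rightarrow> real) \<Rightarrow> bool" where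
  "WRD M \<rho> \<longleftrightarrow> (\<exists>x\<^sub>0\<in>space M. \<exists>l>1. \<exists>C>1.
     ereal C \<le> Liminf at_top (\<lambda>r.
       ereal (measure M (qball M \<rho> x\<^sub>0 (l * r)) / measure M (qball M \<rho> x\<^sub>0 r))))"

definition WMD :: "'a measure \<Rightarrow> ('a \<Rightarrow> 'a \<Rightarrow> real) \<Rightarrow> 'a set \<Rightarrow> bool" where
  "WMD M \<rho> \<Omega> \<longleftrightarrow> (\<exists>x\<^sub>0\<in>space M. \<exists>C\<^sub>0. 0 < C\<^sub>0 \<and> C\<^sub>0 \<le> 1 \<and>
     ereal C\<^sub>0 \<le> Liminf at_top (\<lambda>r.
       ereal (measure M (qball M \<rho> x\<^sub>0 r \<inter> \<Omega>) / measure M (qball M \<rho> x\<^sub>0 r))))"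

definition Umin :: "'a measure \<Rightarrow> ('a \<Rightarrow> 'a \<Rightarrow> real) \<Rightarrow> 'a \<Rightarrow> 'a \<Rightarrow> real" where
  "Umin M \<rho> x y =
     min (measure M (qball M \<rho> x (\<rho> x y))) (measure M (qball M \<rho> y (\<rho> x y)))"

section \<open>Growth functions and Orlicz functions\<close>

definition nearness :: "'a measure \<Rightarrow> ('a \<Rightarrow> 'a \<Rightarrow> real) \<Rightarrow> ('a \<Rightarrow> real \<Rightarrow> real) \<Rightarrow> bool" where
  "nearness M \<rho> \<phi> \<longleftrightarrow> (\<exists>C>0. \<forall>x\<in>space M. \<forall>y\<in>space M. \<forall>r>0. \<rho> x y \<le> r \<longrightarrow>
     1 / C \<le> \<phi> x r / \<phi> y r \<and> \<phi> x r / \<phi> y r \<le> C)"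

definition G1_dec :: "'a measure \<Rightarrow> ('a \<Rightarrow> 'a \<Rightarrow> real) \<Rightarrow> ('a \<Rightarrow> real \<Rightarrow> real) set" where
  "G1_dec M \<rho> = {\<phi>. (\<forall>x\<in>space M. \<forall>r>0. 0 < \<phi> x r) \<and>
     (\<exists>C>0. \<forall>x\<in>space M. \<forall>r s. 0 < r \<and> r < s \<longrightarrow>
        measure M (qball M \<rho> x r) * \<phi> x r \<le> C * (measure M (qball M \<rho> x s) * \<phi> x s) \<and>
        \<phi> x s \<le> C * \<phi> x r)}"

definition orlicz_function :: "(real \<Rightarrow> real) \<Rightarrow> bool" where
  "orlicz_function \<Phi> \<longleftrightarrow>
     mono_on {0..} \<Phi> \<and> \<Phi> 0 = 0 \<and> (\<forall>t>0. 0 < \<Phi> t) \<and> filterlim \<Phi> at_top at_top"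

definition lower_type :: "(real \<Rightarrow> real) \<Rightarrow> real \<Rightarrow> bool" where
  "lower_type \<Phi> p \<longleftrightarrow> (\<exists>C\<ge>1. \<forall>t>0. \<forall>s. 0 < s \<and> s < 1 \<longrightarrow> \<Phi> (s * t) \<le> C * s powr p * \<Phi> t)"

definition upper_type :: "(real \<Rightarrow> real) \<Rightarrow> real \<Rightarrow> bool" where
  "upper_type \<Phi> p \<longleftrightarrow> (\<exists>C\<ge>1. \<forall>t>0. \<forall>s>1. \<Phi> (s * t) \<le> C * s powr p * \<Phi> t)"

section \<open>Orlicz--Morrey spaces\<close>

text \<open>The infimum of the empty set in \<^typ>\<open>ennreal\<close> is \<open>\<infinity>\<close>.\<close>

definition orlicz_norm :: "'a measure \<Rightarrow> (real \<Rightarrow> real) \<Rightarrow> ('a \<Rightarrow> real) \<Rightarrow> ennreal" where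
  "orlicz_norm M \<Phi> g =
     Inf {ennreal l | l. 0 < l \<and> (\<integral>\<^sup>+x. ennreal (\<Phi> (\<bar>g x\<bar> / l)) \<partial>M) \<le> 1}"

definition orlicz_loc :: "'a measure \<Rightarrow> ('a \<Rightarrow> 'a \<Rightarrow> real) \<Rightarrow> (real \<Rightarrow> real) \<Rightarrow> ('a \<Rightarrow> real) set" where
  "orlicz_loc M \<rho> \<Phi> = {g \<in> borel_measurable M.
     \<forall>x\<in>space M. \<exists>r>0. orlicz_norm M \<Phi> (\<lambda>y. g y * indicator (qball M \<rho> x r) y) < \<infinity>}"

definition om_ball_norm :: "'a measure \<Rightarrow> ('a \<Rightarrow> 'a \<Rightarrow> real) \<Rightarrow> (real \<Rightarrow> real) \<Rightarrow>
    ('a \<Rightarrow> real \<Rightarrow> real) \<Rightarrow> 'a \<Rightarrow> real \<Rightarrow> ('a \<Rightarrow> real) \<Rightarrow> ennreal" where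
  "om_ball_norm M \<rho> \<Phi> \<phi> x r g =
     Inf {ennreal l | l. 0 < l \<and>
       (\<integral>\<^sup>+y\<in>qball M \<rho> x r. ennreal (\<Phi> (\<bar>g y\<bar> / l)) \<partial>M) / emeasure M (qball M \<rho> x r)
         \<le> ennreal (\<phi> x r)}"

definition om_norm :: "'a measure \<Rightarrow> ('a \<Rightarrow> 'a \<Rightarrow> real) \<Rightarrow> (real \<Rightarrow> real) \<Rightarrow>
    ('a \<Rightarrow> real \<Rightarrow> real) \<Rightarrow> ('a \<Rightarrow> real) \<Rightarrow> ennreal" where
  "om_norm M \<rho> \<Phi> \<phi> g = (SUP x\<in>space M. SUP r\<in>{0<..}. om_ball_norm M \<rho> \<Phi> \<phi> x r g)"

definition om_space :: "'a measure \<Rightarrow> ('a \<Rightarrow> 'a \<Rightarrow> real) \<Rightarrow> (real \<Rightarrow> real) \<Rightarrow>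
    ('a \<Rightarrow> real \<Rightarrow> real) \<Rightarrow> ('a \<Rightarrow> real) set" where
  "om_space M \<rho> \<Phi> \<phi> = {g \<in> orlicz_loc M \<rho> \<Phi>. om_norm M \<rho> \<Phi> \<phi> g < \<infinity>}"

text \<open>
  The restriction norm on \<open>\<Omega>\<close>. Functions are identified when they agree almost everywhere, so
  \<open>g|\<Omega> = F\<close> is read almost everywhere. \<open>F\<close> may take infinite values, because the Gagliardo
  function below can be infinite, for instance on a null set.
\<close>

definition om_norm_on :: "'a measure \<Rightarrow> ('a \<Rightarrow> 'a \<Rightarrow> real) \<Rightarrow> (real \<Rightarrow> real) \<Rightarrow>
    ('a \<Rightarrow> real \<Rightarrow> real) \<Rightarrow> 'a set \<Rightarrow> ('a \<Rightarrow> ereal) \<Rightarrow> ennreal" where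
  "om_norm_on M \<rho> \<Phi> \<phi> \<Omega> F =
     (INF g \<in> {g \<in> om_space M \<rho> \<Phi> \<phi>. AE x in M. x \<in> \<Omega> \<longrightarrow> ereal (g x) = F x}.
        om_norm M \<rho> \<Phi> \<phi> g)"

text \<open>
  The quotient by additive constants is represented by the seminorm on functions, and
  \<open>om_space_mod\<close> by the set of all representatives.
\<close>

definition om_norm_mod :: "'a measure \<Rightarrow> ('a \<Rightarrow> 'a \<Rightarrow> real) \<Rightarrow> (real \<Rightarrow> real) \<Rightarrow>
    ('a \<Rightarrow> real \<Rightarrow> real) \<Rightarrow> 'a set \<Rightarrow> ('a \<Rightarrow> real) \<Rightarrow> ennreal" where
  "om_norm_mod M \<rho> \<Phi> \<phi> \<Omega> f = (INF a::real. om_norm_on M \<rho> \<Phi> \<phi> \<Omega> (\<lambda>x. ereal (f x + a)))"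

definition om_space_mod :: "'a measure \<Rightarrow> ('a \<Rightarrow> 'a \<Rightarrow> real) \<Rightarrow> (real \<Rightarrow> real) \<Rightarrow>
    ('a \<Rightarrow> real \<Rightarrow> real) \<Rightarrow> 'a set \<Rightarrow> ('a \<Rightarrow> real) set" where
  "om_space_mod M \<rho> \<Phi> \<phi> \<Omega> =
     {f \<in> borel_measurable (restrict_space M \<Omega>). om_norm_mod M \<rho> \<Phi> \<phi> \<Omega> f < \<infinity>}"

section \<open>Homogeneous fractional Sobolev spaces\<close>

definition ennreal_powr :: "ennreal \<Rightarrow> real \<Rightarrow> ennreal" where
  "ennreal_powr a p = (if a = \<infinity> then \<infinity> else ennreal (enn2real a powr p))"

definition gagliardo :: "'a measure \<Rightarrow> ('a \<Rightarrow> 'a \<Rightarrow> real) \<Rightarrow> 'a set \<Rightarrow> real \<Rightarrow> real \<Rightarrow>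
    ('a \<Rightarrow> real) \<Rightarrow> 'a \<Rightarrow> ennreal" where
  "gagliardo M \<rho> \<Omega> s q f x =
     ennreal_powr
       (\<integral>\<^sup>+y\<in>\<Omega>. ennreal (if y = x then 0
          else \<bar>f x - f y\<bar> powr q / (Umin M \<rho> x y * \<rho> x y powr (s * q))) \<partial>M)
       (1 / q)"

definition gagliardo_norm :: "'a measure \<Rightarrow> ('a \<Rightarrow> 'a \<Rightarrow> real) \<Rightarrow> (real \<Rightarrow> real) \<Rightarrow>
    ('a \<Rightarrow> real \<Rightarrow> real) \<Rightarrow> 'a set \<Rightarrow> real \<Rightarrow> real \<Rightarrow> ('a \<Rightarrow> real) \<Rightarrow> ennreal" where
  "gagliardo_norm M \<rho> \<Phi> \<phi> \<Omega> s q f =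
     om_norm_on M \<rho> \<Phi> \<phi> \<Omega> (\<lambda>x. enn2ereal (gagliardo M \<rho> \<Omega> s q f x))"

definition sobolev_om :: "'a measure \<Rightarrow> ('a \<Rightarrow> 'a \<Rightarrow> real) \<Rightarrow> (real \<Rightarrow> real) \<Rightarrow>
    ('a \<Rightarrow> real \<Rightarrow> real) \<Rightarrow> 'a set \<Rightarrow> real \<Rightarrow> real \<Rightarrow> ('a \<Rightarrow> real) set" where
  "sobolev_om M \<rho> \<Phi> \<phi> \<Omega> s q =
     {f \<in> borel_measurable (restrict_space M \<Omega>). gagliardo_norm M \<rho> \<Phi> \<phi> \<Omega> s q f < \<infinity>}"

text \<open>
  The norm of a function on \<open>\<Omega>\<close> is only meaningful for (almost everywhere) measurable functions.
  Measurability of all balls says that \<open>\<rho>\<close> is measurable in each variable separately; this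
  alone does not make \<open>gagliardo M \<rho> \<Omega> s q f\<close> measurable, so the tacit requirement that the
  Gagliardo functions of \<open>f\<close> be measurable is stated explicitly. It holds for every measurable
  \<open>f\<close> as soon as \<open>\<rho>\<close> is jointly measurable, see \<open>gagliardo_measurable_of_joint\<close> below.
\<close>

definition gagliardo_measurable :: "'a measure \<Rightarrow> ('a \<Rightarrow> 'a \<Rightarrow> real) \<Rightarrow> 'a set \<Rightarrow> real \<Rightarrow>
    ('a \<Rightarrow> real) \<Rightarrow> bool" where
  "gagliardo_measurable M \<rho> \<Omega> q f \<longleftrightarrow>
     (\<forall>s\<in>{0<..<1}. \<exists>h\<in>borel_measurable M. AE x in M. x \<in> \<Omega> \<longrightarrow> h x = gagliardo M \<rho> \<Omega> s q f x)"

lemma gagliardo_measurable_of_joint: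
  assumes hom: "homogeneous_type M \<rho>"
    and \<rho>: "case_prod \<rho> \<in> borel_measurable (M \<Otimes>\<^sub>M M)"
    and \<Omega>: "\<Omega> \<in> sets M"
    and f: "f \<in> borel_measurable (restrict_space M \<Omega>)"
  shows "gagliardo_measurable M \<rho> \<Omega> q f"
proof -
  have qm: "quasi_metric_on (space M) \<rho>" using hom by (simp add: homogeneous_type_def)
  obtain x0 where x0: "x0 \<in> space M" using qm by (auto simp: quasi_metric_on_def)
  have fin: "emeasure M (qball M \<rho> x r) < \<infinity>" if x: "x \<in> space M" and r: "r > 0" for x r
  proof -
    obtain L where "L \<ge> (1::real)" "emeasure M (qball M \<rho> x (2 * (r/2)))
        \<le> ennreal L * emeasure M (qball M \<rho> x (r/2))"
        "ennreal L * emeasure M (qball M \<rho> x (r/2)) < \<infinity>"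
      using hom x half_gt_zero[OF r] unfolding homogeneous_type_def by blast
    then show ?thesis by (auto intro: order.strict_trans1)
  qed
  interpret sigma_finite_measure M
  proof
    let ?A = "(\<lambda>n::nat. qball M \<rho> x0 (real (Suc n))) ` UNIV"
    have "\<exists>n::nat. \<rho> x0 y < real (Suc n)" for y
      
    proof -
      obtain n :: nat where "\<rho> x0 y < real n" using reals_Archimedean2 by blast
      then have "\<rho> x0 y < real (Suc n)" by simp
      then show ?thesis by blast
    qed
    then have "\<Union>?A = space M" by (auto simp: qball_def)
    moreover have "?A \<subseteq> sets M" using hom x0 by (auto simp: homogeneous_type_def)
    moreover have "\<forall>a\<in>?A. emeasure M a \<noteq> \<infinity>" 
    proof
      fix a assume "a \<in> ?A"
      then obtain n :: nat where a: "a = qball M \<rho> x0 (real (Suc n))" by blast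
      have "emeasure M a < \<infinity>" unfolding a by (rule fin[OF x0]) simp
      then show "emeasure M a \<noteq> \<infinity>" by simp
    qed
    ultimately show "\<exists>A. countable A \<and> A \<subseteq> sets M \<and> \<Union> A = space M \<and> (\<forall>a\<in>A. emeasure M a \<noteq> \<infinity>)"
      by (intro exI[of _ ?A] conjI countable_image) simp_all
  qed
  have \<rho>'[measurable]: "(\<lambda>x. \<rho> (g x) (h x)) \<in> borel_measurable N"
    if "g \<in> measurable N M" "h \<in> measurable N M" for g h and N :: "'z measure"
    using measurable_compose[OF measurable_Pair[OF that] \<rho>] by simp
  have ballm: "(\<lambda>x. measure M (qball M \<rho> (g x) (h x))) \<in> borel_measurable N"
    if [measurable]: "g \<in> measurable N M" "h \<in> borel_measurable N" for g h and N :: "('a \<times> 'a) measure"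
  proof -
    have "(\<lambda>x. emeasure M (qball M \<rho> (g x) (h x))) \<in> borel_measurable N"
    proof (rule measurable_emeasure[where A="\<lambda>x. qball M \<rho> (g x) (h x)"])
      fix x show "qball M \<rho> (g x) (h x) \<subseteq> space M" by (auto simp: qball_def)
    next
      have "{x \<in> space (N \<Otimes>\<^sub>M M). \<rho> (g (fst x)) (snd x) < h (fst x)} \<in> sets (N \<Otimes>\<^sub>M M)"
        using \<rho>'[of "\<lambda>x. g (fst x)" "N \<Otimes>\<^sub>M M" snd] by measurable
      also have "{x \<in> space (N \<Otimes>\<^sub>M M). \<rho> (g (fst x)) (snd x) < h (fst x)} =
         {x \<in> space (N \<Otimes>\<^sub>M M). snd x \<in> qball M \<rho> (g (fst x)) (h (fst x))}"
        by (auto simp: qball_def space_pair_measure)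
      finally show "{x \<in> space (N \<Otimes>\<^sub>M M). snd x \<in> qball M \<rho> (g (fst x)) (h (fst x))}
          \<in> sets (N \<Otimes>\<^sub>M M)" .
    qed
    then show ?thesis unfolding measure_def by measurable
  qed
  define f' where "f' = (\<lambda>x. indicator \<Omega> x *\<^sub>R f x)"
  have [measurable]: "f' \<in> borel_measurable M"
    using f \<Omega> borel_measurable_restrict_space_iff[of \<Omega> M f] sets.Int_space_eq2[OF \<Omega>]
    by (simp add: f'_def)
  show ?thesis unfolding gagliardo_measurable_def
  proof (intro ballI)
    fix s :: real
    define k where "k = (\<lambda>x y. ennreal (if \<rho> x y = 0 then 0
          else \<bar>f' x - f' y\<bar> powr q / (Umin M \<rho> x y * \<rho> x y powr (s * q))) * indicator \<Omega> y)"
    have [measurable]: "(\<lambda>p. \<rho> (fst p) (snd p)) \<in> borel_measurable (M \<Otimes>\<^sub>M M)"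
      using \<rho> by (simp add: case_prod_beta')
    have [measurable]: "(\<lambda>p. Umin M \<rho> (fst p) (snd p)) \<in> borel_measurable (M \<Otimes>\<^sub>M M)"
      unfolding Umin_def by (intro borel_measurable_min ballm) measurable
    note [measurable] = \<Omega>
    have "(\<lambda>p. k (fst p) (snd p)) \<in> borel_measurable (M \<Otimes>\<^sub>M M)"
      unfolding k_def by measurable
    then have K[measurable]: "(\<lambda>x. \<integral>\<^sup>+y. k x y \<partial>M) \<in> borel_measurable M"
      by (intro borel_measurable_nn_integral) (simp add: case_prod_beta')
    let ?h = "\<lambda>x. ennreal_powr (\<integral>\<^sup>+y. k x y \<partial>M) (1 / q)"
    have "?h \<in> borel_measurable M" unfolding ennreal_powr_def by measurable
    moreover have "?h x = gagliardo M \<rho> \<Omega> s q f x" if "x \<in> \<Omega>" for x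
    proof -
      have "x \<in> space M" using \<Omega> that sets.sets_into_space by blast
      then have "(\<integral>\<^sup>+y. k x y \<partial>M) = (\<integral>\<^sup>+y\<in>\<Omega>. ennreal (if y = x then 0
          else \<bar>f x - f y\<bar> powr q / (Umin M \<rho> x y * \<rho> x y powr (s * q))) \<partial>M)"
        using qm that unfolding quasi_metric_on_def
        by (intro nn_integral_cong) (auto simp: k_def f'_def indicator_def)
      then show ?thesis by (simp add: gagliardo_def)
    qed
    ultimately show "\<exists>h\<in>borel_measurable M. AE x in M. x \<in> \<Omega> \<longrightarrow> h x = gagliardo M \<rho> \<Omega> s q f x"
      by (intro bexI[of _ ?h]) auto
  qed
qed

end

theory Submission
  imports Defs
begin

text \<open>
  As \<open>s\<close> tends to \<open>0\<close>, the factor \<open>s\<close> in front of the \<open>q\<close>-th power of the Gagliardo function leaves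
  only the interaction of \<open>x\<close> with points far away. There \<open>\<rho> x y powr (s * q)\<close> varies so slowly that
  each dyadic annulus contributes a comparable amount; about \<open>1 / s\<close> annuli count, and the
  prefactor \<open>s\<close> normalises their sum. On most of a far annulus a function that is small at infinity
  on average satisfies \<open>\<bar>f x - f y\<bar> \<approx> \<bar>f x\<bar>\<close>, so the limit is comparable to \<open>\<bar>f\<bar>\<close>. An additive
  constant \<open>a\<close> does not change the Gagliardo function; below, \<open>g\<close> is a function on the whole space
  that equals \<open>f + a\<close> almost everywhere on \<open>\<Omega>\<close>, and norm bounds are expressed by the modular
  condition \<open>\<integral> \<Phi> (\<bar>g\<bar> / l) \<le> \<phi> x r * \<mu> (B x r)\<close> over every ball.

  Upper bound. The integral is split at \<open>\<rho> x y = 1\<close>. If \<open>s < s\<^sub>0\<close>, the near part is at most the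
  integral of order \<open>s\<^sub>0\<close>; for some \<open>s\<^sub>0\<close> it has finite norm, and \<open>s powr (1 / q)\<close> makes it
  negligible. The far part is at most a multiple of \<open>\<bar>g x\<bar> powr q\<close> plus a weighted sum of averages of
  \<open>\<bar>g\<bar> powr q\<close> over the balls \<open>B x (2 ^ k)\<close>, and after multiplication by \<open>s\<close> the weights have a
  total that is bounded uniformly in \<open>s\<close>. Because \<open>q\<close> is below the lower type of \<open>\<Phi>\<close>, the function
  \<open>t \<mapsto> \<Phi> (t powr (1 / q))\<close> behaves like a convex one: lemma \<open>power_le_Phi\<close> gives it approximate
  supporting lines, and a Jensen argument (\<open>Phi_le_of_power_bound\<close>, \<open>gagliardo_pointwise\<close>) bounds
  \<open>\<Phi>\<close> of a multiple of the scaled Gagliardo function by \<open>\<Phi>\<close> of the near part, \<open>\<Phi> (\<bar>g x\<bar> / l)\<close> and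
  the same weighted averages of \<open>\<Phi> (\<bar>g\<bar> / l)\<close>. It remains that
  averaging at any radius \<open>t\<close> preserves the modular condition on a ball of radius \<open>r\<close>
  (\<open>average_majorant\<close>): for \<open>t \<le> r\<close> by a covering with bounded overlap, for \<open>t > r\<close> because \<open>\<phi>\<close> is
  almost decreasing in the radius and almost constant on the ball.

  Lower bound. Reverse doubling and measure density yield a ratio \<open>\<Lambda>\<close> such that every large annulus
  \<open>B x (\<Lambda> * r) - B x r\<close> meets \<open>\<Omega>\<close> in a set of measure at least \<open>\<mu> (B x r)\<close>
  (\<open>wide_annuli_meet_domain\<close>). The integral condition forces \<open>\<phi> x r \<rightarrow> 0\<close> as \<open>r \<rightarrow> \<infinity>\<close>, hence the
  averages of \<open>\<bar>g\<bar> powr q\<close> over \<open>B x r\<close> tend to \<open>0\<close> (\<open>power_average_vanishes\<close>). So far annuli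
  contribute at least a fixed fraction of what \<open>\<bar>g x\<bar> powr q\<close> would, and at almost every \<open>x\<close> of
  \<open>\<Omega>\<close> one gets \<open>\<bar>g x\<bar> \<le> C * s powr (1 / q) * G\<^sub>s x\<close> for all small \<open>s\<close>, with \<open>G\<^sub>s\<close> the Gagliardo
  function of order \<open>s\<close> (\<open>gagliardo_ge\<close>). Fatou's lemma along a sequence realising the limit inferior
  turns this into the inequality of norms.

  Since \<open>\<rho>\<close> is measurable only in each variable separately, averages over \<open>B x t\<close> may fail to be
  measurable in \<open>x\<close>, and integrals of the Gagliardo kernel are lower integrals. Averages are therefore
  replaced by explicit measurable majorants, and the kernel is compared with step functions that are
  constant on annuli.
\<close>

section \<open>Doubling quasi-metric measure spaces\<close>

locale doubling_space =
  fixes M :: "'a measure" and \<rho> :: "'a \<Rightarrow> 'a \<Rightarrow> real" and K L :: real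
  assumes K_ge_1: "1 \<le> K"
    and dist_nonneg: "x \<in> space M \<Longrightarrow> y \<in> space M \<Longrightarrow> 0 \<le> \<rho> x y"
    and dist_self: "x \<in> space M \<Longrightarrow> \<rho> x x = 0"
    and dist_pos: "x \<in> space M \<Longrightarrow> y \<in> space M \<Longrightarrow> x \<noteq> y \<Longrightarrow> 0 < \<rho> x y"
    and dist_sym: "x \<in> space M \<Longrightarrow> y \<in> space M \<Longrightarrow> \<rho> x y = \<rho> y x"
    and dist_triangle: "x \<in> space M \<Longrightarrow> y \<in> space M \<Longrightarrow> z \<in> space M \<Longrightarrow>
      \<rho> x z \<le> K * (\<rho> x y + \<rho> y z)"
    and ball_sets_pos: "x \<in> space M \<Longrightarrow> 0 < r \<Longrightarrow> qball M \<rho> x r \<in> sets M"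
    and L_ge_1: "1 \<le> L"
    and emeasure_ball_finite: "x \<in> space M \<Longrightarrow> 0 < r \<Longrightarrow> emeasure M (qball M \<rho> x r) \<noteq> \<infinity>"
    and measure_ball_pos: "x \<in> space M \<Longrightarrow> 0 < r \<Longrightarrow> 0 < measure M (qball M \<rho> x r)"
    and measure_ball_double: "x \<in> space M \<Longrightarrow> 0 < r \<Longrightarrow>
      measure M (qball M \<rho> x (2 * r)) \<le> L * measure M (qball M \<rho> x r)"

lemma homogeneous_type_doubling_space:
  assumes "homogeneous_type M \<rho>"
  obtains K L where "doubling_space M \<rho> K L"
proof -
  have qm: "quasi_metric_on (space M) \<rho>"
    and bs: "\<And>x r. x \<in> space M \<Longrightarrow> 0 < r \<Longrightarrow> qball M \<rho> x r \<in> sets M"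
    using assms by (auto simp: homogeneous_type_def)
  obtain K where K: "1 \<le> K" "\<And>x y z. x \<in> space M \<Longrightarrow> y \<in> space M \<Longrightarrow> z \<in> space M \<Longrightarrow>
      \<rho> x z \<le> K * (\<rho> x y + \<rho> y z)"
    using qm[unfolded quasi_metric_on_def, THEN conjunct2, THEN conjunct2] by metis
  have qm': "0 \<le> \<rho> x y" "\<rho> x y = 0 \<longleftrightarrow> x = y" "\<rho> x y = \<rho> y x"
    if "x \<in> space M" "y \<in> space M" for x y
    using qm that unfolding quasi_metric_on_def by blast+
  obtain L where L: "1 \<le> L" "\<And>x r. x \<in> space M \<Longrightarrow> 0 < r \<Longrightarrow>
        0 < emeasure M (qball M \<rho> x (2 * r)) \<and>
        emeasure M (qball M \<rho> x (2 * r)) \<le> ennreal L * emeasure M (qball M \<rho> x r) \<and>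
        ennreal L * emeasure M (qball M \<rho> x r) < \<infinity>"
    using assms unfolding homogeneous_type_def by blast
  have pos: "0 < emeasure M (qball M \<rho> x r)" if "x \<in> space M" "0 < r" for x r
    using L(2)[of x "r/2"] that by simp
  have fin: "emeasure M (qball M \<rho> x r) \<noteq> \<infinity>" if "x \<in> space M" "0 < r" for x r
    using L(2)[of x "r/2"] that by (auto intro!: less_imp_neq intro: order.strict_trans1)
  have "doubling_space M \<rho> K L"
  proof
    show "1 \<le> K" "1 \<le> L" by fact+
  next
    fix x r assume x: "x \<in> space M" and r: "0 < (r::real)"
    have e: "emeasure M (qball M \<rho> x s) = ennreal (measure M (qball M \<rho> x s))" if "0 < s" for s
      using fin[OF x that] by (simp add: emeasure_eq_ennreal_measure)
    show "0 < measure M (qball M \<rho> x r)"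
      using pos[OF x r] by (simp add: e[OF r])
    have "ennreal (measure M (qball M \<rho> x (2 * r))) \<le> ennreal L * ennreal (measure M (qball M \<rho> x r))"
      using L(2)[OF x r] r by (simp add: e)
    also have "\<dots> = ennreal (L * measure M (qball M \<rho> x r))"
      using L(1) by (simp add: ennreal_mult)
    finally show "measure M (qball M \<rho> x (2 * r)) \<le> L * measure M (qball M \<rho> x r)"
      using L(1) by (subst (asm) ennreal_le_iff) auto
  qed (use K qm' bs fin in \<open>auto simp: less_le\<close>)
  then show thesis by (rule that)
qed

context doubling_space
begin

abbreviation B :: "'a \<Rightarrow> real \<Rightarrow> 'a set" where "B x r \<equiv> qball M \<rho> x r"

abbreviation V :: "'a \<Rightarrow> real \<Rightarrow> real" where "V x r \<equiv> measure M (B x r)"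

lemma ball_sets [measurable]: "x \<in> space M \<Longrightarrow> B x r \<in> sets M"
proof (cases "0 < r")
  case False
  moreover assume "x \<in> space M"
  ultimately have "B x r = {}"
    using dist_nonneg by (fastforce simp: qball_def)
  then show ?thesis by simp
qed (rule ball_sets_pos)

lemma emeasure_ball: "x \<in> space M \<Longrightarrow> 0 < r \<Longrightarrow> emeasure M (B x r) = ennreal (V x r)"
  using emeasure_ball_finite[of x r] by (simp add: emeasure_eq_ennreal_measure)

lemma fmeasurable_ball: "x \<in> space M \<Longrightarrow> 0 < r \<Longrightarrow> B x r \<in> fmeasurable M"
  using emeasure_ball_finite[of x r] by (intro fmeasurableI) (auto simp: top.not_eq_extremum)

lemma measure_ball_mono:
  assumes "x \<in> space M" "y \<in> space M" "0 < s" "B x r \<subseteq> B y s"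
  shows "V x r \<le> V y s"
  using assms by (intro measure_mono_fmeasurable fmeasurable_ball) auto

lemma ball_subset_ball:
  assumes "x \<in> space M" "y \<in> space M" "K * (\<rho> y x + r) \<le> s"
  shows "B x r \<subseteq> B y s"
proof
  fix z assume "z \<in> B x r"
  then have z: "z \<in> space M" "\<rho> x z < r" by (auto simp: qball_def)
  have "\<rho> y z \<le> K * (\<rho> y x + \<rho> x z)" using assms z by (intro dist_triangle) auto
  also have "\<dots> < K * (\<rho> y x + r)" using z K_ge_1 by (intro mult_strict_left_mono) auto
  finally show "z \<in> B y s" using assms z by (auto simp: qball_def)
qed

lemma ball_subset_ball_same: "r \<le> s \<Longrightarrow> B x r \<subseteq> B x s"
  by (auto simp: qball_def)

lemma measure_ball_power: "x \<in> space M \<Longrightarrow> 0 < r \<Longrightarrow> V x (2 ^ n * r) \<le> L ^ n * V x r"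
proof (induction n)
  case (Suc n)
  have "V x (2 * (2 ^ n * r)) \<le> L * V x (2 ^ n * r)"
    using Suc by (intro measure_ball_double) auto
  also have "\<dots> \<le> L * (L ^ n * V x r)"
    using Suc L_ge_1 by (intro mult_left_mono) auto
  finally show ?case by (simp add: mult_ac)
qed simp

text \<open>
  Balls whose radii and distance of centres are comparable have comparable measures; every use of
  doubling below goes through this form.
\<close>

lemma ball_comparison:
  fixes a b :: real
  obtains D where "1 \<le> D"
    "\<And>x y r. x \<in> space M \<Longrightarrow> y \<in> space M \<Longrightarrow> 0 < r \<Longrightarrow> \<rho> x y \<le> a * r \<Longrightarrow> V x (b * r) \<le> D * V y r"
proof -
  obtain n :: nat where n: "K * (a + b) < 2 ^ n"
    using real_arch_pow[of 2] by auto
  show thesis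
  proof (rule that[of "L ^ n"])
    show "1 \<le> L ^ n" using L_ge_1 by simp
    fix x y r assume *: "x \<in> space M" "y \<in> space M" "0 < (r::real)" "\<rho> x y \<le> a * r"
    have "B x (b * r) \<subseteq> B y (2 ^ n * r)"
    proof (rule ball_subset_ball)
      have "K * (\<rho> y x + b * r) \<le> K * (a * r + b * r)"
        using * K_ge_1 by (intro mult_left_mono) (auto simp: dist_sym)
      also have "\<dots> \<le> 2 ^ n * r"
        using n *(3) by (metis distrib_right less_eq_real_def mult.assoc mult_right_mono)
      finally show "K * (\<rho> y x + b * r) \<le> 2 ^ n * r" .
    qed (use * in auto)
    then have "V x (b * r) \<le> V y (2 ^ n * r)"
      using * by (intro measure_ball_mono) auto
    also have "\<dots> \<le> L ^ n * V y r" using * by (intro measure_ball_power)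
    finally show "V x (b * r) \<le> L ^ n * V y r" .
  qed
qed

definition separated :: "real \<Rightarrow> 'a set \<Rightarrow> bool" where
  "separated r Z \<longleftrightarrow> (\<forall>z\<in>Z. \<forall>w\<in>Z. z \<noteq> w \<longrightarrow> r \<le> \<rho> z w)"

text \<open>
  Balls of radius \<open>r / (2 * K)\<close> around \<open>r\<close>-separated points are disjoint, lie in one ball around
  \<open>y\<close>, and each has a fixed fraction of its measure.
\<close>

lemma packing_bound:
  fixes a :: real
  assumes "0 \<le> a"
  obtains N :: nat where "\<And>y r Z. y \<in> space M \<Longrightarrow> 0 < r \<Longrightarrow> finite Z \<Longrightarrow> Z \<subseteq> B y (a * r) \<Longrightarrow>
     separated r Z \<Longrightarrow> card Z \<le> N"
proof -
  define c where "c = 1 / (2 * K)"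
  have c: "0 < c" "K * c = 1 / 2" using K_ge_1 by (auto simp: c_def)
  obtain D where D: "1 \<le> D" "\<And>x y r. x \<in> space M \<Longrightarrow> y \<in> space M \<Longrightarrow> 0 < r \<Longrightarrow>
     \<rho> x y \<le> a / c * r \<Longrightarrow> V x ((K * a + 1) / c * r) \<le> D * V y r"
    by (rule ball_comparison[of "a / c" "(K * a + 1) / c"]) blast
  show thesis
  proof (rule that[of "nat \<lfloor>D\<rfloor>"])
    fix y r Z assume y: "y \<in> space M" and r: "0 < (r::real)" and Z: "finite Z" "Z \<subseteq> B y (a * r)"
      and sep: "separated r Z"
    have Zs: "Z \<subseteq> space M" using Z by (auto simp: qball_def)
    let ?R = "(K * a + 1) * r"
    have R: "0 < ?R" using assms K_ge_1 r by (intro mult_pos_pos add_nonneg_pos) auto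
    have disj: "disjoint_family_on (\<lambda>z. B z (c * r)) Z"
      unfolding disjoint_family_on_def
    proof (intro ballI impI, rule ccontr)
      fix z w assume zw: "z \<in> Z" "w \<in> Z" "z \<noteq> w" and "B z (c * r) \<inter> B w (c * r) \<noteq> {}"
      then obtain u where u: "u \<in> space M" "\<rho> z u < c * r" "\<rho> w u < c * r"
        by (auto simp: qball_def)
      have "\<rho> z w \<le> K * (\<rho> z u + \<rho> u w)" using zw u Zs by (intro dist_triangle) auto
      also have "\<dots> < K * (c * r + c * r)"
        using u zw Zs K_ge_1 by (intro mult_strict_left_mono add_strict_mono) (auto simp: dist_sym)
      also have "\<dots> = r" using c by (simp add: algebra_simps)
      finally show False using sep zw unfolding separated_def by (meson not_less)
    qed
    have sub: "B z (c * r) \<subseteq> B y ?R" if "z \<in> Z" for z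
    proof (rule ball_subset_ball)
      have "K * (\<rho> y z + c * r) \<le> K * (a * r + c * r)"
        using that Z K_ge_1 by (intro mult_left_mono) (auto simp: qball_def)
      also have "\<dots> \<le> ?R" using c r by (simp add: algebra_simps)
      finally show "K * (\<rho> y z + c * r) \<le> ?R" .
    qed (use that Zs y in auto)
    have low: "V y ?R \<le> D * V z (c * r)" if "z \<in> Z" for z
      using D(2)[of y z "c * r"] that y Zs Z c r by (auto simp: qball_def)
    have "real (card Z) * V y ?R = (\<Sum>z\<in>Z. V y ?R)" by simp
    also have "\<dots> \<le> (\<Sum>z\<in>Z. D * V z (c * r))" by (intro sum_mono low)
    also have "\<dots> = D * (\<Sum>z\<in>Z. V z (c * r))" by (simp add: sum_distrib_left)
    also have "(\<Sum>z\<in>Z. V z (c * r)) = measure M (\<Union>z\<in>Z. B z (c * r))"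
      using Zs c r Z disj by (intro measure_finite_Union[symmetric]) (auto simp: emeasure_ball)
    also have "\<dots> \<le> V y ?R"
      using sub y R Zs Z by (intro measure_mono_fmeasurable fmeasurable_ball sets.finite_UN) auto
    finally have "real (card Z) * V y ?R \<le> D * V y ?R" using D by simp
    then have "real (card Z) \<le> D" using measure_ball_pos[OF y R] by simp
    then show "card Z \<le> nat \<lfloor>D\<rfloor>" by linarith
  qed
qed

text \<open>
  An \<open>r\<close>-separated set of maximal cardinality is a net; the packing bound provides the maximum.
\<close>

lemma finite_net:
  assumes x: "x \<in> space M" and R: "0 < R" and r: "0 < r"
  obtains Z where "finite Z" "Z \<subseteq> B x R" "separated r Z" "B x R \<subseteq> (\<Union>z\<in>Z. B z r)"
proof -
  obtain N where N: "\<And>y r' Z. y \<in> space M \<Longrightarrow> 0 < r' \<Longrightarrow> finite Z \<Longrightarrow> Z \<subseteq> B y (R / r * r') \<Longrightarrow>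
     separated r' Z \<Longrightarrow> card Z \<le> N"
    using packing_bound[of "R / r"] R r by (metis divide_nonneg_pos less_imp_le)
  let ?P = "\<lambda>Z. finite Z \<and> Z \<subseteq> B x R \<and> separated r Z"
  have "?P {}" by (auto simp: separated_def)
  moreover have "\<forall>Z. ?P Z \<longrightarrow> card Z < Suc N"
    using N[OF x r] r by (auto simp: less_Suc_eq_le)
  ultimately obtain Z where Z: "?P Z" "\<And>Z'. ?P Z' \<Longrightarrow> card Z' \<le> card Z"
    using ex_has_greatest_nat[of ?P "{}" card "Suc N"] by (metis less_imp_le)
  have "B x R \<subseteq> (\<Union>z\<in>Z. B z r)"
  proof (rule ccontr)
    assume "\<not> ?thesis"
    then obtain w where w: "w \<in> B x R" "\<And>z. z \<in> Z \<Longrightarrow> \<not> \<rho> z w < r" by (auto simp: qball_def)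
    have "w \<notin> Z" using w(2)[of w] w(1) dist_self[of w] r by (auto simp: qball_def)
    moreover have "?P (insert w Z)"
      using Z w dist_sym by (auto simp: separated_def qball_def not_less subset_eq)
    ultimately show False using Z(2)[of "insert w Z"] Z(1) by simp
  qed
  then show thesis using Z that by blast
qed

text \<open>
  The union of finite nets at scales \<open>1 / n\<close> is a countable dense set, so an open set is a countable
  union of (measurable) balls.
\<close>

lemma qopen_sets:
  assumes "qopen M \<rho> \<Omega>"
  shows "\<Omega> \<in> sets M"
proof (cases "\<Omega> = {}")
  case False
  then obtain x where x: "x \<in> space M" using assms by (auto simp: qopen_def)
  have "\<exists>Z. finite Z \<and> Z \<subseteq> space M \<and> B x R \<subseteq> (\<Union>z\<in>Z. B z r)" if "0 < R" "0 < r" for R r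
    by (rule finite_net[OF x that]) (auto simp: qball_def)
  then obtain Z where Z: "\<And>R r. 0 < R \<Longrightarrow> 0 < r \<Longrightarrow>
      finite (Z R r) \<and> Z R r \<subseteq> space M \<and> B x R \<subseteq> (\<Union>z\<in>Z R r. B z r)"
    by metis
  let ?r = "\<lambda>n::nat. 1 / real (Suc n)"
  let ?I = "{(z, n). z \<in> Z (real (Suc n)) (?r n) \<and> B z (?r n) \<subseteq> \<Omega>}"
  have "\<Omega> = (\<Union>(z, n)\<in>?I. B z (?r n))"
  proof (intro equalityI subsetI)
    fix y assume y: "y \<in> \<Omega>"
    then have ys: "y \<in> space M" using assms by (auto simp: qopen_def)
    obtain e where e: "0 < e" "B y e \<subseteq> \<Omega>" using assms y unfolding qopen_def by blast
    obtain n :: nat where "\<rho> x y + 2 * K / e < real n" using reals_Archimedean2 by blast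
    then have n: "\<rho> x y + 2 * K / e < real (Suc n)" by simp
    have "0 < 2 * K / e" using K_ge_1 e by simp
    then have "\<rho> x y < real (Suc n)" and ne: "2 * K / e < real (Suc n)"
      using n dist_nonneg[OF x ys] by linarith+
    then have "y \<in> B x (real (Suc n))" using ys by (simp add: qball_def)
    then obtain z where z: "z \<in> Z (real (Suc n)) (?r n)" "y \<in> B z (?r n)"
      using Z[of "real (Suc n)" "?r n"] by auto
    then have zs: "z \<in> space M" "\<rho> z y < ?r n"
      using Z[of "real (Suc n)" "?r n"] by (auto simp: qball_def)
    have "B z (?r n) \<subseteq> B y e"
    proof (rule ball_subset_ball)
      have "K * (\<rho> y z + ?r n) \<le> K * (?r n + ?r n)"
        using zs ys K_ge_1 by (intro mult_left_mono) (auto simp: dist_sym)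
      also have "\<dots> \<le> e" using ne e(1) by (simp add: field_simps)
      finally show "K * (\<rho> y z + ?r n) \<le> e" .
    qed (use zs ys in auto)
    then show "y \<in> (\<Union>(z, n)\<in>?I. B z (?r n))" using z e by blast
  qed blast
  moreover have "countable ?I"
  proof -
    have "?I \<subseteq> (\<Union>n. Z (real (Suc n)) (?r n) \<times> {n})" by auto
    moreover have "finite (Z (real (Suc n)) (?r n))" for n
      using Z[of "real (Suc n)" "?r n"] by simp
    then have "countable (\<Union>n. Z (real (Suc n)) (?r n) \<times> {n})"
      by (intro countable_UN[OF countableI_type] countable_finite finite_cartesian_product) auto
    ultimately show ?thesis by (rule countable_subset)
  qed
  moreover have "B z (?r n) \<in> sets M" if "(z, n) \<in> ?I" for z n
  proof (rule ball_sets)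
    have "Z (real (Suc n)) (?r n) \<subseteq> space M" using Z[of "real (Suc n)" "?r n"] by simp
    then show "z \<in> space M" using that by blast
  qed
  ultimately show ?thesis
    by (metis (no_types, lifting) case_prod_beta sets.countable_UN'' prod.collapse)
qed simp

end

section \<open>Averages over balls of a fixed radius\<close>

context doubling_space
begin

abbreviation average :: "('a \<Rightarrow> ennreal) \<Rightarrow> 'a \<Rightarrow> real \<Rightarrow> ennreal" where
  "average v x t \<equiv> ennreal (1 / V x t) * (\<integral>\<^sup>+y\<in>B x t. v y \<partial>M)"

text \<open>
  At a scale \<open>t \<le> r\<close>, cover \<open>B x\<^sub>0 r\<close> by balls \<open>B z t\<close> around a finite \<open>t\<close>-net. On \<open>B z t\<close> the average
  at \<open>x\<close> is controlled by the average over \<open>B z (2 * K * t)\<close>, which gives a step function, and the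
  enlarged balls have bounded overlap by the packing bound. This replaces an application of
  Tonelli's theorem to the set \<open>\<rho> x y < t\<close>, which need not be measurable in the product.
\<close>

lemma small_average_majorant:
  obtains C b :: real where "0 \<le> C" "1 \<le> b"
    "\<And>v x\<^sub>0 r t. v \<in> borel_measurable M \<Longrightarrow> x\<^sub>0 \<in> space M \<Longrightarrow> 0 < t \<Longrightarrow> t \<le> r \<Longrightarrow>
       \<exists>A\<in>borel_measurable M. (\<forall>x\<in>B x\<^sub>0 r. average v x t \<le> A x) \<and>
         (\<integral>\<^sup>+x. A x \<partial>M) \<le> ennreal C * (\<integral>\<^sup>+y\<in>B x\<^sub>0 (b * r). v y \<partial>M)"
proof -
  obtain D where D: "1 \<le> D" "\<And>x y r. x \<in> space M \<Longrightarrow> y \<in> space M \<Longrightarrow> 0 < r \<Longrightarrow>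
     \<rho> x y \<le> 1 * r \<Longrightarrow> V x (1 * r) \<le> D * V y r"
    by (rule ball_comparison[of 1 1]) blast
  have K0: "0 \<le> 2 * K" using K_ge_1 by simp
  obtain N where N: "\<And>y r Z. y \<in> space M \<Longrightarrow> 0 < r \<Longrightarrow> finite Z \<Longrightarrow> Z \<subseteq> B y (2 * K * r) \<Longrightarrow>
     separated r Z \<Longrightarrow> card Z \<le> N"
    using packing_bound[OF K0] by blast
  define b where "b = K * (1 + 2 * K)"
  have b: "1 \<le> b"
    unfolding b_def using K_ge_1 mult_mono[of 1 K 1 "1 + 2 * K"] by simp
  show thesis
  proof (rule that[of "D * real N" b])
    fix v :: "'a \<Rightarrow> ennreal" and x0 r t
    assume [measurable]: "v \<in> borel_measurable M"
      and x0: "x0 \<in> space M" and t: "0 < (t::real)" "t \<le> r"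
    obtain Z where Z: "finite Z" "Z \<subseteq> B x0 r" "separated t Z" "B x0 r \<subseteq> (\<Union>z\<in>Z. B z t)"
      using finite_net[OF x0 _ t(1), of r] t by auto
    have Zs: "z \<in> space M" "\<rho> x0 z < r" if "z \<in> Z" for z using that Z by (auto simp: qball_def)
    note [measurable] = ball_sets[OF Zs(1)]
    define I where "I = (\<lambda>z. \<integral>\<^sup>+y\<in>B z (2 * K * t). v y \<partial>M)"
    define A where "A = (\<lambda>x. \<Sum>z\<in>Z. ennreal (D / V z t) * I z * indicator (B z t) x)"
    have Vp: "0 < V z t" if "z \<in> Z" for z
      using Zs that t by (intro measure_ball_pos) auto
    have [measurable]: "A \<in> borel_measurable M"
      unfolding A_def by (intro borel_measurable_sum borel_measurable_times_ennreal
          borel_measurable_const borel_measurable_indicator ball_sets Zs)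
    have "average v x t \<le> A x" if x: "x \<in> B x0 r" for x
    proof -
      have xs: "x \<in> space M" using x by (simp add: qball_def)
      obtain z where z: "z \<in> Z" "x \<in> B z t" using x Z by auto
      have d: "\<rho> z x < t" using z by (simp add: qball_def)
      have sub: "B x t \<subseteq> B z (2 * K * t)"
      proof (rule ball_subset_ball)
        have "K * (\<rho> z x + t) \<le> K * (t + t)" using d K_ge_1 by (intro mult_left_mono) auto
        then show "K * (\<rho> z x + t) \<le> 2 * K * t" by simp
      qed (use xs z Zs in auto)
      have "1 / V x t \<le> D / V z t"
        using D(2)[of z x t] z Zs xs t d Vp[OF z(1)] measure_ball_pos[of x t]
        by (simp add: field_simps)
      then have "average v x t \<le> ennreal (D / V z t) * I z"
        unfolding I_def using sub
        by (intro mult_mono nn_integral_mono ennreal_leI) (auto simp: indicator_def)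
      also have "\<dots> = ennreal (D / V z t) * I z * indicator (B z t) x" using z by simp
      also have "\<dots> \<le> A x" unfolding A_def using Z(1) z(1)
        by (intro member_le_sum) auto
      finally show ?thesis .
    qed
    moreover have "(\<integral>\<^sup>+x. A x \<partial>M) \<le> ennreal (D * real N) * (\<integral>\<^sup>+y\<in>B x0 (b * r). v y \<partial>M)"
    proof -
      have "(\<integral>\<^sup>+x. A x \<partial>M) = (\<Sum>z\<in>Z. \<integral>\<^sup>+x. ennreal (D / V z t) * I z * indicator (B z t) x \<partial>M)"
        unfolding A_def by (rule nn_integral_sum) measurable
      also have "\<dots> = (\<Sum>z\<in>Z. ennreal D * I z)"
      proof (rule sum.cong[OF refl])
        fix z assume z: "z \<in> Z"
        have "(\<integral>\<^sup>+x. ennreal (D / V z t) * I z * indicator (B z t) x \<partial>M) =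
            ennreal (D / V z t) * I z * ennreal (V z t)"
          using z t Zs by (subst nn_integral_cmult_indicator) (auto simp: emeasure_ball)
        also have "\<dots> = ennreal (D / V z t * V z t) * I z"
          using D(1) by (subst ennreal_mult) (auto simp: mult_ac)
        finally show "(\<integral>\<^sup>+x. ennreal (D / V z t) * I z * indicator (B z t) x \<partial>M) = ennreal D * I z"
          using Vp[OF z] by simp
      qed
      also have "\<dots> = ennreal D * (\<integral>\<^sup>+y. (\<Sum>z\<in>Z. v y * indicator (B z (2 * K * t)) y) \<partial>M)"
      proof -
        have "(\<integral>\<^sup>+y. (\<Sum>z\<in>Z. v y * indicator (B z (2 * K * t)) y) \<partial>M) = (\<Sum>z\<in>Z. I z)"
          unfolding I_def by (rule nn_integral_sum) measurable
        then show ?thesis by (simp only: sum_distrib_left)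
      qed
      also have "\<dots> \<le> ennreal D * (\<integral>\<^sup>+y. real N * (v y * indicator (B x0 (b * r)) y) \<partial>M)"
      proof (intro mult_left_mono nn_integral_mono)
        fix y assume y: "y \<in> space M"
        let ?Z = "{z \<in> Z. y \<in> B z (2 * K * t)}"
        have "(\<Sum>z\<in>Z. v y * indicator (B z (2 * K * t)) y) = (\<Sum>z\<in>?Z. v y)"
          using Z(1) by (intro sum.mono_neutral_cong_right) auto
        also have "\<dots> = of_nat (card ?Z) * v y" by simp
        also have "\<dots> \<le> real N * (v y * indicator (B x0 (b * r)) y)"
        proof (cases "?Z = {}")
          case False
          then obtain z where z: "z \<in> Z" "y \<in> B z (2 * K * t)" by blast
          have "B z (2 * K * t) \<subseteq> B x0 (b * r)"
          proof (rule ball_subset_ball)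
            have "K * (\<rho> x0 z + 2 * K * t) \<le> K * (r + 2 * K * r)"
              using Zs(2)[OF z(1)] t K_ge_1 by (intro mult_left_mono add_mono) auto
            then show "K * (\<rho> x0 z + 2 * K * t) \<le> b * r" by (simp add: b_def algebra_simps)
          qed (use z Zs x0 in auto)
          then have "y \<in> B x0 (b * r)" using z by blast
          moreover have "card ?Z \<le> N"
          proof (rule N)
            show "?Z \<subseteq> B y (2 * K * t)" using Zs y by (auto simp: qball_def dist_sym)
            show "separated t ?Z" using Z(3) by (auto simp: separated_def)
          qed (use Z y t in auto)
          then have "of_nat (card ?Z) \<le> ennreal (real N)"
            by (simp add: ennreal_of_nat_eq_real_of_nat)
          ultimately show ?thesis by (simp add: mult_right_mono)
        qed (simp only: card.empty, simp)
        finally show "(\<Sum>z\<in>Z. v y * indicator (B z (2 * K * t)) y) \<le>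
            real N * (v y * indicator (B x0 (b * r)) y)" .
      qed simp
      also have "\<dots> = ennreal D * (ennreal (real N) * (\<integral>\<^sup>+y\<in>B x0 (b * r). v y \<partial>M))"
        using x0 by (subst nn_integral_cmult) auto
      also have "\<dots> = ennreal (D * real N) * (\<integral>\<^sup>+y\<in>B x0 (b * r). v y \<partial>M)"
        using D(1) by (simp add: ennreal_mult mult_ac)
      finally show ?thesis .
    qed
    ultimately show "\<exists>A\<in>borel_measurable M. (\<forall>x\<in>B x0 r. average v x t \<le> A x) \<and>
         (\<integral>\<^sup>+x. A x \<partial>M) \<le> ennreal (D * real N) * (\<integral>\<^sup>+y\<in>B x0 (b * r). v y \<partial>M)"
      by (intro bexI[of _ A]) auto
  qed (use D(1) b in auto)
qed

end

text \<open>
  One constant \<open>H\<close> serves for almost monotonicity and for nearness; the integral condition on \<open>\<phi>\<close>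
  enters through the vanishing at infinity.
\<close>

locale growth_space = doubling_space M \<rho> K L
  for M :: "'a measure" and \<rho> K L +
  fixes \<phi> :: "'a \<Rightarrow> real \<Rightarrow> real" and H :: real
  assumes H_ge_1: "1 \<le> H"
    and growth_pos: "x \<in> space M \<Longrightarrow> 0 < r \<Longrightarrow> 0 < \<phi> x r"
    and growth_decreasing: "x \<in> space M \<Longrightarrow> 0 < r \<Longrightarrow> r \<le> s \<Longrightarrow> \<phi> x s \<le> H * \<phi> x r"
    and growth_near: "x \<in> space M \<Longrightarrow> y \<in> space M \<Longrightarrow> 0 < r \<Longrightarrow> \<rho> y x \<le> r \<Longrightarrow> \<phi> x r \<le> H * \<phi> y r"
    and growth_vanishes: "x \<in> space M \<Longrightarrow> (\<phi> x \<longlongrightarrow> 0) at_top"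
begin

text \<open>
  For \<open>v = \<Phi> (\<bar>g\<bar> / l)\<close> this is the modular form of an Orlicz--Morrey bound: it implies that the norm
  of \<open>g\<close> is at most \<open>l\<close>, and holds if the norm is less than \<open>l\<close>.
\<close>

definition morrey_bounded :: "('a \<Rightarrow> ennreal) \<Rightarrow> bool" where
  "morrey_bounded v \<longleftrightarrow>
     (\<forall>x\<in>space M. \<forall>r>0. (\<integral>\<^sup>+y\<in>B x r. v y \<partial>M) \<le> ennreal (\<phi> x r * V x r))"

lemma morrey_boundedD:
  "morrey_bounded v \<Longrightarrow> x \<in> space M \<Longrightarrow> 0 < r \<Longrightarrow>
     (\<integral>\<^sup>+y\<in>B x r. v y \<partial>M) \<le> ennreal (\<phi> x r * V x r)"
  by (simp add: morrey_bounded_def)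

lemma average_le_growth:
  assumes "morrey_bounded v" "x \<in> space M" "0 < r"
  shows "average v x r \<le> ennreal (\<phi> x r)"
proof -
  have "average v x r \<le> ennreal (1 / V x r) * ennreal (\<phi> x r * V x r)"
    using assms by (intro mult_left_mono morrey_boundedD) auto
  also have "\<dots> = ennreal (1 / V x r * (\<phi> x r * V x r))"
    using growth_pos[OF assms(2,3)] by (intro ennreal_mult[symmetric]) auto
  also have "\<dots> = ennreal (\<phi> x r)" using measure_ball_pos[OF assms(2,3)] by simp
  finally show ?thesis .
qed

text \<open>
  For \<open>t \<le> r\<close> the covering argument applies; for \<open>t > r\<close> the average at \<open>x\<close> is at most
  \<open>\<phi> x t \<le> H * \<phi> x r \<le> H * H * \<phi> x\<^sub>0 r\<close>. The point is that \<open>C\<close> is independent of \<open>t\<close>.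
\<close>

lemma average_majorant:
  obtains C :: real where "0 \<le> C"
    "\<And>v x\<^sub>0 r t. v \<in> borel_measurable M \<Longrightarrow> morrey_bounded v \<Longrightarrow> x\<^sub>0 \<in> space M \<Longrightarrow> 0 < r \<Longrightarrow>
       0 < t \<Longrightarrow>
       \<exists>A\<in>borel_measurable M. (\<forall>x\<in>B x\<^sub>0 r. average v x t \<le> A x) \<and>
         (\<integral>\<^sup>+x\<in>B x\<^sub>0 r. A x \<partial>M) \<le> ennreal (C * (\<phi> x\<^sub>0 r * V x\<^sub>0 r))"
proof -
  obtain C b :: real where C: "0 \<le> C" "1 \<le> b"
    and loc: "\<And>v x\<^sub>0 r t. v \<in> borel_measurable M \<Longrightarrow> x\<^sub>0 \<in> space M \<Longrightarrow> 0 < t \<Longrightarrow> t \<le> r \<Longrightarrow>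
       \<exists>A\<in>borel_measurable M. (\<forall>x\<in>B x\<^sub>0 r. average v x t \<le> A x) \<and>
         (\<integral>\<^sup>+x. A x \<partial>M) \<le> ennreal C * (\<integral>\<^sup>+y\<in>B x\<^sub>0 (b * r). v y \<partial>M)"
    by (rule small_average_majorant) blast
  obtain D where D: "1 \<le> D" "\<And>x y r. x \<in> space M \<Longrightarrow> y \<in> space M \<Longrightarrow> 0 < r \<Longrightarrow>
     \<rho> x y \<le> 0 * r \<Longrightarrow> V x (b * r) \<le> D * V y r"
    by (rule ball_comparison[of 0 b]) blast
  show thesis
  proof (rule that[of "C * H * D + H * H"])
    fix v :: "'a \<Rightarrow> ennreal" and x0 r t
    assume v: "v \<in> borel_measurable M" "morrey_bounded v"
      and x0: "x0 \<in> space M" and r: "0 < (r::real)" and t: "0 < (t::real)"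
    let ?F = "\<phi> x0 r * V x0 r"
    have F: "0 \<le> ?F" using growth_pos[OF x0 r] by simp
    have CHD: "0 \<le> C * H * D" using C D H_ge_1 by simp
    show "\<exists>A\<in>borel_measurable M. (\<forall>x\<in>B x0 r. average v x t \<le> A x) \<and>
         (\<integral>\<^sup>+x\<in>B x0 r. A x \<partial>M) \<le> ennreal ((C * H * D + H * H) * ?F)"
    proof (cases "t \<le> r")
      case True
      obtain A where A: "A \<in> borel_measurable M" "\<forall>x\<in>B x0 r. average v x t \<le> A x"
        "(\<integral>\<^sup>+x. A x \<partial>M) \<le> ennreal C * (\<integral>\<^sup>+y\<in>B x0 (b * r). v y \<partial>M)"
        using loc[OF v(1) x0 t True] by blast
      have br: "0 < b * r" "r \<le> b * r" using C r by auto
      have "(\<integral>\<^sup>+x\<in>B x0 r. A x \<partial>M) \<le> (\<integral>\<^sup>+x. A x \<partial>M)"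
        by (intro nn_integral_mono) (auto simp: indicator_def)
      also note A(3)
      also have "ennreal C * (\<integral>\<^sup>+y\<in>B x0 (b * r). v y \<partial>M) \<le> ennreal C * ennreal (H * D * ?F)"
      proof (intro mult_left_mono order_trans[OF morrey_boundedD[OF v(2) x0 br(1)]] ennreal_leI)
        have "\<phi> x0 (b * r) * V x0 (b * r) \<le> (H * \<phi> x0 r) * (D * V x0 r)"
          using growth_decreasing[OF x0 r br(2)] D(2)[of x0 x0 r] dist_self x0 r
            growth_pos[OF x0 r] H_ge_1 by (intro mult_mono) auto
        then show "\<phi> x0 (b * r) * V x0 (b * r) \<le> H * D * ?F" by (simp add: mult_ac)
      qed simp
      also have "\<dots> = ennreal (C * H * D * ?F)"
        using C D H_ge_1 F by (subst ennreal_mult[symmetric]) (auto simp: mult_ac)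
      also have "\<dots> \<le> ennreal ((C * H * D + H * H) * ?F)"
        using F by (intro ennreal_leI mult_right_mono) auto
      finally show ?thesis using A by blast
    next
      case False
      then have rt: "r \<le> t" by simp
      have "average v x t \<le> ennreal (H * H * \<phi> x0 r)" if x: "x \<in> B x0 r" for x
      proof -
        have xs: "x \<in> space M" "\<rho> x0 x \<le> r" using x by (auto simp: qball_def)
        have "average v x t \<le> ennreal (\<phi> x t)" by (rule average_le_growth[OF v(2) xs(1) t])
        also have "\<phi> x t \<le> H * \<phi> x r" by (rule growth_decreasing[OF xs(1) r rt])
        also have "H * \<phi> x r \<le> H * (H * \<phi> x0 r)"
          using growth_near[OF xs(1) x0 r xs(2)] H_ge_1 by (intro mult_left_mono) auto
        finally show ?thesis by (simp add: mult_ac ennreal_leI)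
      qed
      moreover have "(\<integral>\<^sup>+x\<in>B x0 r. ennreal (H * H * \<phi> x0 r) \<partial>M) \<le> ennreal ((C * H * D + H * H) * ?F)"
      proof -
        have "(\<integral>\<^sup>+x\<in>B x0 r. ennreal (H * H * \<phi> x0 r) \<partial>M) = ennreal (H * H * \<phi> x0 r) * ennreal (V x0 r)"
          using x0 r by (subst nn_integral_cmult_indicator) (auto simp: emeasure_ball)
        also have "\<dots> = ennreal (H * H * ?F)"
          using growth_pos[OF x0 r] H_ge_1 by (subst ennreal_mult[symmetric]) (auto simp: mult_ac)
        also have "\<dots> \<le> ennreal ((C * H * D + H * H) * ?F)"
          using F CHD by (intro ennreal_leI mult_right_mono) auto
        finally show ?thesis .
      qed
      ultimately show ?thesis by (intro bexI[of _ "\<lambda>_. ennreal (H * H * \<phi> x0 r)"]) auto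
    qed
  qed (use C D H_ge_1 in auto)
qed

text \<open>
  The form in which the part of the Gagliardo integral at distance at least \<open>1\<close> is estimated; \<open>w k\<close>
  will be \<open>s * 2 powr (- k * s * q)\<close>.
\<close>

definition far_average :: "(nat \<Rightarrow> real) \<Rightarrow> ('a \<Rightarrow> ennreal) \<Rightarrow> 'a \<Rightarrow> ennreal" where
  "far_average w v x = (\<Sum>k. ennreal (w k) * average v x (2 ^ Suc k))"

lemma far_average_majorant:
  obtains C :: real where "0 \<le> C"
    "\<And>v w W x\<^sub>0 r. v \<in> borel_measurable M \<Longrightarrow> morrey_bounded v \<Longrightarrow>
       (\<Sum>k. ennreal (w k)) \<le> ennreal W \<Longrightarrow> 0 \<le> W \<Longrightarrow> x\<^sub>0 \<in> space M \<Longrightarrow> 0 < r \<Longrightarrow>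
       \<exists>A\<in>borel_measurable M. (\<forall>x\<in>B x\<^sub>0 r. far_average w v x \<le> A x) \<and>
         (\<integral>\<^sup>+x\<in>B x\<^sub>0 r. A x \<partial>M) \<le> ennreal (C * W * (\<phi> x\<^sub>0 r * V x\<^sub>0 r))"
proof -
  obtain C :: real where C: "0 \<le> C"
    and maj: "\<And>v x\<^sub>0 r t. v \<in> borel_measurable M \<Longrightarrow> morrey_bounded v \<Longrightarrow> x\<^sub>0 \<in> space M \<Longrightarrow> 0 < r \<Longrightarrow>
       0 < t \<Longrightarrow>
       \<exists>A\<in>borel_measurable M. (\<forall>x\<in>B x\<^sub>0 r. average v x t \<le> A x) \<and>
         (\<integral>\<^sup>+x\<in>B x\<^sub>0 r. A x \<partial>M) \<le> ennreal (C * (\<phi> x\<^sub>0 r * V x\<^sub>0 r))"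
    by (rule average_majorant) blast
  show thesis
  proof (rule that[OF C])
    fix v :: "'a \<Rightarrow> ennreal" and w :: "nat \<Rightarrow> real" and W x0 r
    assume v: "v \<in> borel_measurable M" "morrey_bounded v"
      and W: "(\<Sum>k. ennreal (w k)) \<le> ennreal W" "0 \<le> W" and x0: "x0 \<in> space M" and r: "0 < (r::real)"
    let ?F = "\<phi> x0 r * V x0 r"
    have F: "0 \<le> C * ?F" using growth_pos[OF x0 r] C by simp
    have "\<forall>k::nat. \<exists>A\<in>borel_measurable M. (\<forall>x\<in>B x0 r. average v x (2 ^ Suc k) \<le> A x) \<and>
         (\<integral>\<^sup>+x\<in>B x0 r. A x \<partial>M) \<le> ennreal (C * ?F)"
      by (intro allI maj v x0 r) simp
    from bchoice[of UNIV, simplified, OF this[unfolded Bex_def]]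
    obtain A where A[measurable]: "\<And>k. A k \<in> borel_measurable M"
      and A2: "\<And>k x. x \<in> B x0 r \<Longrightarrow> average v x (2 ^ Suc k) \<le> A k x"
      and A3: "\<And>k. (\<integral>\<^sup>+x\<in>B x0 r. A k x \<partial>M) \<le> ennreal (C * ?F)"
      by blast
    note [measurable] = ball_sets[OF x0]
    let ?A = "\<lambda>x. \<Sum>k. ennreal (w k) * A k x"
    have "?A \<in> borel_measurable M" by measurable
    moreover have "far_average w v x \<le> ?A x" if "x \<in> B x0 r" for x
      unfolding far_average_def using A2[OF that] by (intro suminf_le mult_left_mono) auto
    moreover have "(\<integral>\<^sup>+x\<in>B x0 r. ?A x \<partial>M) \<le> ennreal (C * W * ?F)"
    proof -
      have "(\<integral>\<^sup>+x\<in>B x0 r. ?A x \<partial>M) = (\<integral>\<^sup>+x. (\<Sum>k. ennreal (w k) * (A k x * indicator (B x0 r) x)) \<partial>M)"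
        by (intro nn_integral_cong) (simp add: indicator_def)
      also have "\<dots> = (\<Sum>k. ennreal (w k) * (\<integral>\<^sup>+x\<in>B x0 r. A k x \<partial>M))"
        by (simp add: nn_integral_suminf nn_integral_cmult)
      also have "\<dots> \<le> (\<Sum>k. ennreal (w k) * ennreal (C * ?F))"
        by (intro suminf_le mult_left_mono A3) auto
      also have "\<dots> = (\<Sum>k. ennreal (w k)) * ennreal (C * ?F)" by simp
      also have "\<dots> \<le> ennreal W * ennreal (C * ?F)" by (intro mult_right_mono W) simp
      also have "\<dots> = ennreal (C * W * ?F)"
        using W F by (subst ennreal_mult[symmetric]) (auto simp: mult_ac)
      finally show ?thesis .
    qed
    ultimately show "\<exists>A\<in>borel_measurable M. (\<forall>x\<in>B x0 r. far_average w v x \<le> A x) \<and>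
         (\<integral>\<^sup>+x\<in>B x0 r. A x \<partial>M) \<le> ennreal (C * W * ?F)" by (intro bexI[of _ ?A]) auto
  qed
qed

lemma far_average_finite:
  assumes "morrey_bounded v" "(\<Sum>k. ennreal (w k)) < \<infinity>" "x \<in> space M"
  shows "far_average w v x < \<infinity>"
proof -
  have "average v x (2 ^ Suc k) \<le> ennreal (H * \<phi> x 1)" for k :: nat
  proof -
    have "average v x (2 ^ Suc k) \<le> ennreal (\<phi> x (2 ^ Suc k))"
      using assms by (intro average_le_growth) auto
    also have "\<phi> x (2 ^ Suc k) \<le> H * \<phi> x 1"
      using assms one_le_power[of "2::real" "Suc k"] by (intro growth_decreasing) auto
    finally show ?thesis by (simp add: ennreal_leI)
  qed
  then have "far_average w v x \<le> (\<Sum>k. ennreal (w k) * ennreal (H * \<phi> x 1))"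
    unfolding far_average_def by (intro suminf_le mult_left_mono) auto
  also have "\<dots> = (\<Sum>k. ennreal (w k)) * ennreal (H * \<phi> x 1)" by simp
  also have "\<dots> < \<infinity>" using assms(2) by (simp add: ennreal_mult_less_top)
  finally show ?thesis .
qed

end

section \<open>Functions of positive lower type\<close>

locale orlicz_type =
  fixes \<Phi> :: "real \<Rightarrow> real" and p q A :: real
  assumes Phi_mono: "mono_on {0..} \<Phi>"
    and Phi_0: "\<Phi> 0 = 0"
    and Phi_pos: "0 < t \<Longrightarrow> 0 < \<Phi> t"
    and q_pos: "0 < q" and q_less_p: "q < p" and A_ge_1: "1 \<le> A"
    and Phi_lower: "0 < t \<Longrightarrow> 0 < s \<Longrightarrow> s < 1 \<Longrightarrow> \<Phi> (s * t) \<le> A * s powr p * \<Phi> t"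
begin

lemma Phi_monoD: "0 \<le> s \<Longrightarrow> s \<le> t \<Longrightarrow> \<Phi> s \<le> \<Phi> t"
  using Phi_mono by (auto simp: mono_on_def)

lemma Phi_nonneg: "0 \<le> t \<Longrightarrow> 0 \<le> \<Phi> t"
  using Phi_monoD[of 0 t] Phi_0 by simp

lemma Phi_measurable [measurable]:
  assumes [measurable]: "g \<in> borel_measurable N"
  shows "(\<lambda>x. \<Phi> \<bar>g x\<bar>) \<in> borel_measurable N"
proof -
  have "mono (\<lambda>t. \<Phi> (max 0 t))" by (intro monoI Phi_monoD) auto
  then have [measurable]: "(\<lambda>t. \<Phi> (max 0 t)) \<in> borel_measurable borel"
    by (rule borel_measurable_mono)
  have "(\<lambda>x. \<Phi> (max 0 \<bar>g x\<bar>)) \<in> borel_measurable N" by measurable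
  then show ?thesis by (simp add: max_def)
qed

text \<open>
  An approximate supporting line at \<open>\<tau>\<close> for \<open>\<Phi>\<close> as a function of \<open>t powr q\<close>: for \<open>t > \<tau>\<close> the lower type
  \<open>p > q\<close> makes \<open>\<Phi> t / t powr q\<close> almost increasing. Integrated against averages it plays the role of
  Jensen's inequality.
\<close>

lemma power_le_Phi:
  assumes t: "0 \<le> t" and \<tau>: "0 < \<tau>"
  shows "t powr q \<le> \<tau> powr q + \<tau> powr q * (A / \<Phi> \<tau>) * \<Phi> t"
proof (cases "t \<le> \<tau>")
  case True
  have "t powr q \<le> \<tau> powr q" using True t q_pos by (intro powr_mono2) auto
  moreover have "0 \<le> \<tau> powr q * (A / \<Phi> \<tau>) * \<Phi> t"
    using A_ge_1 Phi_nonneg[OF t] Phi_pos[OF \<tau>] by simp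
  ultimately show ?thesis by linarith
next
  case False
  then have tp: "0 < t" and less: "\<tau> / t < 1" using \<tau> by auto
  have "\<Phi> \<tau> = \<Phi> (\<tau> / t * t)" using tp by simp
  also have "\<dots> \<le> A * (\<tau> / t) powr p * \<Phi> t"
    using tp \<tau> less by (intro Phi_lower) auto
  also have "\<dots> \<le> A * (\<tau> / t) powr q * \<Phi> t"
    using tp \<tau> less q_less_p A_ge_1 Phi_nonneg[OF t]
    by (intro mult_right_mono mult_left_mono powr_mono') auto
  finally have "t powr q * \<Phi> \<tau> \<le> A * \<tau> powr q * \<Phi> t"
    using tp \<tau> by (simp add: powr_divide field_simps)
  then have "t powr q \<le> \<tau> powr q * (A / \<Phi> \<tau>) * \<Phi> t"
    using Phi_pos[OF \<tau>] by (simp add: field_simps)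
  then show ?thesis by (smt (verit) powr_ge_zero)
qed

lemma Phi_shrink:
  assumes "0 \<le> C"
  obtains \<epsilon> where "0 < \<epsilon>" "\<And>t. 0 \<le> t \<Longrightarrow> C * \<Phi> (\<epsilon> * t) \<le> \<Phi> t"
proof -
  (* C * A * \<epsilon> powr p \<le> 1, and the 2 keeps \<epsilon> below 1, where the lower type applies *)
  define \<epsilon> where "\<epsilon> = (1 / (2 + C * A)) powr (1 / p)"
  have p: "0 < p" using q_pos q_less_p by simp
  have CA: "0 \<le> C * A" using assms A_ge_1 by simp
  have e: "0 < \<epsilon>" unfolding \<epsilon>_def using CA by simp
  have e_p: "\<epsilon> powr p = 1 / (2 + C * A)"
    unfolding \<epsilon>_def using p CA by (simp add: powr_powr)
  have e1: "\<epsilon> < 1"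
  proof (rule ccontr)
    assume "\<not> \<epsilon> < 1"
    then have "1 \<le> \<epsilon> powr p" using p by (intro ge_one_powr_ge_zero) auto
    then show False using e_p CA by (simp add: field_simps)
  qed
  show thesis
  proof (rule that[OF e])
    fix t :: real assume t: "0 \<le> t"
    show "C * \<Phi> (\<epsilon> * t) \<le> \<Phi> t"
    proof (cases "t = 0")
      case False
      have "C * \<Phi> (\<epsilon> * t) \<le> C * (A * \<epsilon> powr p * \<Phi> t)"
        using False t e e1 assms by (intro mult_left_mono Phi_lower) auto
      also have "\<dots> = (C * A / (2 + C * A)) * \<Phi> t" by (simp add: e_p)
      also have "\<dots> \<le> 1 * \<Phi> t"
        using CA Phi_nonneg[OF t] by (intro mult_right_mono) (auto simp: field_simps)
      finally show ?thesis by simp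
    qed (simp add: Phi_0)
  qed
qed

text \<open>
  The Jensen step. Take \<open>\<tau>\<close> to be the multiple of \<open>J\<close> for which the term \<open>C * \<tau> powr q\<close> is a quarter
  of \<open>J powr q\<close>. Then either \<open>E\<close> already exceeds \<open>\<Phi> \<tau>\<close>, or both \<open>\<tau>\<close>-terms can be absorbed on the
  left and \<open>\<tau>\<close> is below \<open>J0\<close> or \<open>Z\<close>.
\<close>

lemma Phi_le_of_power_bound:
  assumes nonneg: "0 \<le> J" "0 \<le> J0" "0 \<le> Z" "0 \<le> E" and C: "1 \<le> C"
    and bound: "\<And>\<tau>. 0 < \<tau> \<Longrightarrow>
      J powr q \<le> J0 powr q + C * (Z powr q + \<tau> powr q + \<tau> powr q * (E / \<Phi> \<tau>))"
  shows "\<Phi> ((1 / (4 * C)) powr (1 / q) * J) \<le> \<Phi> J0 + \<Phi> Z + E"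
proof -
  let ?\<eta> = "(1 / (4 * C)) powr (1 / q)"
  have eq: "?\<eta> powr q = 1 / (4 * C)" using q_pos C by (simp add: powr_powr)
  have e: "0 < ?\<eta>" using C by simp
  have Phis: "0 \<le> \<Phi> J0" "0 \<le> \<Phi> Z" using nonneg by (auto intro: Phi_nonneg)
  consider "J = 0" | "0 < J" "\<Phi> (?\<eta> * J) \<le> E" | "0 < J" "E < \<Phi> (?\<eta> * J)"
    using nonneg by linarith
  then show ?thesis
  proof cases
    case 1 then show ?thesis using Phis nonneg by (simp add: Phi_0)
  next
    case 2 then show ?thesis using Phis by linarith
  next
    case 3
    let ?\<tau> = "?\<eta> * J"
    have \<tau>: "0 < ?\<tau>" using 3 e by simp
    have \<tau>q: "?\<tau> powr q = J powr q / (4 * C)" using 3 e by (simp add: powr_mult eq)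
    have "E / \<Phi> ?\<tau> \<le> 1" using 3 Phi_pos[OF \<tau>] by simp
    then have "?\<tau> powr q * (E / \<Phi> ?\<tau>) \<le> ?\<tau> powr q * 1" by (intro mult_left_mono) auto
    then have "J powr q \<le> J0 powr q + C * (Z powr q + ?\<tau> powr q + ?\<tau> powr q)"
      using bound[OF \<tau>] C
      by (smt (verit) mult_left_mono)
    also have "\<dots> = J0 powr q + C * Z powr q + J powr q / 2"
      unfolding \<tau>q using C by (simp add: field_simps)
    finally have "J powr q \<le> 2 * J0 powr q + 2 * (C * Z powr q)" by simp
    then consider "J powr q \<le> 4 * J0 powr q" | "J powr q \<le> 4 * (C * Z powr q)" by linarith
    then show ?thesis
    proof cases
      case 1
      have "?\<tau> powr q \<le> 4 * J0 powr q / (4 * C)" unfolding \<tau>q using 1 C by (intro divide_right_mono) auto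
      also have "\<dots> \<le> J0 powr q" using C mult_right_mono[of 1 C "J0 powr q"] by (simp add: field_simps)
      finally have "?\<tau> \<le> J0" using q_pos \<tau> nonneg powr_less_mono2[of q J0 ?\<tau>] by linarith
      then have "\<Phi> ?\<tau> \<le> \<Phi> J0" using \<tau> by (intro Phi_monoD) auto
      then show ?thesis using Phis nonneg by linarith
    next
      case 2
      have "?\<tau> powr q \<le> 4 * (C * Z powr q) / (4 * C)" unfolding \<tau>q using 2 C by (intro divide_right_mono) auto
      also have "\<dots> = Z powr q" using C by simp
      finally have "?\<tau> \<le> Z" using q_pos \<tau> nonneg powr_less_mono2[of q Z ?\<tau>] by linarith
      then have "\<Phi> ?\<tau> \<le> \<Phi> Z" using \<tau> by (intro Phi_monoD) auto
      then show ?thesis using Phis nonneg by linarith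
    qed
  qed
qed

end

section \<open>Pointwise upper estimate of the Gagliardo function\<close>

text \<open>
  Subadditivity for a splitting of the domain. It holds for lower integrals too, hence for
  non-measurable \<open>u\<close>, because every simple function below \<open>u\<close> can be split.
\<close>

lemma nn_integral_split_le:
  assumes [measurable]: "S \<in> sets N"
  shows "(\<integral>\<^sup>+x. u x \<partial>N) \<le> (\<integral>\<^sup>+x. u x * indicator S x \<partial>N) + (\<integral>\<^sup>+x. u x * indicator (- S) x \<partial>N)"
  unfolding nn_integral_def[of N u]
proof (rule SUP_least)
  fix w assume "w \<in> {g. simple_function N g \<and> g \<le> u}"
  then have w: "simple_function N w" and le: "\<And>x. w x \<le> u x" by (auto simp: le_fun_def)
  have [measurable]: "w \<in> borel_measurable N" by (rule borel_measurable_simple_function[OF w])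
  have "integral\<^sup>S N w = (\<integral>\<^sup>+x. w x \<partial>N)" by (rule nn_integral_eq_simple_integral[OF w, symmetric])
  also have "\<dots> = (\<integral>\<^sup>+x. w x * indicator S x + w x * indicator (space N - S) x \<partial>N)"
    by (intro nn_integral_cong) (auto simp: indicator_def)
  also have "\<dots> = (\<integral>\<^sup>+x. w x * indicator S x \<partial>N) + (\<integral>\<^sup>+x. w x * indicator (space N - S) x \<partial>N)"
    by (intro nn_integral_add) measurable
  also have "\<dots> \<le> (\<integral>\<^sup>+x. u x * indicator S x \<partial>N) + (\<integral>\<^sup>+x. u x * indicator (- S) x \<partial>N)"
    using le by (intro add_mono nn_integral_mono) (auto simp: indicator_def)
  finally show "integral\<^sup>S N w \<le> \<dots>" .
qed

text \<open>
  The reason for the factor \<open>s\<close>: the geometric series sums to \<open>s / (1 - 2 powr (- s * q))\<close>, which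
  stays bounded as \<open>s \<rightarrow> 0\<close>.
\<close>

lemma suminf_geometric_weights_le:
  fixes s q :: real
  assumes "0 < s" "s < 1" "0 < q"
  shows "(\<Sum>k. ennreal (s * (2 powr (- (s * q))) ^ k)) \<le> ennreal ((1 + q * ln 2) / (q * ln 2))"
proof -
  let ?b = "2 powr (- (s * q)) :: real" and ?v = "s * q * ln 2 :: real"
  have v: "0 < ?v" using assms by simp
  have b: "?b = 1 / exp ?v" by (simp add: powr_def exp_minus field_simps)
  have "?b \<le> 1 / (1 + ?v)" unfolding b using v by (intro divide_left_mono) (auto intro: mult_pos_pos)
  then have low: "?v / (1 + ?v) \<le> 1 - ?b" using v by (simp add: field_simps)
  have b1: "0 < ?b" "?b < 1" using v by (auto simp: b)
  have "(\<lambda>k. s * ?b ^ k) sums (s * (1 / (1 - ?b)))"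
    using b1 by (intro sums_mult geometric_sums) auto
  then have "(\<Sum>k. ennreal (s * ?b ^ k)) = ennreal (s * (1 / (1 - ?b)))"
    using assms by (intro suminf_ennreal_eq) auto
  also have "s * (1 / (1 - ?b)) \<le> s * (1 / (?v / (1 + ?v)))"
    using low v assms b1 by (intro mult_left_mono divide_left_mono mult_pos_pos divide_pos_pos add_pos_pos) auto
  also have "\<dots> = (1 + ?v) / (q * ln 2)" using assms by (simp add: field_simps)
  also have "\<dots> \<le> (1 + q * ln 2) / (q * ln 2)"
    using assms by (intro divide_right_mono) (auto simp: mult_le_cancel_right1)
  finally show ?thesis by (simp add: ennreal_leI)
qed

lemma abs_diff_powr_le:
  fixes a b :: real
  assumes "0 < q"
  shows "\<bar>a - b\<bar> powr q \<le> 2 powr q * (\<bar>a\<bar> powr q + \<bar>b\<bar> powr q)"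
proof -
  have "\<bar>a - b\<bar> powr q \<le> (2 * max \<bar>a\<bar> \<bar>b\<bar>) powr q"
    using assms by (intro powr_mono2) auto
  also have "\<dots> = 2 powr q * (max \<bar>a\<bar> \<bar>b\<bar>) powr q" by (simp add: powr_mult)
  also have "\<dots> \<le> 2 powr q * (\<bar>a\<bar> powr q + \<bar>b\<bar> powr q)"
    by (intro mult_left_mono) (auto simp: max_def)
  finally show ?thesis .
qed

context doubling_space
begin

text \<open>
  Integrating against this kernel produces weighted averages over the balls \<open>B x (2 ^ Suc k)\<close>. Unlike
  \<open>Umin\<close> it is measurable in \<open>y\<close>.
\<close>

definition annular_kernel :: "(nat \<Rightarrow> real) \<Rightarrow> 'a \<Rightarrow> 'a \<Rightarrow> ennreal" where
  "annular_kernel w x y =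
     (\<Sum>k. ennreal (w k) * (ennreal (1 / V x (2 ^ Suc k)) * indicator (B x (2 ^ Suc k)) y))"

lemma annular_kernel_measurable [measurable]:
  "x \<in> space M \<Longrightarrow> annular_kernel w x \<in> borel_measurable M"
  unfolding annular_kernel_def by measurable

lemma nn_integral_annular_kernel:
  assumes x: "x \<in> space M" and [measurable]: "v \<in> borel_measurable M"
  shows "(\<integral>\<^sup>+y. annular_kernel w x y * v y \<partial>M) = (\<Sum>k. ennreal (w k) * average v x (2 ^ Suc k))"
proof -
  note [measurable] = ball_sets[OF x]
  have "(\<integral>\<^sup>+y. annular_kernel w x y * v y \<partial>M) =
      (\<integral>\<^sup>+y. (\<Sum>k. ennreal (w k) * (ennreal (1 / V x (2 ^ Suc k)) *
          (v y * indicator (B x (2 ^ Suc k)) y))) \<partial>M)"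
    unfolding annular_kernel_def
    by (intro nn_integral_cong) (simp add: ennreal_suminf_multc[symmetric] mult_ac)
  also have "\<dots> = (\<Sum>k. ennreal (w k) * average v x (2 ^ Suc k))"
    by (subst nn_integral_suminf) (simp_all add: nn_integral_cmult)
  finally show ?thesis .
qed

text \<open>
  If \<open>2 ^ k \<le> \<rho> x y < 2 ^ Suc k\<close>, doubling gives \<open>\<mu> (B x (2 ^ Suc k)) \<le> D * Umin M \<rho> x y\<close>, so the
  \<open>k\<close>-th term of the kernel alone suffices.
\<close>

lemma gagliardo_kernel_le_annular_kernel:
  obtains D where "1 \<le> D"
    "\<And>x y e. x \<in> space M \<Longrightarrow> y \<in> space M \<Longrightarrow> 1 \<le> \<rho> x y \<Longrightarrow> 0 < e \<Longrightarrow>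
       ennreal (1 / (Umin M \<rho> x y * \<rho> x y powr e)) \<le>
         ennreal D * annular_kernel (\<lambda>k. (2 powr (- e)) ^ k) x y"
proof -
  obtain D where D: "1 \<le> D" "\<And>x y r. x \<in> space M \<Longrightarrow> y \<in> space M \<Longrightarrow> 0 < r \<Longrightarrow>
     \<rho> x y \<le> 2 * r \<Longrightarrow> V x (2 * r) \<le> D * V y r"
    by (rule ball_comparison[of 2 2]) blast
  show thesis
  proof (rule that[OF D(1)])
    fix x y and e :: real
    assume x: "x \<in> space M" and y: "y \<in> space M" and 1: "1 \<le> \<rho> x y" and e: "0 < e"
    define k where "k = nat \<lfloor>log 2 (\<rho> x y)\<rfloor>"
    have l: "0 \<le> log 2 (\<rho> x y)" using 1 by simp
    have "2 powr real k \<le> \<rho> x y" "\<rho> x y < 2 powr real (Suc k)"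
      using 1 l by (auto simp: k_def le_log_iff[symmetric] log_less_iff[symmetric]) linarith
    then have k: "2 ^ k \<le> \<rho> x y" "\<rho> x y < 2 ^ Suc k" by (simp_all only: powr_realpow zero_less_numeral)
    have kp: "(0::real) < 2 ^ k" by simp
    (* both balls in Umin have radius at least 2 ^ k and a centre at distance below 2 * 2 ^ k from x *)
    have "V x (2 ^ Suc k) \<le> D * V x (2 ^ k)"
      using D(2)[OF x x kp] dist_self[OF x] by simp
    also have "\<dots> \<le> D * V x (\<rho> x y)"
      using D(1) x k 1 by (intro mult_left_mono measure_ball_mono ball_subset_ball_same) auto
    finally have a: "V x (2 ^ Suc k) \<le> D * V x (\<rho> x y)" .
    have "V x (2 ^ Suc k) \<le> D * V y (2 ^ k)"
      using D(2)[OF x y kp] k by simp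
    also have "\<dots> \<le> D * V y (\<rho> x y)"
      using D(1) y k 1 by (intro mult_left_mono measure_ball_mono ball_subset_ball_same) auto
    finally have U: "V x (2 ^ Suc k) \<le> D * Umin M \<rho> x y"
      using a unfolding Umin_def by (auto simp: min_def)
    have Vp: "0 < V x (2 ^ Suc k)" using x by (intro measure_ball_pos) auto
    then have Up: "0 < Umin M \<rho> x y" using U D(1) by (smt (verit) zero_less_mult_pos)
    have "(2 powr e) ^ k = (2 ^ k) powr e"
      by (simp add: powr_realpow[symmetric] powr_powr mult.commute)
    also have "\<dots> \<le> \<rho> x y powr e" using k e by (intro powr_mono2) auto
    finally have re: "(2 powr e) ^ k \<le> \<rho> x y powr e" .
    have "1 / (Umin M \<rho> x y * \<rho> x y powr e) \<le> 1 / (V x (2 ^ Suc k) / D * (2 powr e) ^ k)"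
      using U re Vp D(1) Up 1
      by (intro divide_left_mono mult_mono mult_pos_pos) (auto simp: field_simps)
    also have "\<dots> = D * ((2 powr (- e)) ^ k * (1 / V x (2 ^ Suc k)))"
      using D(1) Vp by (simp add: powr_minus field_simps)
    finally have "ennreal (1 / (Umin M \<rho> x y * \<rho> x y powr e)) \<le>
        ennreal (D * ((2 powr (- e)) ^ k * (1 / V x (2 ^ Suc k))))" by (rule ennreal_leI)
    also have "\<dots> = ennreal D * (ennreal ((2 powr (- e)) ^ k) * ennreal (1 / V x (2 ^ Suc k)))"
      using D(1) Vp by (simp only: ennreal_mult mult_nonneg_nonneg divide_nonneg_pos zero_le_one
          zero_le_power powr_ge_zero order_trans[OF zero_le_one])
    also have "\<dots> = ennreal D * (ennreal ((2 powr (- e)) ^ k) *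
        (ennreal (1 / V x (2 ^ Suc k)) * indicator (B x (2 ^ Suc k)) y))"
      using y k by (simp add: qball_def)
    also have "\<dots> \<le> ennreal D * annular_kernel (\<lambda>k. (2 powr (- e)) ^ k) x y"
      unfolding annular_kernel_def
      using sum_le_suminf[of "\<lambda>k. ennreal ((2 powr (- e)) ^ k) *
        (ennreal (1 / V x (2 ^ Suc k)) * indicator (B x (2 ^ Suc k)) y)" "{k}"]
      by (intro mult_left_mono) auto
    finally show "ennreal (1 / (Umin M \<rho> x y * \<rho> x y powr e)) \<le>
         ennreal D * annular_kernel (\<lambda>k. (2 powr (- e)) ^ k) x y" .
  qed
qed

end

locale orlicz_morrey =
  growth_space M \<rho> K L \<phi> H + orlicz_type \<Phi> p q A
  for M :: "'a measure" and \<rho> K L \<phi> H \<Phi> p q A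
begin

abbreviation gagliardo_integral :: "'a set \<Rightarrow> real \<Rightarrow> ('a \<Rightarrow> real) \<Rightarrow> 'a \<Rightarrow> ennreal" where
  "gagliardo_integral \<Omega> s f x \<equiv> (\<integral>\<^sup>+y\<in>\<Omega>. ennreal (if y = x then 0
     else \<bar>f x - f y\<bar> powr q / (Umin M \<rho> x y * \<rho> x y powr (s * q))) \<partial>M)"

lemma Umin_pos:
  assumes "x \<in> space M" "y \<in> space M" "y \<noteq> x"
  shows "0 < Umin M \<rho> x y"
  using assms dist_pos[of x y] by (auto simp: Umin_def intro!: measure_ball_pos)

text \<open>
  At distances below \<open>1\<close> the kernel increases with the order.
\<close>

lemma gagliardo_integral_near:
  assumes x: "x \<in> \<Omega>" "\<Omega> \<subseteq> space M" and s: "s < s\<^sub>0"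
  shows "(\<integral>\<^sup>+y. ennreal (if y = x then 0
     else \<bar>f x - f y\<bar> powr q / (Umin M \<rho> x y * \<rho> x y powr (s * q))) * indicator \<Omega> y *
       indicator (B x 1) y \<partial>M) \<le> gagliardo_integral \<Omega> s\<^sub>0 f x"
proof (rule nn_integral_mono)
  fix y assume y: "y \<in> space M"
  have xs: "x \<in> space M" using x by auto
  have "\<bar>f x - f y\<bar> powr q / (Umin M \<rho> x y * \<rho> x y powr (s * q)) \<le>
      \<bar>f x - f y\<bar> powr q / (Umin M \<rho> x y * \<rho> x y powr (s\<^sub>0 * q))"
    if "y \<noteq> x" "\<rho> x y < 1"
  proof -
    have d: "0 < \<rho> x y" using dist_pos[OF xs y] that by auto
    have "\<rho> x y powr (s\<^sub>0 * q) \<le> \<rho> x y powr (s * q)"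
      using s q_pos d that by (intro powr_mono') auto
    then show ?thesis
      using Umin_pos[OF xs y that(1)] d by (intro divide_left_mono mult_left_mono mult_pos_pos) auto
  qed
  then show "ennreal (if y = x then 0
     else \<bar>f x - f y\<bar> powr q / (Umin M \<rho> x y * \<rho> x y powr (s * q))) * indicator \<Omega> y *
       indicator (B x 1) y \<le> ennreal (if y = x then 0
     else \<bar>f x - f y\<bar> powr q / (Umin M \<rho> x y * \<rho> x y powr (s\<^sub>0 * q))) * indicator \<Omega> y"
    by (auto simp: indicator_def qball_def intro!: ennreal_leI)
qed

text \<open>
  At distances at least \<open>1\<close>, use \<open>\<bar>f x - f y\<bar> = \<bar>g x - g y\<bar>\<close> and bound \<open>\<bar>g x\<bar>\<close> and \<open>\<bar>g y\<bar>\<close> separately.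
\<close>

lemma gagliardo_integral_le:
  obtains D where "1 \<le> D"
    "\<And>\<Omega> s s\<^sub>0 f g a x. \<Omega> \<in> sets M \<Longrightarrow> x \<in> \<Omega> \<Longrightarrow> g \<in> borel_measurable M \<Longrightarrow>
       AE y in M. y \<in> \<Omega> \<longrightarrow> g y = f y + a \<Longrightarrow> g x = f x + a \<Longrightarrow> 0 < s \<Longrightarrow> s < s\<^sub>0 \<Longrightarrow>
       gagliardo_integral \<Omega> s f x \<le> gagliardo_integral \<Omega> s\<^sub>0 f x +
         ennreal D * (\<Sum>k. ennreal ((2 powr (- (s * q))) ^ k) *
           average (\<lambda>y. ennreal (\<bar>g x\<bar> powr q + \<bar>g y\<bar> powr q)) x (2 ^ Suc k))"
proof -
  obtain D where D: "1 \<le> D"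
    "\<And>x y e. x \<in> space M \<Longrightarrow> y \<in> space M \<Longrightarrow> 1 \<le> \<rho> x y \<Longrightarrow> 0 < e \<Longrightarrow>
       ennreal (1 / (Umin M \<rho> x y * \<rho> x y powr e)) \<le>
         ennreal D * annular_kernel (\<lambda>k. (2 powr (- e)) ^ k) x y"
    by (rule gagliardo_kernel_le_annular_kernel) blast
  show thesis
  proof (rule that[of "D * 2 powr q"])
    show "1 \<le> D * 2 powr q"
      using D(1) q_pos ge_one_powr_ge_zero[of 2 q] mult_mono[of 1 D 1 "2 powr q"] by simp
    fix \<Omega> s s0 f g a x
    assume \<Omega>: "\<Omega> \<in> sets M" and x: "x \<in> \<Omega>" and [measurable]: "g \<in> borel_measurable M"
      and ae: "AE y in M. y \<in> \<Omega> \<longrightarrow> g y = f y + a" and gx: "g x = f x + (a::real)"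
      and s: "0 < (s::real)" "s < s0"
    have \<Omega>': "\<Omega> \<subseteq> space M" using \<Omega> by (rule sets.sets_into_space)
    have xs: "x \<in> space M" using x \<Omega>' by auto
    define u where "u = (\<lambda>y. ennreal (if y = x then 0
       else \<bar>f x - f y\<bar> powr q / (Umin M \<rho> x y * \<rho> x y powr (s * q))) * indicator \<Omega> y)"
    define \<kappa> where "\<kappa> = annular_kernel (\<lambda>k. (2 powr (- (s * q))) ^ k) x"
    define v where "v = (\<lambda>y. ennreal (\<bar>g x\<bar> powr q + \<bar>g y\<bar> powr q))"
    have [measurable]: "\<kappa> \<in> borel_measurable M" "v \<in> borel_measurable M"
      unfolding \<kappa>_def v_def using xs by measurable
    have "(\<integral>\<^sup>+y. u y * indicator (- B x 1) y \<partial>M) \<le> (\<integral>\<^sup>+y. ennreal (D * 2 powr q) * (\<kappa> y * v y) \<partial>M)"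
    proof (intro nn_integral_mono_AE, use ae in eventually_elim)
      fix y assume ae: "y \<in> \<Omega> \<longrightarrow> g y = f y + a"
      show "u y * indicator (- B x 1) y \<le> ennreal (D * 2 powr q) * (\<kappa> y * v y)"
      proof (cases "y \<in> \<Omega> \<and> y \<notin> B x 1 \<and> y \<noteq> x")
        case True
        have ys: "y \<in> space M" and d: "1 \<le> \<rho> x y" using True \<Omega>' by (auto simp: qball_def)
        have "f x - f y = g x - g y" using ae True gx by simp
        then have "u y * indicator (- B x 1) y =
            ennreal (\<bar>g x - g y\<bar> powr q * (1 / (Umin M \<rho> x y * \<rho> x y powr (s * q))))"
          using True by (simp add: u_def)
        also have "\<dots> = ennreal (\<bar>g x - g y\<bar> powr q) *
            ennreal (1 / (Umin M \<rho> x y * \<rho> x y powr (s * q)))"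
          using Umin_pos[OF xs ys] True by (intro ennreal_mult) (auto simp: less_imp_le)
        also have "\<dots> \<le> ennreal (2 powr q * (\<bar>g x\<bar> powr q + \<bar>g y\<bar> powr q)) * (ennreal D * \<kappa> y)"
          unfolding \<kappa>_def using s q_pos
          by (intro mult_mono ennreal_leI abs_diff_powr_le D(2) xs ys d) auto
        also have "\<dots> = ennreal (D * 2 powr q) * (\<kappa> y * v y)"
          unfolding v_def using D(1) by (simp add: ennreal_mult mult_ac)
        finally show ?thesis .
      qed (auto simp: u_def indicator_def)
    qed
    also have "\<dots> = ennreal (D * 2 powr q) * (\<Sum>k. ennreal ((2 powr (- (s * q))) ^ k) *
           average v x (2 ^ Suc k))"
      by (subst nn_integral_cmult) (use xs in \<open>simp_all add: \<kappa>_def nn_integral_annular_kernel\<close>)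
    finally have far: "(\<integral>\<^sup>+y. u y * indicator (- B x 1) y \<partial>M) \<le>
        ennreal (D * 2 powr q) * (\<Sum>k. ennreal ((2 powr (- (s * q))) ^ k) * average v x (2 ^ Suc k))" .
    have "gagliardo_integral \<Omega> s f x = (\<integral>\<^sup>+y. u y \<partial>M)" by (simp add: u_def)
    also have "\<dots> \<le> (\<integral>\<^sup>+y. u y * indicator (B x 1) y \<partial>M) + (\<integral>\<^sup>+y. u y * indicator (- B x 1) y \<partial>M)"
      using xs by (intro nn_integral_split_le) simp
    also have "\<dots> \<le> gagliardo_integral \<Omega> s0 f x +
        ennreal (D * 2 powr q) * (\<Sum>k. ennreal ((2 powr (- (s * q))) ^ k) * average v x (2 ^ Suc k))"
      using gagliardo_integral_near[OF x \<Omega>' s(2)] far by (intro add_mono) (auto simp: u_def)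
    finally show "gagliardo_integral \<Omega> s f x \<le> gagliardo_integral \<Omega> s0 f x +
         ennreal (D * 2 powr q) * (\<Sum>k. ennreal ((2 powr (- (s * q))) ^ k) *
           average (\<lambda>y. ennreal (\<bar>g x\<bar> powr q + \<bar>g y\<bar> powr q)) x (2 ^ Suc k))"
      by (simp add: v_def)
  qed
qed

text \<open>
  The supporting line at \<open>\<tau>\<close>, applied to \<open>\<bar>g y\<bar> / l\<close> and averaged.
\<close>

lemma average_power_le:
  assumes [measurable]: "g \<in> borel_measurable M" and x: "x \<in> space M" and t: "0 < t"
    and l: "0 < l" and \<tau>: "0 < \<tau>" and c: "0 \<le> c"
  shows "average (\<lambda>y. ennreal (c + \<bar>g y\<bar> powr q)) x t \<le>
    ennreal (c + l powr q * \<tau> powr q) +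
    ennreal (l powr q * \<tau> powr q * (A / \<Phi> \<tau>)) * average (\<lambda>y. ennreal (\<Phi> (\<bar>g y\<bar> / l))) x t"
proof -
  let ?c1 = "c + l powr q * \<tau> powr q" and ?c2 = "l powr q * \<tau> powr q * (A / \<Phi> \<tau>)"
  have A\<tau>: "0 \<le> A / \<Phi> \<tau>" using Phi_pos[OF \<tau>] A_ge_1 by simp
  then have c2: "0 \<le> ?c2" by (intro mult_nonneg_nonneg) auto
  note [measurable] = ball_sets[OF x]
  have [measurable]: "(\<lambda>y. \<Phi> (\<bar>g y\<bar> / l)) \<in> borel_measurable M"
    using Phi_measurable[of "\<lambda>y. g y / l" M] l by simp
  have le: "ennreal (c + \<bar>g y\<bar> powr q) \<le> ennreal ?c1 + ennreal ?c2 * ennreal (\<Phi> (\<bar>g y\<bar> / l))" for y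
  proof -
    have "\<bar>g y\<bar> powr q = l powr q * (\<bar>g y\<bar> / l) powr q" using l by (simp add: powr_divide)
    also have "\<dots> \<le> l powr q * (\<tau> powr q + \<tau> powr q * (A / \<Phi> \<tau>) * \<Phi> (\<bar>g y\<bar> / l))"
      using l \<tau> by (intro mult_left_mono power_le_Phi) auto
    finally have "c + \<bar>g y\<bar> powr q \<le> ?c1 + ?c2 * \<Phi> (\<bar>g y\<bar> / l)" by (simp add: algebra_simps)
    then have "ennreal (c + \<bar>g y\<bar> powr q) \<le> ennreal (?c1 + ?c2 * \<Phi> (\<bar>g y\<bar> / l))" by (rule ennreal_leI)
    also have "\<dots> = ennreal ?c1 + ennreal (?c2 * \<Phi> (\<bar>g y\<bar> / l))"
      using c A\<tau> l by (intro ennreal_plus mult_nonneg_nonneg Phi_nonneg add_nonneg_nonneg) auto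
    also have "ennreal (?c2 * \<Phi> (\<bar>g y\<bar> / l)) = ennreal ?c2 * ennreal (\<Phi> (\<bar>g y\<bar> / l))"
      using c2 l by (intro ennreal_mult Phi_nonneg) auto
    finally show ?thesis .
  qed
  have "(\<integral>\<^sup>+y\<in>B x t. ennreal (c + \<bar>g y\<bar> powr q) \<partial>M) \<le>
     (\<integral>\<^sup>+y. ennreal ?c1 * indicator (B x t) y +
        ennreal ?c2 * (ennreal (\<Phi> (\<bar>g y\<bar> / l)) * indicator (B x t) y) \<partial>M)"
    using le by (intro nn_integral_mono) (auto simp: indicator_def)
  also have "\<dots> = ennreal ?c1 * ennreal (V x t) +
      ennreal ?c2 * (\<integral>\<^sup>+y\<in>B x t. ennreal (\<Phi> (\<bar>g y\<bar> / l)) \<partial>M)"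
    using x t by (subst nn_integral_add)
      (auto simp: nn_integral_cmult nn_integral_cmult_indicator emeasure_ball)
  finally have "average (\<lambda>y. ennreal (c + \<bar>g y\<bar> powr q)) x t \<le> ennreal (1 / V x t) *
     (ennreal ?c1 * ennreal (V x t) + ennreal ?c2 * (\<integral>\<^sup>+y\<in>B x t. ennreal (\<Phi> (\<bar>g y\<bar> / l)) \<partial>M))"
    by (intro mult_left_mono) auto
  also have "\<dots> = ennreal ?c1 * (ennreal (1 / V x t) * ennreal (V x t)) +
      ennreal ?c2 * average (\<lambda>y. ennreal (\<Phi> (\<bar>g y\<bar> / l))) x t"
    by (simp add: distrib_left mult_ac)
  also have "ennreal (1 / V x t) * ennreal (V x t) = 1"
    using measure_ball_pos[OF x t] by (simp add: ennreal_mult[symmetric])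
  finally show ?thesis by simp
qed

text \<open>
  Multiplication by \<open>s\<close> bounds the total weight of the averages, so \<open>C\<close> is independent of \<open>s\<close>; \<open>\<tau>\<close> is
  left free because its best value depends on the left-hand side.
\<close>

lemma scaled_gagliardo_integral_le:
  obtains C where "1 \<le> C"
    "\<And>\<Omega> s s\<^sub>0 f g a x l \<tau>. \<Omega> \<in> sets M \<Longrightarrow> x \<in> \<Omega> \<Longrightarrow> g \<in> borel_measurable M \<Longrightarrow>
       AE y in M. y \<in> \<Omega> \<longrightarrow> g y = f y + a \<Longrightarrow> g x = f x + a \<Longrightarrow>
       0 < s \<Longrightarrow> s < s\<^sub>0 \<Longrightarrow> s < 1 \<Longrightarrow> 0 < l \<Longrightarrow> 0 < \<tau> \<Longrightarrow>
       ennreal s * gagliardo_integral \<Omega> s f x \<le> ennreal s * gagliardo_integral \<Omega> s\<^sub>0 f x +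
         (ennreal (C * (\<bar>g x\<bar> powr q + l powr q * \<tau> powr q)) +
          ennreal (C * (l powr q * \<tau> powr q / \<Phi> \<tau>)) *
            far_average (\<lambda>k. s * (2 powr (- (s * q))) ^ k) (\<lambda>y. ennreal (\<Phi> (\<bar>g y\<bar> / l))) x)"
proof -
  obtain D where D: "1 \<le> D"
    "\<And>\<Omega> s s\<^sub>0 f g a x. \<Omega> \<in> sets M \<Longrightarrow> x \<in> \<Omega> \<Longrightarrow> g \<in> borel_measurable M \<Longrightarrow>
       AE y in M. y \<in> \<Omega> \<longrightarrow> g y = f y + a \<Longrightarrow> g x = f x + a \<Longrightarrow> 0 < s \<Longrightarrow> s < s\<^sub>0 \<Longrightarrow>
       gagliardo_integral \<Omega> s f x \<le> gagliardo_integral \<Omega> s\<^sub>0 f x +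
         ennreal D * (\<Sum>k. ennreal ((2 powr (- (s * q))) ^ k) *
           average (\<lambda>y. ennreal (\<bar>g x\<bar> powr q + \<bar>g y\<bar> powr q)) x (2 ^ Suc k))"
    by (rule gagliardo_integral_le) blast
  define W where "W = (1 + q * ln 2) / (q * ln 2)"
  have W: "0 \<le> W" using q_pos by (simp add: W_def)
  show thesis
  proof (rule that[of "D * (W + A)"])
    show "1 \<le> D * (W + A)"
      using D(1) W A_ge_1 mult_mono[of 1 D 1 "W + A"] by simp
    fix \<Omega> s s0 f g a x l \<tau>
    assume \<Omega>: "\<Omega> \<in> sets M" and x: "x \<in> \<Omega>" and g[measurable]: "g \<in> borel_measurable M"
      and ae: "AE y in M. y \<in> \<Omega> \<longrightarrow> g y = f y + a" and gx: "g x = f x + (a::real)"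
      and s: "0 < (s::real)" "s < s0" "s < 1" and l: "0 < (l::real)" and \<tau>: "0 < (\<tau>::real)"
    have xs: "x \<in> space M" using sets.sets_into_space[OF \<Omega>] x by auto
    let ?b = "\<lambda>k. (2 powr (- (s * q))) ^ k"
    let ?E = "far_average (\<lambda>k. s * ?b k) (\<lambda>y. ennreal (\<Phi> (\<bar>g y\<bar> / l))) x"
    let ?av = "\<lambda>k. average (\<lambda>y. ennreal (\<bar>g x\<bar> powr q + \<bar>g y\<bar> powr q)) x (2 ^ Suc k)"
    define c1 where "c1 = \<bar>g x\<bar> powr q + l powr q * \<tau> powr q"
    define c2 where "c2 = l powr q * \<tau> powr q / \<Phi> \<tau>"
    have c: "0 \<le> c1" "0 \<le> c2" using Phi_pos[OF \<tau>] by (auto simp: c1_def c2_def)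
    have "ennreal s * (\<Sum>k. ennreal (?b k) * ?av k) = (\<Sum>k. ennreal (s * ?b k) * ?av k)"
      using s by (subst ennreal_suminf_cmult[symmetric]) (auto simp: ennreal_mult mult_ac)
    also have "\<dots> \<le> (\<Sum>k. ennreal (s * ?b k) * (ennreal c1 + ennreal (A * c2) *
          average (\<lambda>y. ennreal (\<Phi> (\<bar>g y\<bar> / l))) x (2 ^ Suc k)))"
    proof (intro suminf_le mult_left_mono)
      fix k :: nat
      show "?av k \<le> ennreal c1 + ennreal (A * c2) *
          average (\<lambda>y. ennreal (\<Phi> (\<bar>g y\<bar> / l))) x (2 ^ Suc k)"
        using average_power_le[OF g xs _ l \<tau>, of "2 ^ Suc k" "\<bar>g x\<bar> powr q"]
        by (simp add: c1_def c2_def mult_ac)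
    qed auto
    also have "\<dots> = (\<Sum>k. ennreal (s * ?b k)) * ennreal c1 + ennreal (A * c2) * ?E"
      unfolding far_average_def
      by (simp add: distrib_left suminf_add[symmetric] mult.left_commute)
    also have "\<dots> \<le> ennreal W * ennreal c1 + ennreal (A * c2) * ?E"
      unfolding W_def using s q_pos
      by (intro add_right_mono mult_right_mono suminf_geometric_weights_le) auto
    finally have *: "ennreal s * (\<Sum>k. ennreal (?b k) * ?av k) \<le>
        ennreal W * ennreal c1 + ennreal (A * c2) * ?E" .
    have "ennreal s * gagliardo_integral \<Omega> s f x \<le> ennreal s * (gagliardo_integral \<Omega> s0 f x +
         ennreal D * (\<Sum>k. ennreal (?b k) * ?av k))"
      by (intro mult_left_mono D(2)[OF \<Omega> x g ae gx s(1,2)]) simp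
    also have "\<dots> = ennreal s * gagliardo_integral \<Omega> s0 f x +
         ennreal D * (ennreal s * (\<Sum>k. ennreal (?b k) * ?av k))"
      by (simp add: distrib_left mult.left_commute)
    also have "\<dots> \<le> ennreal s * gagliardo_integral \<Omega> s0 f x +
         ennreal D * (ennreal W * ennreal c1 + ennreal (A * c2) * ?E)"
      by (intro add_left_mono mult_left_mono *) simp
    also have "\<dots> = ennreal s * gagliardo_integral \<Omega> s0 f x +
         (ennreal (D * W * c1) + ennreal (D * A * c2) * ?E)"
      using D(1) W c A_ge_1 by (simp add: distrib_left ennreal_mult mult.assoc)
    also have "\<dots> \<le> ennreal s * gagliardo_integral \<Omega> s0 f x +
         (ennreal (D * (W + A) * c1) + ennreal (D * (W + A) * c2) * ?E)"
      using D(1) W c A_ge_1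
      by (intro add_left_mono add_mono mult_right_mono ennreal_leI mult_right_mono mult_left_mono)
        (auto simp: algebra_simps)
    finally show "ennreal s * gagliardo_integral \<Omega> s f x \<le> ennreal s * gagliardo_integral \<Omega> s0 f x +
         (ennreal (D * (W + A) * (\<bar>g x\<bar> powr q + l powr q * \<tau> powr q)) +
          ennreal (D * (W + A) * (l powr q * \<tau> powr q / \<Phi> \<tau>)) * ?E)"
      by (simp add: c1_def c2_def)
  qed
qed

lemma gagliardo_eq:
  "gagliardo M \<rho> \<Omega> s q f x = ennreal_powr (gagliardo_integral \<Omega> s f x) (1 / q)"
  by (simp add: gagliardo_def)

text \<open>
  With \<open>J\<close> and \<open>J0\<close> the scaled Gagliardo functions of orders \<open>s\<close> and \<open>s\<^sub>0\<close> at \<open>x\<close>, the preceding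
  estimate for all \<open>\<tau>\<close> is the hypothesis of \<open>Phi_le_of_power_bound\<close>. Finiteness comes first, from
  \<open>\<tau> = 1\<close>.
\<close>

lemma gagliardo_pointwise:
  obtains \<eta> where "0 < \<eta>"
    "\<And>\<Omega> s s\<^sub>0 f g a x l. \<Omega> \<in> sets M \<Longrightarrow> x \<in> \<Omega> \<Longrightarrow> g \<in> borel_measurable M \<Longrightarrow>
       AE y in M. y \<in> \<Omega> \<longrightarrow> g y = f y + a \<Longrightarrow> g x = f x + a \<Longrightarrow>
       0 < s \<Longrightarrow> s < s\<^sub>0 \<Longrightarrow> s < 1 \<Longrightarrow> 0 < l \<Longrightarrow> morrey_bounded (\<lambda>y. ennreal (\<Phi> (\<bar>g y\<bar> / l))) \<Longrightarrow>
       gagliardo M \<rho> \<Omega> s\<^sub>0 q f x \<noteq> \<infinity> \<Longrightarrow>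
       gagliardo M \<rho> \<Omega> s q f x \<noteq> \<infinity> \<and>
       ennreal (\<Phi> (\<eta> * (s powr (1 / q) * enn2real (gagliardo M \<rho> \<Omega> s q f x) / l))) \<le>
         ennreal (\<Phi> (s powr (1 / q) * enn2real (gagliardo M \<rho> \<Omega> s\<^sub>0 q f x) / l)) +
         ennreal (\<Phi> (\<bar>g x\<bar> / l)) +
         far_average (\<lambda>k. s * (2 powr (- (s * q))) ^ k) (\<lambda>y. ennreal (\<Phi> (\<bar>g y\<bar> / l))) x"
proof -
  obtain C where C: "1 \<le> C"
    "\<And>\<Omega> s s\<^sub>0 f g a x l \<tau>. \<Omega> \<in> sets M \<Longrightarrow> x \<in> \<Omega> \<Longrightarrow> g \<in> borel_measurable M \<Longrightarrow>
       AE y in M. y \<in> \<Omega> \<longrightarrow> g y = f y + a \<Longrightarrow> g x = f x + a \<Longrightarrow>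
       0 < s \<Longrightarrow> s < s\<^sub>0 \<Longrightarrow> s < 1 \<Longrightarrow> 0 < l \<Longrightarrow> 0 < \<tau> \<Longrightarrow>
       ennreal s * gagliardo_integral \<Omega> s f x \<le> ennreal s * gagliardo_integral \<Omega> s\<^sub>0 f x +
         (ennreal (C * (\<bar>g x\<bar> powr q + l powr q * \<tau> powr q)) +
          ennreal (C * (l powr q * \<tau> powr q / \<Phi> \<tau>)) *
            far_average (\<lambda>k. s * (2 powr (- (s * q))) ^ k) (\<lambda>y. ennreal (\<Phi> (\<bar>g y\<bar> / l))) x)"
    by (rule scaled_gagliardo_integral_le) blast
  show thesis
  proof (rule that[of "(1 / (4 * C)) powr (1 / q)"])
    show "0 < (1 / (4 * C)) powr (1 / q)" using C(1) by simp
    fix \<Omega> s s0 f g a x l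
    assume *: "\<Omega> \<in> sets M" "x \<in> \<Omega>" "g \<in> borel_measurable M"
      "AE y in M. y \<in> \<Omega> \<longrightarrow> g y = f y + a" "g x = f x + (a::real)"
      "0 < (s::real)" "s < s0" "s < 1" "0 < (l::real)"
      and mb: "morrey_bounded (\<lambda>y. ennreal (\<Phi> (\<bar>g y\<bar> / l)))"
      and fin0: "gagliardo M \<rho> \<Omega> s0 q f x \<noteq> \<infinity>"
    note s = \<open>0 < s\<close> and l = \<open>0 < l\<close>
    have xs: "x \<in> space M" using sets.sets_into_space[OF *(1)] *(2) by auto
    let ?w = "\<lambda>k. s * (2 powr (- (s * q))) ^ k"
    let ?E = "far_average ?w (\<lambda>y. ennreal (\<Phi> (\<bar>g y\<bar> / l))) x"
    have "(\<Sum>k. ennreal (?w k)) < \<infinity>"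
      using suminf_geometric_weights_le[OF s *(8) q_pos] by (auto intro: order.strict_trans1)
    then have "?E < \<infinity>" by (intro far_average_finite mb xs)
    then obtain e where e: "?E = ennreal e" "0 \<le> e" by (cases ?E) auto
    have "gagliardo_integral \<Omega> s0 f x \<noteq> \<infinity>"
      using fin0 unfolding gagliardo_eq ennreal_powr_def by presburger
    then obtain i0 where i0: "gagliardo_integral \<Omega> s0 f x = ennreal i0" "0 \<le> i0"
      by (cases "gagliardo_integral \<Omega> s0 f x") auto
    have bound: "ennreal s * gagliardo_integral \<Omega> s f x \<le> ennreal (s * i0 +
         (C * (\<bar>g x\<bar> powr q + l powr q * \<tau> powr q) + C * (l powr q * \<tau> powr q / \<Phi> \<tau>) * e))"
      if \<tau>: "0 < \<tau>" for \<tau>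
    proof -
      have "0 \<le> C * (\<bar>g x\<bar> powr q + l powr q * \<tau> powr q)" "0 \<le> C * (l powr q * \<tau> powr q / \<Phi> \<tau>)"
        using C(1) Phi_pos[OF \<tau>] by simp_all
      moreover have "ennreal s * ennreal i0 + (ennreal c\<^sub>1 + ennreal c\<^sub>2 * ennreal e) =
          ennreal (s * i0 + (c\<^sub>1 + c\<^sub>2 * e))" if "0 \<le> c\<^sub>1" "0 \<le> c\<^sub>2" for c\<^sub>1 c\<^sub>2
        using that e(2) i0(2) s by (simp add: ennreal_mult)
      ultimately show ?thesis
        using C(2)[OF * \<tau>] unfolding e(1) i0(1) by presburger
    qed
    have "ennreal s * gagliardo_integral \<Omega> s f x < \<infinity>"
      using bound[of 1] by (auto intro: order.strict_trans1)
    then have fin: "gagliardo_integral \<Omega> s f x \<noteq> \<infinity>"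
      using s by (auto simp: ennreal_mult_less_top)
    then obtain i where i: "gagliardo_integral \<Omega> s f x = ennreal i" "0 \<le> i"
      by (cases "gagliardo_integral \<Omega> s f x") auto
    let ?J = "s powr (1 / q) * i powr (1 / q) / l" and ?N = "s powr (1 / q) * i0 powr (1 / q) / l"
    have powers: "?J powr q = s * i / l powr q" "?N powr q = s * i0 / l powr q"
      using s l i i0 q_pos by (simp_all add: powr_divide powr_mult powr_powr)
    have "\<Phi> ((1 / (4 * C)) powr (1 / q) * ?J) \<le> \<Phi> ?N + \<Phi> (\<bar>g x\<bar> / l) + e"
    proof (rule Phi_le_of_power_bound)
      fix \<tau> :: real assume \<tau>: "0 < \<tau>"
      let ?R = "s * i0 + (C * (\<bar>g x\<bar> powr q + l powr q * \<tau> powr q) +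
          C * (l powr q * \<tau> powr q / \<Phi> \<tau>) * e)"
      have R: "0 \<le> ?R"
        using C(1) Phi_pos[OF \<tau>] e s i0 by (intro add_nonneg_nonneg mult_nonneg_nonneg) auto
      have "s * i \<le> ?R"
        using bound[OF \<tau>] R i s by (simp add: ennreal_mult[symmetric])
      then have "s * i / l powr q \<le> ?R / l powr q" by (intro divide_right_mono) auto
      also have "\<dots> = s * i0 / l powr q +
          C * ((\<bar>g x\<bar> / l) powr q + \<tau> powr q + \<tau> powr q * (e / \<Phi> \<tau>))"
        using l Phi_pos[OF \<tau>] by (simp add: powr_divide field_simps)
      finally show "?J powr q \<le> ?N powr q +
          C * ((\<bar>g x\<bar> / l) powr q + \<tau> powr q + \<tau> powr q * (e / \<Phi> \<tau>))"
        unfolding powers .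
    qed (use l e C in auto)
    moreover have "enn2real (gagliardo M \<rho> \<Omega> s q f x) = i powr (1 / q)"
      "enn2real (gagliardo M \<rho> \<Omega> s0 q f x) = i0 powr (1 / q)"
      unfolding gagliardo_eq i i0 ennreal_powr_def using i i0 by simp_all
    moreover have "gagliardo M \<rho> \<Omega> s q f x \<noteq> \<infinity>"
      unfolding gagliardo_eq i ennreal_powr_def by simp
    moreover have "0 \<le> \<Phi> ?N" "0 \<le> \<Phi> (\<bar>g x\<bar> / l)" using l by (auto intro: Phi_nonneg)
    ultimately show "gagliardo M \<rho> \<Omega> s q f x \<noteq> \<infinity> \<and>
       ennreal (\<Phi> ((1 / (4 * C)) powr (1 / q) * (s powr (1 / q) * enn2real (gagliardo M \<rho> \<Omega> s q f x) / l))) \<le>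
         ennreal (\<Phi> (s powr (1 / q) * enn2real (gagliardo M \<rho> \<Omega> s0 q f x) / l)) +
         ennreal (\<Phi> (\<bar>g x\<bar> / l)) + ?E"
      using e by (simp add: ennreal_plus[symmetric] ennreal_leI del: ennreal_plus)
  qed
qed

end

section \<open>Orlicz--Morrey norms and the upper bound\<close>

context orlicz_morrey
begin

abbreviation om_bounded :: "('a \<Rightarrow> real) \<Rightarrow> real \<Rightarrow> bool" where
  "om_bounded g l \<equiv> morrey_bounded (\<lambda>y. ennreal (\<Phi> (\<bar>g y\<bar> / l)))"

lemma Phi_scaled_measurable [measurable]:
  assumes "0 \<le> l" and [measurable]: "g \<in> borel_measurable N"
  shows "(\<lambda>y. \<Phi> (\<bar>g y\<bar> / l)) \<in> borel_measurable N"
  using Phi_measurable[of "\<lambda>y. g y / l" N] assms by simp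

lemma average_le_iff:
  assumes "x \<in> space M" "0 < r"
  shows "I / emeasure M (B x r) \<le> ennreal (\<phi> x r) \<longleftrightarrow> I \<le> ennreal (\<phi> x r * V x r)"
proof -
  let ?v = "ennreal (V x r)"
  have v: "?v \<noteq> 0" "?v \<noteq> top" "0 < ?v"
    using measure_ball_pos[OF assms] by auto
  have eq: "ennreal (\<phi> x r * V x r) = ennreal (\<phi> x r) * ?v"
    using growth_pos[OF assms] by (intro ennreal_mult) auto
  show ?thesis unfolding emeasure_ball[OF assms] eq
  proof
    assume "I / ?v \<le> ennreal (\<phi> x r)"
    then have "I / ?v * ?v \<le> ennreal (\<phi> x r) * ?v" by (intro mult_right_mono) auto
    then show "I \<le> ennreal (\<phi> x r) * ?v" using v by (simp add: ennreal_divide_times)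
  next
    assume "I \<le> ennreal (\<phi> x r) * ?v"
    then have "I / ?v \<le> ennreal (\<phi> x r) * ?v / ?v" by (intro divide_right_mono_ennreal)
    then show "I / ?v \<le> ennreal (\<phi> x r)" using v by (simp add: ennreal_mult_divide_eq)
  qed
qed

lemma om_bounded_if_norm_less:
  assumes less: "om_norm M \<rho> \<Phi> \<phi> g < ennreal l"
  shows "om_bounded g l"
  unfolding morrey_bounded_def
proof (intro ballI allI impI)
  fix x r assume x: "x \<in> space M" and r: "0 < (r::real)"
  have "om_ball_norm M \<rho> \<Phi> \<phi> x r g \<le> om_norm M \<rho> \<Phi> \<phi> g"
    unfolding om_norm_def using x r by (intro SUP_upper2[of x] SUP_upper2[of r]) auto
  then have "om_ball_norm M \<rho> \<Phi> \<phi> x r g < ennreal l" using less by (rule order.strict_trans1)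
  then obtain l' where l': "0 < l'" "ennreal l' < ennreal l"
    "(\<integral>\<^sup>+y\<in>B x r. ennreal (\<Phi> (\<bar>g y\<bar> / l')) \<partial>M) / emeasure M (B x r) \<le> ennreal (\<phi> x r)"
    unfolding om_ball_norm_def Inf_less_iff by auto
  have ll: "l' < l" using l' by (simp add: ennreal_less_iff)
  have "(\<integral>\<^sup>+y\<in>B x r. ennreal (\<Phi> (\<bar>g y\<bar> / l)) \<partial>M) \<le> (\<integral>\<^sup>+y\<in>B x r. ennreal (\<Phi> (\<bar>g y\<bar> / l')) \<partial>M)"
    using ll l'(1) by (intro nn_integral_mono mult_right_mono ennreal_leI Phi_monoD divide_left_mono) auto
  also have "\<dots> \<le> ennreal (\<phi> x r * V x r)" using l'(3) average_le_iff[OF x r] by blast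
  finally show "(\<integral>\<^sup>+y\<in>B x r. ennreal (\<Phi> (\<bar>g y\<bar> / l)) \<partial>M) \<le> ennreal (\<phi> x r * V x r)" .
qed

lemma om_norm_le_if_bounded:
  assumes "om_bounded g l" "0 < l"
  shows "om_norm M \<rho> \<Phi> \<phi> g \<le> ennreal l"
  unfolding om_norm_def om_ball_norm_def
proof (intro SUP_least Inf_lower)
  fix x and r :: real assume "x \<in> space M" "r \<in> {0<..}"
  then show "ennreal l \<in> {ennreal l |l. 0 < l \<and> (\<integral>\<^sup>+y\<in>B x r. ennreal (\<Phi> (\<bar>g y\<bar> / l)) \<partial>M) /
      emeasure M (B x r) \<le> ennreal (\<phi> x r)}"
    using assms morrey_boundedD[OF assms(1), of x r] average_le_iff[of x r] by auto
qed

text \<open>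
  The modular bound on the unit ball around \<open>x\<close>, shrunk by the lower type until the modular is at
  most \<open>1\<close>, gives the local Orlicz condition.
\<close>

lemma om_bounded_imp_om_space:
  assumes [measurable]: "g \<in> borel_measurable M" and bd: "om_bounded g l" and l: "0 < l"
  shows "g \<in> om_space M \<rho> \<Phi> \<phi>"
proof -
  have "\<exists>r>0. orlicz_norm M \<Phi> (\<lambda>y. g y * indicator (B x r) y) < \<infinity>" if x: "x \<in> space M" for x
  proof -
    let ?F = "\<phi> x 1 * V x 1"
    have F: "0 < ?F" using growth_pos[OF x, of 1] measure_ball_pos[OF x, of 1] by simp
    obtain \<epsilon> where \<epsilon>: "0 < \<epsilon>" "\<And>t. 0 \<le> t \<Longrightarrow> ?F * \<Phi> (\<epsilon> * t) \<le> \<Phi> t"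
      using Phi_shrink[of ?F] F by (metis less_imp_le)
    note [measurable] = ball_sets[OF x]
    have "ennreal ?F * (\<integral>\<^sup>+y. ennreal (\<Phi> (\<bar>g y * indicator (B x 1) y\<bar> / (l / \<epsilon>))) \<partial>M) =
        (\<integral>\<^sup>+y. ennreal ?F * ennreal (\<Phi> (\<bar>g y * indicator (B x 1) y\<bar> / (l / \<epsilon>))) \<partial>M)"
      using l \<epsilon> by (intro nn_integral_cmult[symmetric] measurable_compose[OF _ measurable_ennreal]
        Phi_scaled_measurable) auto
    also have "\<dots> \<le> (\<integral>\<^sup>+y\<in>B x 1. ennreal (\<Phi> (\<bar>g y\<bar> / l)) \<partial>M)"
    proof (intro nn_integral_mono)
      fix y
      have "ennreal ?F * ennreal (\<Phi> (\<epsilon> * (\<bar>g y\<bar> / l))) \<le> ennreal (\<Phi> (\<bar>g y\<bar> / l))"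
        using \<epsilon>(1) \<epsilon>(2)[of "\<bar>g y\<bar> / l"] l F
        by (subst ennreal_mult[symmetric]) (auto intro!: ennreal_leI Phi_nonneg)
      then show "ennreal ?F * ennreal (\<Phi> (\<bar>g y * indicator (B x 1) y\<bar> / (l / \<epsilon>))) \<le>
          ennreal (\<Phi> (\<bar>g y\<bar> / l)) * indicator (B x 1) y"
        by (auto simp: indicator_def Phi_0 mult_ac)
    qed
    also have "\<dots> \<le> ennreal ?F * 1" using morrey_boundedD[OF bd x, of 1] by simp
    finally have "(\<integral>\<^sup>+y. ennreal (\<Phi> (\<bar>g y * indicator (B x 1) y\<bar> / (l / \<epsilon>))) \<partial>M) \<le> 1"
      using F by (subst (asm) ennreal_mult_le_mult_iff) auto
    then have "orlicz_norm M \<Phi> (\<lambda>y. g y * indicator (B x 1) y) \<le> ennreal (l / \<epsilon>)"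
      unfolding orlicz_norm_def using l \<epsilon> by (intro Inf_lower) auto
    then have "orlicz_norm M \<Phi> (\<lambda>y. g y * indicator (B x 1) y) < \<infinity>"
      by (auto intro: order.strict_trans1)
    then show ?thesis by (intro exI[of _ 1]) simp
  qed
  moreover have "om_norm M \<rho> \<Phi> \<phi> g < \<infinity>"
    using om_norm_le_if_bounded[OF bd l] by (auto intro: order.strict_trans1)
  ultimately show ?thesis by (auto simp: om_space_def orlicz_loc_def)
qed

text \<open>
  A constant in front of the modular bound costs only a constant factor in the norm.
\<close>

lemma om_bounded_rescale:
  assumes "0 \<le> C"
  obtains \<epsilon> where "0 < \<epsilon>"
    "\<And>g l. g \<in> borel_measurable M \<Longrightarrow> 0 < l \<Longrightarrow>
      (\<And>x r. x \<in> space M \<Longrightarrow> 0 < r \<Longrightarrow>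
         (\<integral>\<^sup>+y\<in>B x r. ennreal (\<Phi> (\<bar>g y\<bar> / l)) \<partial>M) \<le> ennreal (C * (\<phi> x r * V x r))) \<Longrightarrow>
      om_bounded g (l / \<epsilon>)"
proof -
  have C1: "0 < 1 + C" using assms by simp
  obtain \<epsilon> where \<epsilon>: "0 < \<epsilon>" "\<And>t. 0 \<le> t \<Longrightarrow> (1 + C) * \<Phi> (\<epsilon> * t) \<le> \<Phi> t"
    using Phi_shrink[of "1 + C"] C1 by (metis less_imp_le)
  show thesis
  proof (rule that[OF \<epsilon>(1)])
    fix g and l :: real
    assume [measurable]: "g \<in> borel_measurable M" and l: "0 < l"
      and bd: "\<And>x r. x \<in> space M \<Longrightarrow> 0 < r \<Longrightarrow>
         (\<integral>\<^sup>+y\<in>B x r. ennreal (\<Phi> (\<bar>g y\<bar> / l)) \<partial>M) \<le> ennreal (C * (\<phi> x r * V x r))"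
    show "om_bounded g (l / \<epsilon>)" unfolding morrey_bounded_def
    proof (intro ballI allI impI)
      fix x r assume x: "x \<in> space M" and r: "0 < (r::real)"
      note [measurable] = ball_sets[OF x]
      have F: "0 \<le> \<phi> x r * V x r" using growth_pos[OF x r] by simp
      have "ennreal (1 + C) * (\<integral>\<^sup>+y\<in>B x r. ennreal (\<Phi> (\<bar>g y\<bar> / (l / \<epsilon>))) \<partial>M) =
          (\<integral>\<^sup>+y. ennreal (1 + C) * (ennreal (\<Phi> (\<bar>g y\<bar> / (l / \<epsilon>))) * indicator (B x r) y) \<partial>M)"
        using l \<epsilon>(1) by (intro nn_integral_cmult[symmetric] borel_measurable_times_ennreal
          measurable_compose[OF _ measurable_ennreal] Phi_scaled_measurable) auto
      also have "\<dots> \<le> (\<integral>\<^sup>+y\<in>B x r. ennreal (\<Phi> (\<bar>g y\<bar> / l)) \<partial>M)"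
      proof (intro nn_integral_mono)
        fix y
        have "ennreal (1 + C) * ennreal (\<Phi> (\<epsilon> * (\<bar>g y\<bar> / l))) \<le> ennreal (\<Phi> (\<bar>g y\<bar> / l))"
          using \<epsilon>(1) \<epsilon>(2)[of "\<bar>g y\<bar> / l"] l C1
          by (subst ennreal_mult[symmetric]) (auto intro!: ennreal_leI Phi_nonneg)
        then show "ennreal (1 + C) * (ennreal (\<Phi> (\<bar>g y\<bar> / (l / \<epsilon>))) * indicator (B x r) y) \<le>
            ennreal (\<Phi> (\<bar>g y\<bar> / l)) * indicator (B x r) y"
          by (auto simp: indicator_def mult_ac)
      qed
      also have "\<dots> \<le> ennreal (C * (\<phi> x r * V x r))" by (rule bd[OF x r])
      also have "\<dots> \<le> ennreal ((1 + C) * (\<phi> x r * V x r))"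
        using F by (intro ennreal_leI mult_right_mono) auto
      also have "\<dots> = ennreal (1 + C) * ennreal (\<phi> x r * V x r)"
        using F C1 by (intro ennreal_mult) auto
      finally show "(\<integral>\<^sup>+y\<in>B x r. ennreal (\<Phi> (\<bar>g y\<bar> / (l / \<epsilon>))) \<partial>M) \<le> ennreal (\<phi> x r * V x r)"
        using C1 by (subst (asm) ennreal_mult_le_mult_iff) auto
    qed
  qed
qed

lemma om_norm_on_lessE:
  assumes "om_norm_on M \<rho> \<Phi> \<phi> \<Omega> F < ennreal l"
  obtains g where "g \<in> borel_measurable M" "AE x in M. x \<in> \<Omega> \<longrightarrow> ereal (g x) = F x" "om_bounded g l"
proof -
  obtain g where "g \<in> om_space M \<rho> \<Phi> \<phi>" "AE x in M. x \<in> \<Omega> \<longrightarrow> ereal (g x) = F x"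
    "om_norm M \<rho> \<Phi> \<phi> g < ennreal l"
    using assms unfolding om_norm_on_def INF_less_iff by blast
  then show thesis
    by (intro that[of g] om_bounded_if_norm_less) (auto simp: om_space_def orlicz_loc_def)
qed

lemma om_norm_on_le:
  assumes "g \<in> borel_measurable M" "AE x in M. x \<in> \<Omega> \<longrightarrow> ereal (g x) = F x" "om_bounded g l" "0 < l"
  shows "om_norm_on M \<rho> \<Phi> \<phi> \<Omega> F \<le> ennreal l"
  unfolding om_norm_on_def using assms
  by (intro INF_lower2[of g] om_norm_le_if_bounded) (auto intro: om_bounded_imp_om_space)

text \<open>
  Integrating \<open>gagliardo_pointwise\<close> over a ball: the first two terms satisfy the modular condition by
  hypothesis, the third up to a constant by \<open>far_average_majorant\<close>.
\<close>

lemma gagliardo_norm_le: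
  obtains c where "0 < c"
    "\<And>\<Omega> f g a s s\<^sub>0 g\<^sub>0 l. \<Omega> \<in> sets M \<Longrightarrow> g \<in> borel_measurable M \<Longrightarrow>
       AE y in M. y \<in> \<Omega> \<longrightarrow> g y = f y + a \<Longrightarrow> 0 < l \<Longrightarrow> om_bounded g l \<Longrightarrow>
       g\<^sub>0 \<in> borel_measurable M \<Longrightarrow>
       AE x in M. x \<in> \<Omega> \<longrightarrow> ereal (g\<^sub>0 x) = enn2ereal (gagliardo M \<rho> \<Omega> s\<^sub>0 q f x) \<Longrightarrow>
       0 < s \<Longrightarrow> s < s\<^sub>0 \<Longrightarrow> s < 1 \<Longrightarrow> om_bounded g\<^sub>0 (l / s powr (1 / q)) \<Longrightarrow>
       gagliardo_measurable M \<rho> \<Omega> q f \<Longrightarrow>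
       ennreal (s powr (1 / q)) * gagliardo_norm M \<rho> \<Phi> \<phi> \<Omega> s q f \<le> ennreal (c * l)"
proof -
  obtain \<eta> where \<eta>: "0 < \<eta>" and pointwise:
    "\<And>\<Omega> s s\<^sub>0 f g a x l. \<Omega> \<in> sets M \<Longrightarrow> x \<in> \<Omega> \<Longrightarrow> g \<in> borel_measurable M \<Longrightarrow>
       AE y in M. y \<in> \<Omega> \<longrightarrow> g y = f y + a \<Longrightarrow> g x = f x + a \<Longrightarrow>
       0 < s \<Longrightarrow> s < s\<^sub>0 \<Longrightarrow> s < 1 \<Longrightarrow> 0 < l \<Longrightarrow> om_bounded g l \<Longrightarrow>
       gagliardo M \<rho> \<Omega> s\<^sub>0 q f x \<noteq> \<infinity> \<Longrightarrow>
       gagliardo M \<rho> \<Omega> s q f x \<noteq> \<infinity> \<and>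
       ennreal (\<Phi> (\<eta> * (s powr (1 / q) * enn2real (gagliardo M \<rho> \<Omega> s q f x) / l))) \<le>
         ennreal (\<Phi> (s powr (1 / q) * enn2real (gagliardo M \<rho> \<Omega> s\<^sub>0 q f x) / l)) +
         ennreal (\<Phi> (\<bar>g x\<bar> / l)) +
         far_average (\<lambda>k. s * (2 powr (- (s * q))) ^ k) (\<lambda>y. ennreal (\<Phi> (\<bar>g y\<bar> / l))) x"
    by (rule gagliardo_pointwise) blast
  obtain C :: real where C: "0 \<le> C" and majorant:
    "\<And>v w W x\<^sub>0 r. v \<in> borel_measurable M \<Longrightarrow> morrey_bounded v \<Longrightarrow>
       (\<Sum>k. ennreal (w k)) \<le> ennreal W \<Longrightarrow> 0 \<le> W \<Longrightarrow> x\<^sub>0 \<in> space M \<Longrightarrow> 0 < r \<Longrightarrow>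
       \<exists>A\<in>borel_measurable M. (\<forall>x\<in>B x\<^sub>0 r. far_average w v x \<le> A x) \<and>
         (\<integral>\<^sup>+x\<in>B x\<^sub>0 r. A x \<partial>M) \<le> ennreal (C * W * (\<phi> x\<^sub>0 r * V x\<^sub>0 r))"
    by (rule far_average_majorant) blast
  define W where "W = (1 + q * ln 2) / (q * ln 2)"
  have W: "0 \<le> W" using q_pos by (simp add: W_def)
  have CW: "0 \<le> 2 + C * W" using C W by simp
  obtain \<epsilon> where \<epsilon>: "0 < \<epsilon>" and rescale:
    "\<And>g l. g \<in> borel_measurable M \<Longrightarrow> 0 < l \<Longrightarrow>
      (\<And>x r. x \<in> space M \<Longrightarrow> 0 < r \<Longrightarrow>
         (\<integral>\<^sup>+y\<in>B x r. ennreal (\<Phi> (\<bar>g y\<bar> / l)) \<partial>M) \<le> ennreal ((2 + C * W) * (\<phi> x r * V x r))) \<Longrightarrow>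
      om_bounded g (l / \<epsilon>)"
    by (rule om_bounded_rescale[OF CW]) blast
  show thesis
  proof (rule that[of "1 / (\<epsilon> * \<eta>)"])
    show "0 < 1 / (\<epsilon> * \<eta>)" using \<epsilon> \<eta> by simp
    fix \<Omega> f g a s s0 g0 l
    assume \<Omega>[measurable]: "\<Omega> \<in> sets M" and g[measurable]: "g \<in> borel_measurable M"
      and ae: "AE y in M. y \<in> \<Omega> \<longrightarrow> g y = f y + (a::real)"
      and l: "0 < l" and bd: "om_bounded g l" and g0[measurable]: "g0 \<in> borel_measurable M"
      and ae0: "AE x in M. x \<in> \<Omega> \<longrightarrow> ereal (g0 x) = enn2ereal (gagliardo M \<rho> \<Omega> s0 q f x)"
      and s: "0 < (s::real)" "s < s0" "s < 1" and bd0: "om_bounded g0 (l / s powr (1 / q))"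
      and meas: "gagliardo_measurable M \<rho> \<Omega> q f"
    let ?s = "s powr (1 / q)"
    have sp: "0 < ?s" using s by simp
    obtain h where [measurable]: "h \<in> borel_measurable M"
      and aeh: "AE x in M. x \<in> \<Omega> \<longrightarrow> h x = gagliardo M \<rho> \<Omega> s q f x"
      using meas[unfolded gagliardo_measurable_def, rule_format, of s] s by auto
    define G where "G = (\<lambda>x. indicator \<Omega> x * enn2real (h x))"
    have G[measurable]: "G \<in> borel_measurable M" unfolding G_def by measurable
    let ?v = "\<lambda>y. ennreal (\<Phi> (\<bar>g y\<bar> / l))"
    let ?n = "\<lambda>y. ennreal (\<Phi> (\<bar>g0 y\<bar> / (l / ?s)))"
    have v[measurable]: "?v \<in> borel_measurable M" "?n \<in> borel_measurable M"
      by (intro measurable_compose[OF _ measurable_ennreal] Phi_scaled_measurable g g0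
          divide_nonneg_pos less_imp_le[OF l] sp)+
    let ?E = "far_average (\<lambda>k. s * (2 powr (- (s * q))) ^ k) ?v"
    have point: "AE x in M. (x \<in> \<Omega> \<longrightarrow> ereal (G x) = enn2ereal (gagliardo M \<rho> \<Omega> s q f x)) \<and>
        ennreal (\<Phi> (\<bar>\<eta> * ?s * G x\<bar> / l)) \<le> ?n x + ?v x + ?E x"
      using ae ae0 aeh
    proof eventually_elim
      fix x assume x: "x \<in> \<Omega> \<longrightarrow> g x = f x + a"
        "x \<in> \<Omega> \<longrightarrow> ereal (g0 x) = enn2ereal (gagliardo M \<rho> \<Omega> s0 q f x)"
        "x \<in> \<Omega> \<longrightarrow> h x = gagliardo M \<rho> \<Omega> s q f x"
      show "(x \<in> \<Omega> \<longrightarrow> ereal (G x) = enn2ereal (gagliardo M \<rho> \<Omega> s q f x)) \<and>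
        ennreal (\<Phi> (\<bar>\<eta> * ?s * G x\<bar> / l)) \<le> ?n x + ?v x + ?E x"
      proof (cases "x \<in> \<Omega>")
        case True
        have fin0: "gagliardo M \<rho> \<Omega> s0 q f x \<noteq> \<infinity>" using x(2) True by auto
        have g0x: "\<bar>g0 x\<bar> = enn2real (gagliardo M \<rho> \<Omega> s0 q f x)"
          using x(2) True
          by (metis abs_of_nonneg enn2real_nonneg ereal.inject enn2ereal_ennreal ennreal_enn2real
              fin0 infinity_ennreal_def top.not_eq_extremum)
        have Gx: "G x = enn2real (gagliardo M \<rho> \<Omega> s q f x)" using True x(3) by (simp add: G_def)
        have P: "gagliardo M \<rho> \<Omega> s q f x \<noteq> \<infinity> \<and>
           ennreal (\<Phi> (\<eta> * (?s * G x / l))) \<le>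
           ennreal (\<Phi> (?s * \<bar>g0 x\<bar> / l)) + ?v x + ?E x"
          unfolding Gx g0x using x(1) True by (intro pointwise[OF \<Omega> True g ae _ s l bd fin0]) auto
        have "ereal (G x) = enn2ereal (gagliardo M \<rho> \<Omega> s q f x)"
          unfolding Gx using P
          by (metis enn2ereal_ennreal enn2real_nonneg ennreal_enn2real infinity_ennreal_def
              top.not_eq_extremum)
        moreover have "\<bar>\<eta> * ?s * G x\<bar> = \<eta> * (?s * G x)"
          using \<eta> Gx by (simp add: abs_mult mult.assoc)
        ultimately show ?thesis using P by (simp add: mult.commute)
      qed (simp add: G_def Phi_0)
    qed
    have "om_bounded (\<lambda>x. \<eta> * ?s * G x) (l / \<epsilon>)"
    proof (rule rescale[OF _ l])
      fix x r assume x: "x \<in> space M" and r: "0 < (r::real)"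
      let ?F = "\<phi> x r * V x r"
      have F: "0 \<le> ?F" using growth_pos[OF x r] by simp
      note [measurable] = ball_sets[OF x]
      obtain A where [measurable]: "A \<in> borel_measurable M" and A: "\<forall>y\<in>B x r. ?E y \<le> A y"
         "(\<integral>\<^sup>+y\<in>B x r. A y \<partial>M) \<le> ennreal (C * W * ?F)"
        using majorant[OF v(1) bd suminf_geometric_weights_le[OF s(1,3) q_pos, folded W_def] W x r]
        by blast
      have "(\<integral>\<^sup>+y\<in>B x r. ennreal (\<Phi> (\<bar>\<eta> * ?s * G y\<bar> / l)) \<partial>M) \<le>
          (\<integral>\<^sup>+y. ?n y * indicator (B x r) y + ?v y * indicator (B x r) y + A y * indicator (B x r) y \<partial>M)"
      proof (intro nn_integral_mono_AE, use point in eventually_elim)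
        fix y assume "(y \<in> \<Omega> \<longrightarrow> ereal (G y) = enn2ereal (gagliardo M \<rho> \<Omega> s q f y)) \<and>
          ennreal (\<Phi> (\<bar>\<eta> * ?s * G y\<bar> / l)) \<le> ?n y + ?v y + ?E y"
        then have "ennreal (\<Phi> (\<bar>\<eta> * ?s * G y\<bar> / l)) \<le> ?n y + ?v y + A y" if "y \<in> B x r"
          using A(1) that by (meson add_left_mono order_trans)
        then show "ennreal (\<Phi> (\<bar>\<eta> * ?s * G y\<bar> / l)) * indicator (B x r) y \<le>
          ?n y * indicator (B x r) y + ?v y * indicator (B x r) y + A y * indicator (B x r) y"
          by (simp add: indicator_def)
      qed
      also have "\<dots> = (\<integral>\<^sup>+y\<in>B x r. ?n y \<partial>M) + (\<integral>\<^sup>+y\<in>B x r. ?v y \<partial>M) + (\<integral>\<^sup>+y\<in>B x r. A y \<partial>M)"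
      proof -
        have "(\<integral>\<^sup>+y. u y * indicator (B x r) y + w y * indicator (B x r) y + A y * indicator (B x r) y \<partial>M) =
            (\<integral>\<^sup>+y\<in>B x r. u y \<partial>M) + (\<integral>\<^sup>+y\<in>B x r. w y \<partial>M) + (\<integral>\<^sup>+y\<in>B x r. A y \<partial>M)"
          if [measurable]: "u \<in> borel_measurable M" "w \<in> borel_measurable M" for u w
          by (simp add: nn_integral_add)
        from this[OF v(2,1)] show ?thesis .
      qed
      also have "\<dots> \<le> ennreal ?F + ennreal ?F + ennreal (C * W * ?F)"
        by (intro add_mono morrey_boundedD[OF bd0 x r] morrey_boundedD[OF bd x r] A(2))
      also have "\<dots> = ennreal (?F + ?F + C * W * ?F)"
        using F C W by (simp only: ennreal_plus mult_nonneg_nonneg add_nonneg_nonneg)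
      also have "?F + ?F + C * W * ?F = (2 + C * W) * ?F" by (simp add: algebra_simps)
      finally show "(\<integral>\<^sup>+y\<in>B x r. ennreal (\<Phi> (\<bar>\<eta> * ?s * G y\<bar> / l)) \<partial>M) \<le>
        ennreal ((2 + C * W) * ?F)" .
    qed simp
    moreover have "\<bar>\<eta> * ?s * G y\<bar> / (l / \<epsilon>) = \<bar>G y\<bar> / (l / (\<epsilon> * \<eta> * ?s))" for y
      using \<eta> sp by (simp add: abs_mult mult_ac)
    ultimately have "om_bounded G (l / (\<epsilon> * \<eta> * ?s))" by (simp only:)
    then have "gagliardo_norm M \<rho> \<Phi> \<phi> \<Omega> s q f \<le> ennreal (l / (\<epsilon> * \<eta> * ?s))"
      unfolding gagliardo_norm_def using point l \<epsilon> \<eta> sp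
      by (intro om_norm_on_le[OF G]) (auto elim: eventually_mono)
    then have "ennreal ?s * gagliardo_norm M \<rho> \<Phi> \<phi> \<Omega> s q f \<le>
        ennreal ?s * ennreal (l / (\<epsilon> * \<eta> * ?s))" by (intro mult_left_mono) auto
    also have "\<dots> = ennreal (?s * (l / (\<epsilon> * \<eta> * ?s)))"
      using l \<epsilon> \<eta> sp by (intro ennreal_mult[symmetric]) auto
    also have "?s * (l / (\<epsilon> * \<eta> * ?s)) = 1 / (\<epsilon> * \<eta>) * l" using sp by simp
    finally show "ennreal ?s * gagliardo_norm M \<rho> \<Phi> \<phi> \<Omega> s q f \<le> ennreal (1 / (\<epsilon> * \<eta>) * l)" .
  qed
qed

text \<open>
  A function \<open>g\<^sub>0\<close> of norm below \<open>l\<^sub>0\<close> that represents the Gagliardo function of order \<open>s\<^sub>0\<close> has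
  \<open>s powr (1 / q) * l\<^sub>0 < l\<close> for small \<open>s\<close>; this is why the constant does not depend on the size of
  the Gagliardo norm of order \<open>s\<^sub>0\<close>.
\<close>

lemma eventually_gagliardo_norm_le:
  obtains c where "0 < c"
    "\<And>\<Omega> f g a s\<^sub>0 l. \<Omega> \<in> sets M \<Longrightarrow> g \<in> borel_measurable M \<Longrightarrow>
       AE y in M. y \<in> \<Omega> \<longrightarrow> g y = f y + a \<Longrightarrow> 0 < l \<Longrightarrow> om_bounded g l \<Longrightarrow>
       0 < s\<^sub>0 \<Longrightarrow> gagliardo_norm M \<rho> \<Phi> \<phi> \<Omega> s\<^sub>0 q f < \<infinity> \<Longrightarrow>
       gagliardo_measurable M \<rho> \<Omega> q f \<Longrightarrow>
       \<forall>\<^sub>F s in at_right 0.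
         ennreal (s powr (1 / q)) * gagliardo_norm M \<rho> \<Phi> \<phi> \<Omega> s q f \<le> ennreal (c * l)"
proof -
  obtain c where c: "0 < c"
    "\<And>\<Omega> f g a s s\<^sub>0 g\<^sub>0 l. \<Omega> \<in> sets M \<Longrightarrow> g \<in> borel_measurable M \<Longrightarrow>
       AE y in M. y \<in> \<Omega> \<longrightarrow> g y = f y + a \<Longrightarrow> 0 < l \<Longrightarrow> om_bounded g l \<Longrightarrow>
       g\<^sub>0 \<in> borel_measurable M \<Longrightarrow>
       AE x in M. x \<in> \<Omega> \<longrightarrow> ereal (g\<^sub>0 x) = enn2ereal (gagliardo M \<rho> \<Omega> s\<^sub>0 q f x) \<Longrightarrow>
       0 < s \<Longrightarrow> s < s\<^sub>0 \<Longrightarrow> s < 1 \<Longrightarrow> om_bounded g\<^sub>0 (l / s powr (1 / q)) \<Longrightarrow>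
       gagliardo_measurable M \<rho> \<Omega> q f \<Longrightarrow>
       ennreal (s powr (1 / q)) * gagliardo_norm M \<rho> \<Phi> \<phi> \<Omega> s q f \<le> ennreal (c * l)"
    by (rule gagliardo_norm_le) blast
  show thesis
  proof (rule that[OF c(1)])
    fix \<Omega> f g a s0 l
    assume *: "\<Omega> \<in> sets M" "g \<in> borel_measurable M" "AE y in M. y \<in> \<Omega> \<longrightarrow> g y = f y + (a::real)"
      "0 < (l::real)" "om_bounded g l"
      and s0: "0 < (s0::real)" and fin: "gagliardo_norm M \<rho> \<Phi> \<phi> \<Omega> s0 q f < \<infinity>"
      and meas: "gagliardo_measurable M \<rho> \<Omega> q f"
    obtain l0 where l0: "0 < l0" "gagliardo_norm M \<rho> \<Phi> \<phi> \<Omega> s0 q f < ennreal l0"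
    proof -
      obtain n where "gagliardo_norm M \<rho> \<Phi> \<phi> \<Omega> s0 q f = ennreal n" "0 \<le> n"
        using fin by (cases "gagliardo_norm M \<rho> \<Phi> \<phi> \<Omega> s0 q f") auto
      then show thesis by (intro that[of "n + 1"]) (auto simp: ennreal_less_iff)
    qed
    obtain g0 where g0: "g0 \<in> borel_measurable M"
      "AE x in M. x \<in> \<Omega> \<longrightarrow> ereal (g0 x) = enn2ereal (gagliardo M \<rho> \<Omega> s0 q f x)" "om_bounded g0 l0"
      using l0(2) unfolding gagliardo_norm_def by (rule om_norm_on_lessE)
    have "((\<lambda>s. s powr (1 / q) * l0) \<longlongrightarrow> 0 powr (1 / q) * l0) (at_right 0)"
      using q_pos by (intro tendsto_intros tendsto_powr2) (auto simp: eventually_at_filter)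
    then have "((\<lambda>s. s powr (1 / q) * l0) \<longlongrightarrow> 0) (at_right 0)" by simp
    then have "\<forall>\<^sub>F s in at_right 0. s powr (1 / q) * l0 < l" by (rule order_tendstoD) fact
    moreover have "\<forall>\<^sub>F s in at_right 0. s \<in> {0<..<min s0 (1::real)}"
      using s0 by (intro eventually_at_right_real) auto
    ultimately show "\<forall>\<^sub>F s in at_right 0.
         ennreal (s powr (1 / q)) * gagliardo_norm M \<rho> \<Phi> \<phi> \<Omega> s q f \<le> ennreal (c * l)"
    proof eventually_elim
      fix s assume small: "s powr (1 / q) * l0 < l" and s: "s \<in> {0<..<min s0 (1::real)}"
      have sp: "0 < s powr (1 / q)" using s by simp
      have "om_bounded g0 (l / s powr (1 / q))"
        unfolding morrey_bounded_def
      proof (intro ballI allI impI)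
        fix x r assume x: "x \<in> space M" and r: "0 < (r::real)"
        have "l0 \<le> l / s powr (1 / q)" using small sp by (simp add: field_simps)
        then have "(\<integral>\<^sup>+y\<in>B x r. ennreal (\<Phi> (\<bar>g0 y\<bar> / (l / s powr (1 / q)))) \<partial>M) \<le>
            (\<integral>\<^sup>+y\<in>B x r. ennreal (\<Phi> (\<bar>g0 y\<bar> / l0)) \<partial>M)"
          using l0 *(4) sp by (intro nn_integral_mono mult_right_mono ennreal_leI Phi_monoD
              divide_left_mono divide_nonneg_nonneg) auto
        also have "\<dots> \<le> ennreal (\<phi> x r * V x r)" by (rule morrey_boundedD[OF g0(3) x r])
        finally show "(\<integral>\<^sup>+y\<in>B x r. ennreal (\<Phi> (\<bar>g0 y\<bar> / (l / s powr (1 / q)))) \<partial>M) \<le>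
          ennreal (\<phi> x r * V x r)" .
      qed
      then show "ennreal (s powr (1 / q)) * gagliardo_norm M \<rho> \<Phi> \<phi> \<Omega> s q f \<le> ennreal (c * l)"
        using s by (intro c(2)[OF * g0(1,2) _ _ _ _ meas]) auto
    qed
  qed
qed

end

section \<open>Pointwise lower estimate of the Gagliardo function\<close>

context doubling_space
begin

text \<open>
  Iterating the growth factor \<open>c > 1\<close> reaches any prescribed factor \<open>T\<close>.
\<close>

lemma WRD_iterated:
  assumes "WRD M \<rho>"
  obtains x0 where "x0 \<in> space M"
    "\<And>T. \<exists>\<Lambda>>1. \<exists>R>0. \<forall>r\<ge>R. T * V x0 r \<le> V x0 (\<Lambda> * r)"
proof -
  obtain x0 l C where x0: "x0 \<in> space M" and l: "1 < l" and C: "1 < C"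
    and lim: "ereal C \<le> Liminf at_top (\<lambda>r. ereal (V x0 (l * r) / V x0 r))"
    using assms unfolding WRD_def by blast
  define c where "c = (1 + C) / 2"
  have c: "1 < c" "c < C" using C by (auto simp: c_def)
  have "ereal c < Liminf at_top (\<lambda>r. ereal (V x0 (l * r) / V x0 r))"
    by (rule order.strict_trans2[OF _ lim]) (use c in simp)
  then have "\<forall>\<^sub>F r in at_top. ereal c < ereal (V x0 (l * r) / V x0 r)" by (rule less_LiminfD)
  then obtain R0 where R0: "\<And>r. R0 \<le> r \<Longrightarrow> c < V x0 (l * r) / V x0 r"
    by (auto simp: eventually_at_top_linorder)
  define R where "R = max R0 1"
  have step: "c * V x0 r \<le> V x0 (l * r)" if "R \<le> r" for r
  proof -
    have "0 < V x0 r" using that x0 by (intro measure_ball_pos) (auto simp: R_def)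
    then show ?thesis using R0[of r] that by (auto simp: R_def field_simps)
  qed
  have iter: "c ^ m * V x0 r \<le> V x0 (l ^ m * r)" if "R \<le> r" for m r
  proof (induction m)
    case (Suc m)
    have "1 * r \<le> l ^ m * r" using l that by (intro mult_right_mono) (auto simp: R_def)
    then have "R \<le> l ^ m * r" using that by linarith
    have "c ^ Suc m * V x0 r \<le> c * V x0 (l ^ m * r)" using Suc c by (simp add: mult.assoc)
    also have "\<dots> \<le> V x0 (l * (l ^ m * r))" by (rule step) fact
    finally show ?case by (simp add: mult.assoc)
  qed simp
  show thesis
  proof (rule that[OF x0])
    fix T :: real
    obtain m where m: "T < c ^ m" using real_arch_pow[OF c(1)] by blast
    have "\<forall>r\<ge>R. T * V x0 r \<le> V x0 (l ^ Suc m * r)"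
    proof (intro allI impI)
      fix r assume r: "R \<le> r"
      have "c ^ m \<le> c ^ Suc m" using c by (intro power_increasing) auto
      then have "T \<le> c ^ Suc m" using m by linarith
      then have "T * V x0 r \<le> c ^ Suc m * V x0 r" by (intro mult_right_mono) auto
      also have "\<dots> \<le> V x0 (l ^ Suc m * r)" by (rule iter[OF r])
      finally show "T * V x0 r \<le> V x0 (l ^ Suc m * r)" .
    qed
    moreover have "1 < l ^ Suc m" using l by (rule power_gt1)
    moreover have "0 < R" by (simp add: R_def)
    ultimately show "\<exists>\<Lambda>>1. \<exists>R>0. \<forall>r\<ge>R. T * V x0 r \<le> V x0 (\<Lambda> * r)" by blast
  qed
qed

text \<open>
  The centres in the two hypotheses are unrelated to each other and to \<open>x\<close>, but balls of a radius
  exceeding all the distances involved are contained in one another after enlargement by \<open>2 * K\<close>.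
  The resulting chain of inclusions loses the density factor \<open>C / 2\<close>, which reverse doubling with
  factor \<open>4 / C\<close> regains twofold. The ratio \<open>\<Lambda>\<close> is the same for all \<open>x\<close>; only \<open>R\<close> depends on \<open>x\<close>.
\<close>

lemma wide_annuli_meet_domain:
  assumes WRD: "WRD M \<rho>" and WMD: "WMD M \<rho> \<Omega>" and \<Omega>: "\<Omega> \<in> sets M"
  obtains \<Lambda> where "1 < \<Lambda>"
    "\<And>x. x \<in> space M \<Longrightarrow> \<exists>R>0. \<forall>r\<ge>R. 2 * V x r \<le> measure M (B x (\<Lambda> * r) \<inter> \<Omega>)"
proof -
  obtain x0 where x0: "x0 \<in> space M"
    and growth: "\<And>T. \<exists>\<Lambda>>1. \<exists>R>0. \<forall>r\<ge>R. T * V x0 r \<le> V x0 (\<Lambda> * r)"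
    using WRD by (rule WRD_iterated) blast
  obtain x1 C where x1: "x1 \<in> space M" and C: "0 < C"
    and lim: "ereal C \<le> Liminf at_top (\<lambda>r. ereal (measure M (B x1 r \<inter> \<Omega>) / V x1 r))"
    using WMD unfolding WMD_def by blast
  have "ereal (C / 2) < Liminf at_top (\<lambda>r. ereal (measure M (B x1 r \<inter> \<Omega>) / V x1 r))"
    by (rule order.strict_trans2[OF _ lim]) (use C in simp)
  then have "\<forall>\<^sub>F r in at_top. ereal (C / 2) < ereal (measure M (B x1 r \<inter> \<Omega>) / V x1 r)"
    by (rule less_LiminfD)
  then obtain R1 where R1: "\<And>r. R1 \<le> r \<Longrightarrow> C / 2 < measure M (B x1 r \<inter> \<Omega>) / V x1 r"
    by (auto simp: eventually_at_top_linorder)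
  obtain \<Lambda> R0 where \<Lambda>: "1 < \<Lambda>" and R0: "0 < R0" "\<And>r. R0 \<le> r \<Longrightarrow> 4 / C * V x0 r \<le> V x0 (\<Lambda> * r)"
    using growth[of "4 / C"] by blast
  let ?k = "2 * K"
  have k: "1 \<le> ?k" using K_ge_1 by simp
  let ?L = "?k * (?k * (\<Lambda> * ?k))"
  show thesis
  proof (rule that[of ?L])
    have "1 \<le> ?k * (?k * ?k)" using k mult_mono[of 1 ?k 1 "?k * ?k"] mult_mono[of 1 ?k 1 ?k] by simp
    then have "\<Lambda> * 1 \<le> \<Lambda> * (?k * (?k * ?k))" using \<Lambda> by (intro mult_left_mono) auto
    then have "1 < \<Lambda> * (?k * (?k * ?k))" using \<Lambda> by linarith
    then show "1 < ?L" by (simp add: mult_ac)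
    fix x assume x: "x \<in> space M"
    define R where "R = max 1 (max R0 (max R1 (max (\<rho> x0 x) (max (\<rho> x1 x0) (\<rho> x x1)))))"
    show "\<exists>R>0. \<forall>r\<ge>R. 2 * V x r \<le> measure M (B x (?L * r) \<inter> \<Omega>)"
    proof (intro exI[of _ R] conjI allI impI)
      show "0 < R" by (simp add: R_def)
      fix r assume r: "R \<le> r"
      then have r': "1 \<le> r" "R0 \<le> r" "R1 \<le> r" "\<rho> x0 x \<le> r" "\<rho> x1 x0 \<le> r" "\<rho> x x1 \<le> r"
        by (auto simp: R_def)
      have grow: "t \<le> ?k * t" if "r \<le> t" for t
        using k that r' mult_right_mono[of 1 ?k t] by simp
      let ?a = "?k * r"
      let ?b = "\<Lambda> * ?a"
      let ?c = "?k * ?b"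
      have a: "r \<le> ?a" by (rule grow) simp
      have "1 * ?a \<le> \<Lambda> * ?a" using \<Lambda> a r' by (intro mult_right_mono) auto
      then have b: "r \<le> ?b" using a by linarith
      have c: "r \<le> ?c" using grow[OF b] b by linarith
      have c0: "0 < ?c" using c r' by linarith
      have incl: "B y t \<subseteq> B z (?k * t)" if "y \<in> space M" "z \<in> space M" "\<rho> z y \<le> r" "r \<le> t" for y z t
      proof (rule ball_subset_ball)
        have "K * (\<rho> z y + t) \<le> K * (t + t)" using that K_ge_1 by (intro mult_left_mono) auto
        then show "K * (\<rho> z y + t) \<le> ?k * t" by simp
      qed (use that in auto)
      have "2 * V x r \<le> 2 * V x0 ?a"
        using incl[OF x x0 r'(4)] a x x0 r' by (intro mult_left_mono measure_ball_mono) auto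
      also have "\<dots> = C / 2 * (4 / C * V x0 ?a)" using C by simp
      also have "\<dots> \<le> C / 2 * V x0 ?b"
        using C R0(2)[of ?a] a r' by (intro mult_left_mono) auto
      also have "\<dots> \<le> C / 2 * V x1 ?c"
        by (intro mult_left_mono measure_ball_mono incl x0 x1 r'(5) b c0) (use C in simp)
      also have "\<dots> \<le> measure M (B x1 ?c \<inter> \<Omega>)"
      proof -
        have "0 < V x1 ?c" by (rule measure_ball_pos[OF x1 c0])
        moreover have "C / 2 < measure M (B x1 ?c \<inter> \<Omega>) / V x1 ?c"
          by (rule R1[OF order_trans[OF r'(3) c]])
        ultimately show ?thesis by (simp only: pos_less_divide_eq less_imp_le)
      qed
      also have "\<dots> \<le> measure M (B x (?k * ?c) \<inter> \<Omega>)"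
      proof (rule measure_mono_fmeasurable)
        show "B x1 ?c \<inter> \<Omega> \<subseteq> B x (?k * ?c) \<inter> \<Omega>" using incl[OF x1 x r'(6) c] by blast
        have "0 < ?k * ?c" using grow[OF c] c r' by linarith
        then show "B x (?k * ?c) \<inter> \<Omega> \<in> fmeasurable M"
          by (intro fmeasurable_Int_fmeasurable fmeasurable_ball x \<Omega>)
        show "B x1 ?c \<inter> \<Omega> \<in> sets M" using x1 \<Omega> by simp
      qed
      also have "?k * ?c = ?L * r" by (simp add: mult_ac)
      finally show "2 * V x r \<le> measure M (B x (?L * r) \<inter> \<Omega>)" .
    qed
  qed
qed

end

context orlicz_morrey
begin

text \<open>
  The supporting line at a small \<open>\<tau>\<close> bounds the average by \<open>\<delta> / 2\<close> plus a multiple of \<open>\<phi> x r\<close>.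
\<close>

lemma power_average_vanishes:
  assumes g: "g \<in> borel_measurable M" and bd: "om_bounded g l" and l: "0 < l"
    and x: "x \<in> space M" and \<delta>: "0 < \<delta>"
  obtains R where "0 < R"
    "\<And>r. R \<le> r \<Longrightarrow> (\<integral>\<^sup>+y\<in>B x r. ennreal (\<bar>g y\<bar> powr q) \<partial>M) \<le> ennreal (\<delta> * V x r)"
proof -
  define \<tau> where "\<tau> = (\<delta> / 2) powr (1 / q) / l"
  have \<tau>: "0 < \<tau>" using \<delta> l by (simp add: \<tau>_def)
  have l\<tau>: "l powr q * \<tau> powr q = \<delta> / 2"
  proof -
    have "l * \<tau> = (\<delta> / 2) powr (1 / q)" using l by (simp add: \<tau>_def)
    then have "(l * \<tau>) powr q = \<delta> / 2" using \<delta> q_pos by (simp add: powr_powr)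
    then show ?thesis by (simp only: powr_mult)
  qed
  define c where "c = \<delta> / 2 * (A / \<Phi> \<tau>)"
  have c: "0 \<le> c" using \<delta> A_ge_1 Phi_pos[OF \<tau>] by (simp add: c_def)
  have "((\<lambda>r. c * \<phi> x r) \<longlongrightarrow> c * 0) at_top" by (intro tendsto_intros growth_vanishes x)
  then have "\<forall>\<^sub>F r in at_top. c * \<phi> x r < \<delta> / 2" using \<delta> by (intro order_tendstoD(2)) auto
  then obtain R where R: "\<And>r. R \<le> r \<Longrightarrow> c * \<phi> x r < \<delta> / 2"
    by (auto simp: eventually_at_top_linorder)
  show thesis
  proof (rule that[of "max R 1"])
    fix r assume r: "max R 1 \<le> r"
    then have r0: "0 < r" by simp
    let ?v = "ennreal (V x r)" and ?I = "\<integral>\<^sup>+y\<in>B x r. ennreal (\<bar>g y\<bar> powr q) \<partial>M"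
    have "average (\<lambda>y. ennreal (0 + \<bar>g y\<bar> powr q)) x r \<le> ennreal (0 + l powr q * \<tau> powr q) +
        ennreal (l powr q * \<tau> powr q * (A / \<Phi> \<tau>)) * average (\<lambda>y. ennreal (\<Phi> (\<bar>g y\<bar> / l))) x r"
      by (rule average_power_le[OF g x r0 l \<tau>]) simp
    also have "\<dots> \<le> ennreal (\<delta> / 2) + ennreal c * ennreal (\<phi> x r)"
      unfolding l\<tau> c_def[symmetric]
      by (intro add_mono mult_left_mono average_le_growth[OF bd x r0]) auto
    also have "\<dots> = ennreal (\<delta> / 2 + c * \<phi> x r)"
      using \<delta> c growth_pos[OF x r0] by (simp add: ennreal_mult)
    also have "\<dots> \<le> ennreal \<delta>" using R[of r] r by (intro ennreal_leI) auto
    finally have "?v * (ennreal (1 / V x r) * ?I) \<le> ?v * ennreal \<delta>" by (intro mult_left_mono) auto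
    moreover have "?v * (ennreal (1 / V x r) * ?I) = ?I"
    proof -
      have "?v * ennreal (1 / V x r) = 1"
        using measure_ball_pos[OF x r0] by (simp add: ennreal_mult[symmetric])
      then show ?thesis by (simp add: mult.assoc[symmetric])
    qed
    ultimately show "?I \<le> ennreal (\<delta> * V x r)"
      using \<delta> by (simp add: ennreal_mult mult.commute)
  qed simp
qed

end

text \<open>
  Counterpart of \<open>suminf_geometric_weights_le\<close>: \<open>s\<close> times the series tends to \<open>1 / (q * ln \<Lambda>)\<close>
  however many initial terms are dropped, so half of that is a lower bound for small \<open>s\<close>.
\<close>

lemma eventually_geometric_tail_ge:
  fixes \<Lambda> q :: real
  assumes "1 < \<Lambda>" "0 < q"
  shows "\<forall>\<^sub>F s in at_right 0.
    ennreal (1 / (2 * q * ln \<Lambda>)) \<le> ennreal s * (\<Sum>j. ennreal ((\<Lambda> ^ Suc (n + j)) powr (- (s * q))))"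
proof -
  have "((\<lambda>s. (\<Lambda> ^ Suc n) powr (- (s * q))) \<longlongrightarrow> (\<Lambda> ^ Suc n) powr (- (0 * q))) (at_right 0)"
    using assms by (intro tendsto_intros) auto
  then have "\<forall>\<^sub>F s in at_right 0. 1 / 2 < (\<Lambda> ^ Suc n) powr (- (s * q))"
    using assms by (intro order_tendstoD(1)) auto
  moreover have "\<forall>\<^sub>F s in at_right 0. s \<in> {0<..<1::real}"
    by (intro eventually_at_right_real) auto
  ultimately show ?thesis
  proof eventually_elim
    fix s :: real assume half: "1 / 2 < (\<Lambda> ^ Suc n) powr (- (s * q))" and s: "s \<in> {0<..<1}"
    let ?b = "\<Lambda> powr (- (s * q))" and ?a = "(\<Lambda> ^ Suc n) powr (- (s * q))"
    have lnL: "0 < ln \<Lambda>" using assms by simp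
    have v: "0 < s * q * ln \<Lambda>" using s assms lnL by simp
    have b: "?b = exp (- (s * q * ln \<Lambda>))" using assms by (simp add: powr_def)
    have b1: "0 < ?b" "?b < 1" using v assms by (auto simp: b)
    have low: "1 - ?b \<le> s * q * ln \<Lambda>"
      using exp_ge_add_one_self[of "- (s * q * ln \<Lambda>)"] unfolding b by linarith
    have "(\<lambda>j. ?a * ?b ^ j) sums (?a * (1 / (1 - ?b)))"
      using b1 by (intro sums_mult geometric_sums) auto
    moreover have "(\<Lambda> ^ Suc (n + j)) powr (- (s * q)) = ?a * ?b ^ j" for j
    proof -
      have "?b ^ j = (\<Lambda> ^ j) powr (- (s * q))"
        using assms by (simp add: powr_realpow[symmetric] powr_powr mult_ac)
      moreover have "\<Lambda> ^ Suc (n + j) = \<Lambda> ^ Suc n * \<Lambda> ^ j" by (simp add: power_add)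
      ultimately show ?thesis by (simp only: powr_mult)
    qed
    ultimately have "(\<Sum>j. ennreal ((\<Lambda> ^ Suc (n + j)) powr (- (s * q)))) = ennreal (?a * (1 / (1 - ?b)))"
      by (intro suminf_ennreal_eq) auto
    then have "ennreal s * (\<Sum>j. ennreal ((\<Lambda> ^ Suc (n + j)) powr (- (s * q)))) =
        ennreal (s * (?a * (1 / (1 - ?b))))"
      using s b1 by (subst ennreal_mult) auto
    moreover have "1 / (2 * q * ln \<Lambda>) \<le> s * (?a * (1 / (1 - ?b)))"
    proof -
      have "1 / (2 * q * ln \<Lambda>) = s * (1 / 2 * (1 / (s * q * ln \<Lambda>)))" using s by simp
      also have "\<dots> \<le> s * (?a * (1 / (1 - ?b)))"
        using s half low b1 v by (intro mult_left_mono mult_mono divide_left_mono) auto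
      finally show ?thesis .
    qed
    ultimately show "ennreal (1 / (2 * q * ln \<Lambda>)) \<le>
        ennreal s * (\<Sum>j. ennreal ((\<Lambda> ^ Suc (n + j)) powr (- (s * q))))" by (simp add: ennreal_leI)
  qed
qed

context orlicz_morrey
begin

text \<open>
  Average \<open>\<bar>g x\<bar> powr q \<le> 2 powr q * (\<bar>g x - g y\<bar> powr q + \<bar>g y\<bar> powr q)\<close> over \<open>S\<close>; the smallness of
  the average of \<open>\<bar>g\<bar> powr q\<close> leaves half of the left-hand side to the first term.
\<close>

lemma annulus_difference_ge:
  assumes S: "S \<in> sets M" "S \<subseteq> B x R" and g[measurable]: "g \<in> borel_measurable M" and v: "0 \<le> v"
    and mS: "ennreal v \<le> emeasure M S"
    and avg: "(\<integral>\<^sup>+y\<in>B x R. ennreal (\<bar>g y\<bar> powr q) \<partial>M) \<le>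
      ennreal (\<bar>g x\<bar> powr q / (2 * 2 powr q) * v)"
  shows "ennreal (\<bar>g x\<bar> powr q / (2 * 2 powr q) * v) \<le> (\<integral>\<^sup>+y\<in>S. ennreal (\<bar>g x - g y\<bar> powr q) \<partial>M)"
proof -
  note [measurable] = S(1)
  let ?t = "\<bar>g x\<bar> powr q / 2 powr q" and ?h = "\<bar>g x\<bar> powr q / (2 * 2 powr q) * v"
  let ?I = "\<integral>\<^sup>+y\<in>S. ennreal (\<bar>g x - g y\<bar> powr q) \<partial>M"
  have h: "0 \<le> ?h" using v by simp
  have le: "?t \<le> \<bar>g x - g y\<bar> powr q + \<bar>g y\<bar> powr q" for y
    using abs_diff_powr_le[OF q_pos, of "g x - g y" "- g y"] by (simp add: field_simps)
  have "ennreal ?h + ennreal ?h = ennreal (?t * v)"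
    using h by (simp add: ennreal_plus[symmetric] field_simps del: ennreal_plus)
  also have "\<dots> = ennreal ?t * ennreal v" using v by (intro ennreal_mult) auto
  also have "\<dots> \<le> ennreal ?t * emeasure M S" by (intro mult_left_mono mS) auto
  also have "\<dots> = (\<integral>\<^sup>+y\<in>S. ennreal ?t \<partial>M)" using S(1) by (simp add: nn_integral_cmult_indicator)
  also have "\<dots> \<le> (\<integral>\<^sup>+y. ennreal (\<bar>g x - g y\<bar> powr q) * indicator S y +
      ennreal (\<bar>g y\<bar> powr q) * indicator S y \<partial>M)"
    using le by (intro nn_integral_mono)
      (auto simp: indicator_def ennreal_plus[symmetric] intro!: ennreal_leI simp del: ennreal_plus)
  also have "\<dots> = ?I + (\<integral>\<^sup>+y\<in>S. ennreal (\<bar>g y\<bar> powr q) \<partial>M)"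
    by (rule nn_integral_add) measurable
  also have "(\<integral>\<^sup>+y\<in>S. ennreal (\<bar>g y\<bar> powr q) \<partial>M) \<le> (\<integral>\<^sup>+y\<in>B x R. ennreal (\<bar>g y\<bar> powr q) \<partial>M)"
    using S(2) by (intro nn_integral_mono) (auto simp: indicator_def)
  also have "\<dots> \<le> ennreal ?h" by (rule avg)
  finally have "ennreal ?h + ennreal ?h \<le> ?I + ennreal ?h" by (simp add: add_left_mono)
  then show "ennreal ?h \<le> ?I"
    using ennreal_add_left_cancel_le[of "ennreal ?h" "ennreal ?h" ?I] by (simp add: add.commute)
qed

text \<open>
  Sum the contributions of the annuli of radii \<open>\<Lambda> ^ k\<close> from some \<open>k = n\<close> on, beyond which the annuli
  are wide and the averages of \<open>\<bar>g\<bar> powr q\<close> are small. The index \<open>n\<close> depends on \<open>x\<close> and \<open>g\<close>, but by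
  \<open>eventually_geometric_tail_ge\<close> the limit does not.
\<close>

lemma gagliardo_integral_ge:
  assumes WRD: "WRD M \<rho>" and WMD: "WMD M \<rho> \<Omega>" and \<Omega>: "\<Omega> \<in> sets M"
  obtains c where "0 < c"
    "\<And>f g a l x. x \<in> \<Omega> \<Longrightarrow> g \<in> borel_measurable M \<Longrightarrow>
       AE y in M. y \<in> \<Omega> \<longrightarrow> g y = f y + a \<Longrightarrow> g x = f x + a \<Longrightarrow> 0 < l \<Longrightarrow> om_bounded g l \<Longrightarrow>
       \<forall>\<^sub>F s in at_right 0.
         ennreal (c * \<bar>g x\<bar> powr q) \<le> ennreal s * gagliardo_integral \<Omega> s f x"
proof -
  obtain \<Lambda> where \<Lambda>: "1 < \<Lambda>"
    and annuli: "\<And>x. x \<in> space M \<Longrightarrow> \<exists>R>0. \<forall>r\<ge>R. 2 * V x r \<le> measure M (B x (\<Lambda> * r) \<inter> \<Omega>)"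
    using WRD WMD \<Omega> by (rule wide_annuli_meet_domain) blast
  obtain D where D: "1 \<le> D" "\<And>x y r. x \<in> space M \<Longrightarrow> y \<in> space M \<Longrightarrow> 0 < r \<Longrightarrow>
     \<rho> x y \<le> 0 * r \<Longrightarrow> V x (\<Lambda> * r) \<le> D * V y r"
    by (rule ball_comparison[of 0 \<Lambda>]) blast
  define c where "c = 1 / (2 * q * ln \<Lambda>) / (2 * 2 powr q * D)"
  have c: "0 < c" using q_pos \<Lambda> D by (simp add: c_def)
  show thesis
  proof (rule that[OF c])
    fix f g a l x
    assume x: "x \<in> \<Omega>" and g[measurable]: "g \<in> borel_measurable M"
      and ae: "AE y in M. y \<in> \<Omega> \<longrightarrow> g y = f y + (a::real)" and gx: "g x = f x + a"
      and l: "0 < (l::real)" and bd: "om_bounded g l"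
    have xs: "x \<in> space M" and \<Omega>': "\<Omega> \<subseteq> space M" using x sets.sets_into_space[OF \<Omega>] by auto
    note [measurable] = ball_sets[OF xs] \<Omega>
    show "\<forall>\<^sub>F s in at_right 0.
         ennreal (c * \<bar>g x\<bar> powr q) \<le> ennreal s * gagliardo_integral \<Omega> s f x"
    proof (cases "g x = 0")
      case False
      (* what an annulus is left with, relative to the measure of its inner ball *)
      define h where "h = \<bar>g x\<bar> powr q / (2 * 2 powr q)"
      have h: "0 < h" using False by (simp add: h_def)
      (* the averages are taken over the outer ball, whence the doubling constant *)
      have hD: "0 < h / D" using h D by simp
      obtain R1 where R1: "0 < R1" "\<And>r. R1 \<le> r \<Longrightarrow> 2 * V x r \<le> measure M (B x (\<Lambda> * r) \<inter> \<Omega>)"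
        using annuli[OF xs] by blast
      obtain R2 where R2: "0 < R2" "\<And>r. R2 \<le> r \<Longrightarrow>
          (\<integral>\<^sup>+y\<in>B x r. ennreal (\<bar>g y\<bar> powr q) \<partial>M) \<le> ennreal (h / D * V x r)"
        using power_average_vanishes[OF g bd l xs hD] by blast
      obtain n where n: "max R1 R2 < \<Lambda> ^ n" using real_arch_pow[OF \<Lambda>] by blast
      define r where "r = (\<lambda>j::nat. \<Lambda> ^ (n + j))"
      have rS: "r (Suc j) = \<Lambda> * r j" for j by (simp add: r_def)
      have r_mono: "mono r" unfolding r_def using \<Lambda> by (intro monoI power_increasing) auto
      have r_ge: "R1 \<le> r j" "R2 \<le> r j" "0 < r j" for j
      proof -
        have "r 0 \<le> r j" using r_mono by (simp add: monoD)
        then show "R1 \<le> r j" "R2 \<le> r j" "0 < r j" using n R1(1) by (auto simp: r_def)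
      qed
      define S where "S = (\<lambda>j. (B x (r (Suc j)) - B x (r j)) \<inter> \<Omega>)"
      have S[measurable]: "S j \<in> sets M" for j unfolding S_def by measurable
      have S_sub: "S j \<subseteq> B x (r (Suc j))" "S j \<subseteq> \<Omega>" for j by (auto simp: S_def)
      have disj: "disjoint_family S"
        unfolding disjoint_family_on_def
      proof (intro ballI impI)
        have "S i \<inter> S j = {}" if "i < j" for i j
        proof -
          have "r (Suc i) \<le> r j" using that r_mono by (auto intro: monoD)
          then show ?thesis by (auto simp: S_def qball_def)
        qed
        then show "S i \<inter> S j = {}" if "i \<noteq> j" for i j
          using that by (metis Int_commute linorder_neq_iff)
      qed
      have doubling: "V x (r (Suc j)) \<le> D * V x (r j)" for j
        unfolding rS using D(2)[OF xs xs r_ge(3)] dist_self[OF xs] by simp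
      have Vp: "0 < V x (r j)" for j using r_ge(3) xs by (intro measure_ball_pos)
      have S_measure: "ennreal (V x (r j)) \<le> emeasure M (S j)" for j
      proof -
        have fm: "B x (r (Suc j)) \<inter> \<Omega> \<in> fmeasurable M"
          using xs r_ge(3) by (intro fmeasurable_Int_fmeasurable fmeasurable_ball \<Omega>)
        have "2 * V x (r j) \<le> measure M (B x (r (Suc j)) \<inter> \<Omega>)"
          unfolding rS by (rule R1(2)[OF r_ge(1)])
        also have "\<dots> \<le> measure M (S j \<union> B x (r j))"
          using xs r_ge(3) fm
          by (intro measure_mono_fmeasurable fmeasurable.Un fmeasurable_ball)
            (auto simp: S_def intro: fmeasurableI2[OF fm])
        also have "\<dots> \<le> measure M (S j) + V x (r j)" by (intro measure_Un_le) (use xs in auto)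
        finally have "V x (r j) \<le> measure M (S j)" by simp
        moreover have "S j \<in> fmeasurable M" by (rule fmeasurableI2[OF fm]) (auto simp: S_def)
        ultimately show ?thesis by (simp add: emeasure_eq_measure2 ennreal_leI)
      qed
      have diff_ge: "ennreal (h * V x (r j)) \<le> (\<integral>\<^sup>+y\<in>S j. ennreal (\<bar>g x - g y\<bar> powr q) \<partial>M)" for j
        unfolding h_def
      proof (rule annulus_difference_ge[OF S S_sub(1) g _ S_measure])
        have "h / D * V x (r (Suc j)) \<le> h / D * (D * V x (r j))"
          using hD by (intro mult_left_mono doubling) auto
        then have "h / D * V x (r (Suc j)) \<le> h * V x (r j)" using D(1) by simp
        then show "(\<integral>\<^sup>+y\<in>B x (r (Suc j)). ennreal (\<bar>g y\<bar> powr q) \<partial>M) \<le>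
            ennreal (\<bar>g x\<bar> powr q / (2 * 2 powr q) * V x (r j))"
          unfolding h_def[symmetric]
          by (intro order_trans[OF R2(2)[OF r_ge(2)]] ennreal_leI)
      qed simp
      have lower: "ennreal (h / D) * (\<Sum>j. ennreal (r (Suc j) powr (- (s * q)))) \<le>
          gagliardo_integral \<Omega> s f x" if s: "0 < s" for s
      proof -
        define w where "w = (\<lambda>j. r (Suc j) powr (- (s * q)) / (D * V x (r j)))"
        have w: "0 \<le> w j" for j using D Vp[of j] by (simp add: w_def)
        have "ennreal (h / D) * (\<Sum>j. ennreal (r (Suc j) powr (- (s * q)))) =
            (\<Sum>j. ennreal (w j) * ennreal (h * V x (r j)))"
        proof (subst ennreal_suminf_cmult[symmetric], intro suminf_cong)
          fix j
          have "h / D * r (Suc j) powr (- (s * q)) = w j * (h * V x (r j))"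
            using Vp[of j] D(1) by (simp add: w_def)
          then show "ennreal (h / D) * ennreal (r (Suc j) powr (- (s * q))) =
              ennreal (w j) * ennreal (h * V x (r j))"
            using hD h w[of j] by (simp add: ennreal_mult[symmetric])
        qed
        also have "\<dots> \<le> (\<Sum>j. ennreal (w j) * (\<integral>\<^sup>+y\<in>S j. ennreal (\<bar>g x - g y\<bar> powr q) \<partial>M))"
          by (intro suminf_le mult_left_mono diff_ge) auto
        also have "\<dots> = (\<integral>\<^sup>+y. (\<Sum>j. ennreal (w j) * (ennreal (\<bar>g x - g y\<bar> powr q) * indicator (S j) y)) \<partial>M)"
          by (simp add: nn_integral_suminf nn_integral_cmult)
        also have "\<dots> \<le> gagliardo_integral \<Omega> s f x"
        proof (intro nn_integral_mono_AE, use ae in eventually_elim)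
          fix y assume ae: "y \<in> \<Omega> \<longrightarrow> g y = f y + a"
          let ?u = "ennreal (if y = x then 0
            else \<bar>f x - f y\<bar> powr q / (Umin M \<rho> x y * \<rho> x y powr (s * q))) * indicator \<Omega> y"
          have "(\<Sum>j. ennreal (w j) * (ennreal (\<bar>g x - g y\<bar> powr q) * indicator (S j) y)) =
              (\<Sum>j. ennreal (w j) * ennreal (\<bar>g x - g y\<bar> powr q) * indicator (S j) y)"
            by (simp add: mult.assoc)
          also have "\<dots> \<le> ?u"
          proof (cases "\<exists>j. y \<in> S j")
            case True
            then obtain j where j: "y \<in> S j" by blast
            then have y: "y \<in> \<Omega>" "y \<in> space M" "\<rho> x y < r (Suc j)" "r j \<le> \<rho> x y"
              by (auto simp: S_def qball_def)
            have yx: "y \<noteq> x" using y(4) r_ge(3)[of j] dist_self[OF xs] by auto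
            have d: "0 < \<rho> x y" using y(4) r_ge(3)[of j] by linarith
            have "Umin M \<rho> x y \<le> V x (\<rho> x y)" by (simp add: Umin_def)
            also have "\<dots> \<le> V x (r (Suc j))"
              using xs y r_ge(3) by (intro measure_ball_mono ball_subset_ball_same) auto
            also have "\<dots> \<le> D * V x (r j)" by (rule doubling)
            finally have U: "Umin M \<rho> x y \<le> D * V x (r j)" .
            have p: "\<rho> x y powr (s * q) \<le> r (Suc j) powr (s * q)"
              using d y s q_pos by (intro powr_mono2) auto
            have "w j * \<bar>g x - g y\<bar> powr q =
                \<bar>g x - g y\<bar> powr q / (D * V x (r j) * r (Suc j) powr (s * q))"
              by (simp add: w_def powr_minus field_simps)
            also have "\<dots> \<le> \<bar>g x - g y\<bar> powr q / (Umin M \<rho> x y * \<rho> x y powr (s * q))"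
              using U p Umin_pos[OF xs y(2) yx] d D(1) Vp[of j] r_ge(3)[of "Suc j"]
              by (intro divide_left_mono mult_mono mult_pos_pos) auto
            finally have "ennreal (w j * \<bar>g x - g y\<bar> powr q) \<le>
                ennreal (\<bar>g x - g y\<bar> powr q / (Umin M \<rho> x y * \<rho> x y powr (s * q)))"
              by (rule ennreal_leI)
            moreover have "g x - g y = f x - f y" using ae y gx by simp
            ultimately have "ennreal (w j * \<bar>g x - g y\<bar> powr q) \<le> ?u"
              using y yx by simp
            moreover have "(\<Sum>j. ennreal (w j) * ennreal (\<bar>g x - g y\<bar> powr q) * indicator (S j) y) =
                ennreal (w j) * ennreal (\<bar>g x - g y\<bar> powr q)"
              using suminf_cmult_indicator[OF disj j, of "\<lambda>j. ennreal (w j) * ennreal (\<bar>g x - g y\<bar> powr q)"]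
              by simp
            ultimately show ?thesis using w[of j] by (simp add: ennreal_mult)
          qed simp
          finally show "(\<Sum>j. ennreal (w j) * (ennreal (\<bar>g x - g y\<bar> powr q) * indicator (S j) y)) \<le> ?u" .
        qed
        finally show ?thesis .
      qed
      have rj: "r (Suc j) = \<Lambda> ^ Suc (n + j)" for j by (simp add: r_def)
      have "\<forall>\<^sub>F s in at_right 0. ennreal (1 / (2 * q * ln \<Lambda>)) \<le>
          ennreal s * (\<Sum>j. ennreal (r (Suc j) powr (- (s * q))))"
        unfolding rj by (rule eventually_geometric_tail_ge[OF \<Lambda> q_pos])
      moreover have "\<forall>\<^sub>F s in at_right 0. 0 < (s::real)" by (simp add: eventually_at_filter)
      ultimately show ?thesis
      proof eventually_elim
        fix s :: real
        assume geo: "ennreal (1 / (2 * q * ln \<Lambda>)) \<le>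
          ennreal s * (\<Sum>j. ennreal (r (Suc j) powr (- (s * q))))" and s: "0 < s"
        have "ennreal (c * \<bar>g x\<bar> powr q) = ennreal (h / D * (1 / (2 * q * ln \<Lambda>)))"
          by (simp add: c_def h_def mult_ac)
        also have "\<dots> = ennreal (h / D) * ennreal (1 / (2 * q * ln \<Lambda>))"
          using hD q_pos \<Lambda> by (intro ennreal_mult) auto
        also have "\<dots> \<le> ennreal (h / D) * (ennreal s * (\<Sum>j. ennreal (r (Suc j) powr (- (s * q)))))"
          by (intro mult_left_mono geo) auto
        also have "\<dots> \<le> ennreal s * gagliardo_integral \<Omega> s f x"
          unfolding mult.left_commute[of "ennreal (h / D)"] by (intro mult_left_mono lower s) auto
        finally show "ennreal (c * \<bar>g x\<bar> powr q) \<le> ennreal s * gagliardo_integral \<Omega> s f x" .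
      qed
    qed simp
  qed
qed

lemma gagliardo_ge:
  assumes WRD: "WRD M \<rho>" and WMD: "WMD M \<rho> \<Omega>" and \<Omega>: "\<Omega> \<in> sets M"
  obtains C where "0 < C"
    "\<And>f g a l x. x \<in> \<Omega> \<Longrightarrow> g \<in> borel_measurable M \<Longrightarrow>
       AE y in M. y \<in> \<Omega> \<longrightarrow> g y = f y + a \<Longrightarrow> g x = f x + a \<Longrightarrow> 0 < l \<Longrightarrow> om_bounded g l \<Longrightarrow>
       \<forall>\<^sub>F s in at_right 0.
         ennreal \<bar>g x\<bar> \<le> ennreal (C * s powr (1 / q)) * gagliardo M \<rho> \<Omega> s q f x"
proof -
  obtain c where c: "0 < c"
    "\<And>f g a l x. x \<in> \<Omega> \<Longrightarrow> g \<in> borel_measurable M \<Longrightarrow>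
       AE y in M. y \<in> \<Omega> \<longrightarrow> g y = f y + a \<Longrightarrow> g x = f x + a \<Longrightarrow> 0 < l \<Longrightarrow> om_bounded g l \<Longrightarrow>
       \<forall>\<^sub>F s in at_right 0.
         ennreal (c * \<bar>g x\<bar> powr q) \<le> ennreal s * gagliardo_integral \<Omega> s f x"
    using assms by (rule gagliardo_integral_ge) blast
  define C where "C = (1 / c) powr (1 / q)"
  have C: "0 < C" using c by (simp add: C_def)
  show thesis
  proof (rule that[OF C])
    fix f g a l x
    assume *: "x \<in> \<Omega>" "g \<in> borel_measurable M" "AE y in M. y \<in> \<Omega> \<longrightarrow> g y = f y + (a::real)"
      "g x = f x + a" "0 < (l::real)" "om_bounded g l"
    have "\<forall>\<^sub>F s in at_right 0. 0 < (s::real)" by (simp add: eventually_at_filter)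
    with c(2)[OF *] show "\<forall>\<^sub>F s in at_right 0.
         ennreal \<bar>g x\<bar> \<le> ennreal (C * s powr (1 / q)) * gagliardo M \<rho> \<Omega> s q f x"
    proof eventually_elim
      fix s :: real
      assume le: "ennreal (c * \<bar>g x\<bar> powr q) \<le> ennreal s * gagliardo_integral \<Omega> s f x" and s: "0 < s"
      show "ennreal \<bar>g x\<bar> \<le> ennreal (C * s powr (1 / q)) * gagliardo M \<rho> \<Omega> s q f x"
      proof (cases "gagliardo_integral \<Omega> s f x")
        case top
        then have "gagliardo M \<rho> \<Omega> s q f x = \<infinity>" by (simp add: gagliardo_eq ennreal_powr_def)
        then show ?thesis using C s by (simp add: ennreal_mult_top)
      next
        case (real i)
        then have "c * \<bar>g x\<bar> powr q \<le> s * i"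
          using le s by (simp add: ennreal_mult[symmetric])
        then have "\<bar>g x\<bar> powr q \<le> 1 / c * s * i" using c by (simp add: field_simps)
        then have "(\<bar>g x\<bar> powr q) powr (1 / q) \<le> (1 / c * s * i) powr (1 / q)"
          using q_pos by (intro powr_mono2) auto
        then have "\<bar>g x\<bar> \<le> C * s powr (1 / q) * i powr (1 / q)"
          unfolding C_def powr_mult[symmetric] using q_pos by (simp add: powr_powr)
        moreover have "gagliardo M \<rho> \<Omega> s q f x = ennreal (i powr (1 / q))"
          unfolding gagliardo_eq real(2) ennreal_powr_def using real(1) by simp
        ultimately show ?thesis using C by (simp add: ennreal_mult[symmetric] ennreal_leI)
      qed
    qed
  qed
qed

section \<open>The lower bound for the norms\<close>

text \<open>
  Fatou's lemma along \<open>s n \<rightarrow> 0\<close> with small norms. As \<open>\<Phi>\<close> may jump, it is the eventual pointwise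
  inequality, and not a limit of the Gagliardo functions, that passes through \<open>\<Phi>\<close>. The extension of \<open>f + a\<close> that realises the bound is the one by zero.
\<close>

lemma om_norm_on_le_gagliardo_norm:
  assumes WRD: "WRD M \<rho>" and WMD: "WMD M \<rho> \<Omega>" and \<Omega>: "\<Omega> \<in> sets M"
  obtains C where "0 < C"
    "\<And>f g a l v. g \<in> borel_measurable M \<Longrightarrow> AE y in M. y \<in> \<Omega> \<longrightarrow> g y = f y + a \<Longrightarrow>
       0 < l \<Longrightarrow> om_bounded g l \<Longrightarrow> 0 < v \<Longrightarrow>
       \<exists>\<^sub>F s in at_right 0. ennreal (s powr (1 / q)) * gagliardo_norm M \<rho> \<Phi> \<phi> \<Omega> s q f < ennreal v \<Longrightarrow>
       om_norm_on M \<rho> \<Phi> \<phi> \<Omega> (\<lambda>x. ereal (f x + a)) \<le> ennreal (C * v)"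
proof -
  obtain C where C: "0 < C"
    and point: "\<And>f g a l x. x \<in> \<Omega> \<Longrightarrow> g \<in> borel_measurable M \<Longrightarrow>
       AE y in M. y \<in> \<Omega> \<longrightarrow> g y = f y + a \<Longrightarrow> g x = f x + a \<Longrightarrow> 0 < l \<Longrightarrow> om_bounded g l \<Longrightarrow>
       \<forall>\<^sub>F s in at_right 0.
         ennreal \<bar>g x\<bar> \<le> ennreal (C * s powr (1 / q)) * gagliardo M \<rho> \<Omega> s q f x"
    using assms by (rule gagliardo_ge) blast
  show thesis
  proof (rule that[OF C])
    fix f g a l v
    assume g[measurable]: "g \<in> borel_measurable M" and ae: "AE y in M. y \<in> \<Omega> \<longrightarrow> g y = f y + (a::real)"
      and l: "0 < (l::real)" and bd: "om_bounded g l" and v: "0 < (v::real)"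
      and freq: "\<exists>\<^sub>F s in at_right 0.
        ennreal (s powr (1 / q)) * gagliardo_norm M \<rho> \<Phi> \<phi> \<Omega> s q f < ennreal v"
    note [measurable] = \<Omega>
    have "\<exists>s. 0 < s \<and> s < 1 / real (Suc n) \<and>
        ennreal (s powr (1 / q)) * gagliardo_norm M \<rho> \<Phi> \<phi> \<Omega> s q f < ennreal v" for n
    proof -
      have "\<forall>\<^sub>F s in at_right 0. s \<in> {0<..<1 / real (Suc n)}"
        by (intro eventually_at_right_real) simp
      from frequently_ex[OF frequently_eventually_frequently[OF freq this]] show ?thesis by auto
    qed
    then obtain s where s: "\<And>n. 0 < s n" "\<And>n. s n < 1 / real (Suc n)"
      "\<And>n. ennreal (s n powr (1 / q)) * gagliardo_norm M \<rho> \<Phi> \<phi> \<Omega> (s n) q f < ennreal v"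
      by metis
    have "s \<longlonglongrightarrow> 0"
      using s(1,2) by (intro tendsto_sandwich[OF _ _ tendsto_const LIMSEQ_Suc[OF lim_inverse_n']])
        (auto intro!: always_eventually less_imp_le simp: inverse_eq_divide)
    then have s_lim: "filterlim s (at_right 0) sequentially"
      using s(1) by (auto simp: filterlim_at less_imp_neq[THEN not_sym])
    define t where "t = (\<lambda>n. s n powr (1 / q))"
    have t: "0 < t n" for n using s(1)[of n] by (simp add: t_def)
    have "gagliardo_norm M \<rho> \<Phi> \<phi> \<Omega> (s n) q f < ennreal (v / t n)" for n
    proof (rule ccontr)
      assume "\<not> ?thesis"
      then have "ennreal (t n) * ennreal (v / t n) \<le> ennreal (t n) * gagliardo_norm M \<rho> \<Phi> \<phi> \<Omega> (s n) q f"
        by (intro mult_left_mono) auto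
      also have "\<dots> < ennreal v" using s(3)[of n] by (simp add: t_def)
      finally show False using t[of n] v by (simp add: ennreal_mult[symmetric])
    qed
    then have "\<exists>G. G \<in> borel_measurable M \<and>
        (AE x in M. x \<in> \<Omega> \<longrightarrow> ereal (G x) = enn2ereal (gagliardo M \<rho> \<Omega> (s n) q f x)) \<and>
        om_bounded G (v / t n)" for n
      unfolding gagliardo_norm_def by (rule om_norm_on_lessE) blast
    then have "\<exists>G. \<forall>n. G n \<in> borel_measurable M \<and>
        (AE x in M. x \<in> \<Omega> \<longrightarrow> ereal (G n x) = enn2ereal (gagliardo M \<rho> \<Omega> (s n) q f x)) \<and>
        om_bounded (G n) (v / t n)"
      by (intro choice allI)
    then obtain G where G[measurable]: "\<And>n. G n \<in> borel_measurable M"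
      and aeG: "\<And>n. AE x in M. x \<in> \<Omega> \<longrightarrow> ereal (G n x) = enn2ereal (gagliardo M \<rho> \<Omega> (s n) q f x)"
      and bdG: "\<And>n. om_bounded (G n) (v / t n)"
      by blast
    let ?g = "\<lambda>x. indicator \<Omega> x * g x"
    have vt: "0 < v / t n" for n using v t[of n] by simp
    have le: "AE x in M. ennreal (\<Phi> (\<bar>?g x\<bar> / (C * v))) \<le>
        liminf (\<lambda>n. ennreal (\<Phi> (\<bar>G n x\<bar> / (v / t n))))"
      using ae aeG[THEN AE_all_countable[THEN iffD2, OF allI]]
    proof eventually_elim
      fix x assume gx: "x \<in> \<Omega> \<longrightarrow> g x = f x + a"
        and Gx: "\<forall>n. x \<in> \<Omega> \<longrightarrow> ereal (G n x) = enn2ereal (gagliardo M \<rho> \<Omega> (s n) q f x)"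
      show "ennreal (\<Phi> (\<bar>?g x\<bar> / (C * v))) \<le> liminf (\<lambda>n. ennreal (\<Phi> (\<bar>G n x\<bar> / (v / t n))))"
      proof (cases "x \<in> \<Omega>")
        case True
        have "\<forall>\<^sub>F n in sequentially. ennreal \<bar>g x\<bar> \<le>
            ennreal (C * s n powr (1 / q)) * gagliardo M \<rho> \<Omega> (s n) q f x"
          using point[OF True g ae _ l bd] gx True by (intro eventually_compose_filterlim[OF _ s_lim]) auto
        then have "\<forall>\<^sub>F n in sequentially. ennreal (\<Phi> (\<bar>?g x\<bar> / (C * v))) \<le>
            ennreal (\<Phi> (\<bar>G n x\<bar> / (v / t n)))"
        proof eventually_elim
          fix n assume le: "ennreal \<bar>g x\<bar> \<le> ennreal (C * s n powr (1 / q)) * gagliardo M \<rho> \<Omega> (s n) q f x"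
          have eq: "ereal (G n x) = enn2ereal (gagliardo M \<rho> \<Omega> (s n) q f x)" using Gx True by blast
          then have G0: "0 \<le> G n x" by (metis enn2ereal_nonneg ereal_less_eq(5))
          have "gagliardo M \<rho> \<Omega> (s n) q f x = ennreal (G n x)"
            using eq by (metis e2ennreal_enn2ereal e2ennreal_ereal)
          then have "\<bar>g x\<bar> \<le> C * t n * G n x"
            using le G0 C t[of n] by (simp add: ennreal_mult[symmetric] t_def)
          then have "\<bar>?g x\<bar> / (C * v) \<le> \<bar>G n x\<bar> / (v / t n)"
            using True G0 C v by (simp add: field_simps)
          then show "ennreal (\<Phi> (\<bar>?g x\<bar> / (C * v))) \<le> ennreal (\<Phi> (\<bar>G n x\<bar> / (v / t n)))"
            using C v by (intro ennreal_leI Phi_monoD) auto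
        qed
        then show ?thesis by (rule Liminf_bounded)
      qed (simp add: Phi_0)
    qed
    have "om_bounded ?g (C * v)" unfolding morrey_bounded_def
    proof (intro ballI allI impI)
      fix x r assume x: "x \<in> space M" and r: "0 < (r::real)"
      note [measurable] = ball_sets[OF x]
      have [measurable]: "(\<lambda>y. ennreal (\<Phi> (\<bar>G n y\<bar> / (v / t n)))) \<in> borel_measurable M" for n
        by (intro measurable_compose[OF _ measurable_ennreal] Phi_scaled_measurable less_imp_le[OF vt] G)
      have "(\<integral>\<^sup>+y\<in>B x r. ennreal (\<Phi> (\<bar>?g y\<bar> / (C * v))) \<partial>M) \<le>
          (\<integral>\<^sup>+y. liminf (\<lambda>n. ennreal (\<Phi> (\<bar>G n y\<bar> / (v / t n))) * indicator (B x r) y) \<partial>M)"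
      proof (intro nn_integral_mono_AE, use le in eventually_elim)
        fix y assume "ennreal (\<Phi> (\<bar>?g y\<bar> / (C * v))) \<le>
          liminf (\<lambda>n. ennreal (\<Phi> (\<bar>G n y\<bar> / (v / t n))))"
        then show "ennreal (\<Phi> (\<bar>?g y\<bar> / (C * v))) * indicator (B x r) y \<le>
          liminf (\<lambda>n. ennreal (\<Phi> (\<bar>G n y\<bar> / (v / t n))) * indicator (B x r) y)"
          by (cases "y \<in> B x r") auto
      qed
      also have "\<dots> \<le> liminf (\<lambda>n. \<integral>\<^sup>+y\<in>B x r. ennreal (\<Phi> (\<bar>G n y\<bar> / (v / t n))) \<partial>M)"
        by (intro nn_integral_liminf) measurable
      also have "\<dots> \<le> liminf (\<lambda>n::nat. ennreal (\<phi> x r * V x r))"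
        by (intro Liminf_mono always_eventually allI morrey_boundedD[OF bdG x r])
      also have "\<dots> = ennreal (\<phi> x r * V x r)" by (simp add: Liminf_const)
      finally show "(\<integral>\<^sup>+y\<in>B x r. ennreal (\<Phi> (\<bar>?g y\<bar> / (C * v))) \<partial>M) \<le> ennreal (\<phi> x r * V x r)" .
    qed
    moreover have "AE x in M. x \<in> \<Omega> \<longrightarrow> ereal (?g x) = ereal (f x + a)" using ae by auto
    moreover have "0 < C * v" using C v by simp
    ultimately show "om_norm_on M \<rho> \<Phi> \<phi> \<Omega> (\<lambda>x. ereal (f x + a)) \<le> ennreal (C * v)"
      by (intro om_norm_on_le[of ?g]) measurable
  qed
qed

end

section \<open>Two-sided comparison\<close>

text \<open>
  A positive lower bound \<open>\<delta>\<close> on \<open>h\<close> would make the integral at least that of \<open>\<delta> / t\<close>, which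
  diverges logarithmically; almost monotonicity upgrades small values to convergence.
\<close>

lemma tendsto_0_if_integrable_against_inverse:
  fixes h :: "real \<Rightarrow> real"
  assumes pos: "\<And>r. 0 < r \<Longrightarrow> 0 < h r"
    and dec: "\<And>r s. 0 < r \<Longrightarrow> r \<le> s \<Longrightarrow> h s \<le> H * h r" and H: "1 \<le> H"
    and int: "(\<integral>\<^sup>+t\<in>{1<..}. ennreal (h t / t) \<partial>lborel) < \<infinity>"
  shows "(h \<longlongrightarrow> 0) at_top"
proof -
  have small: "\<exists>r>1. h r < \<delta>" if \<delta>: "0 < \<delta>" for \<delta>
  proof (rule ccontr)
    assume "\<not> ?thesis"
    then have ge: "\<delta> \<le> h t" if "1 < t" for t using that by force
    obtain N where N: "(\<integral>\<^sup>+t\<in>{1<..}. ennreal (h t / t) \<partial>lborel) = ennreal N" "0 \<le> N"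
      using int by (cases "\<integral>\<^sup>+t\<in>{1<..}. ennreal (h t / t) \<partial>lborel") auto
    (* chosen so that the integral of \<delta> / t over [2, T] is N + 1 *)
    define T where "T = 2 * exp ((N + 1) / \<delta>)"
    have T: "2 \<le> T" using N \<delta> by (simp add: T_def)
    have "ennreal (\<delta> * ln T - \<delta> * ln 2) = (\<integral>\<^sup>+t. ennreal (\<delta> / t) * indicator {2..T} t \<partial>lborel)"
      using T \<delta> by (intro nn_integral_FTC_Icc[symmetric]) (auto intro!: derivative_eq_intros)
    also have "\<dots> \<le> (\<integral>\<^sup>+t\<in>{1<..}. ennreal (h t / t) \<partial>lborel)"
      using ge by (intro nn_integral_mono) (auto simp: indicator_def intro!: ennreal_leI divide_right_mono)
    also have "\<dots> = ennreal N" by (rule N(1))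
    finally have "\<delta> * ln T - \<delta> * ln 2 \<le> N" using N(2) by simp
    moreover have "\<delta> * ln T - \<delta> * ln 2 = N + 1"
    proof -
      have "ln T = ln 2 + (N + 1) / \<delta>" unfolding T_def by (simp add: ln_mult)
      then have "\<delta> * ln T - \<delta> * ln 2 = \<delta> * ((N + 1) / \<delta>)" by (simp add: distrib_left)
      then show ?thesis using \<delta> by simp
    qed
    ultimately show False by simp
  qed
  show ?thesis
  proof (rule tendstoI)
    fix e :: real assume e: "0 < e"
    obtain r where r: "1 < r" "h r < e / H" using small[of "e / H"] e H by auto
    have "dist (h s) 0 < e" if "r \<le> s" for s
    proof -
      have "h s \<le> H * h r" using r that by (intro dec) auto
      also have "\<dots> < e" using r H by (simp add: field_simps)
      finally show ?thesis using pos[of s] r that by simp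
    qed
    then show "\<forall>\<^sub>F s in at_top. dist (h s) 0 < e" by (auto simp: eventually_at_top_linorder)
  qed
qed

lemma growth_space_if_G1_dec:
  assumes "doubling_space M \<rho> K L" and "\<phi> \<in> G1_dec M \<rho>" and "nearness M \<rho> \<phi>"
    and int: "\<exists>C>0. \<forall>x\<in>space M. \<forall>r>0.
      (\<integral>\<^sup>+t\<in>{r<..}. ennreal (\<phi> x t / t) \<partial>lborel) \<le> ennreal (C * \<phi> x r)"
  obtains H where "growth_space M \<rho> K L \<phi> H"
proof -
  interpret doubling_space M \<rho> K L by fact
  have pos: "\<And>x r. x \<in> space M \<Longrightarrow> 0 < r \<Longrightarrow> 0 < \<phi> x r"
    using assms(2) by (auto simp: G1_dec_def)
  obtain C\<^sub>1 where C1: "0 < C\<^sub>1" "\<And>x r s. x \<in> space M \<Longrightarrow> 0 < r \<Longrightarrow> r < s \<Longrightarrow> \<phi> x s \<le> C\<^sub>1 * \<phi> x r"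
    using assms(2) unfolding G1_dec_def by blast
  obtain C\<^sub>2 where C2: "0 < C\<^sub>2" "\<And>x y r. x \<in> space M \<Longrightarrow> y \<in> space M \<Longrightarrow> 0 < r \<Longrightarrow> \<rho> x y \<le> r \<Longrightarrow>
      \<phi> x r / \<phi> y r \<le> C\<^sub>2"
    using assms(3) unfolding nearness_def by blast
  define H where "H = max 1 (max C\<^sub>1 C\<^sub>2)"
  have H: "1 \<le> H" "C\<^sub>1 \<le> H" "C\<^sub>2 \<le> H" by (auto simp: H_def)
  have dec: "\<phi> x s \<le> H * \<phi> x r" if "x \<in> space M" "0 < r" "r \<le> s" for x r s
  proof (cases "r = s")
    case True
    then show ?thesis using H(1) pos[OF that(1,2)] mult_right_mono[of 1 H "\<phi> x r"] by simp
  next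
    case False
    then have "\<phi> x s \<le> C\<^sub>1 * \<phi> x r" using that by (intro C1(2)) auto
    also have "\<dots> \<le> H * \<phi> x r" using H pos[OF that(1,2)] by (intro mult_right_mono) auto
    finally show ?thesis .
  qed
  have "growth_space M \<rho> K L \<phi> H"
  proof
    show "1 \<le> H" by fact
    fix x r assume x: "x \<in> space M"
    show "0 < \<phi> x r" if "0 < r" using pos x that by blast
    show "\<phi> x s \<le> H * \<phi> x r" if "0 < r" "r \<le> s" for s using dec x that by blast
    show "\<phi> x r \<le> H * \<phi> y r" if y: "y \<in> space M" and r: "0 < r" and d: "\<rho> y x \<le> r" for y
    proof -
      have "\<phi> x r / \<phi> y r \<le> C\<^sub>2" using d x y r by (intro C2(2)) (auto simp: dist_sym)
      then have "\<phi> x r \<le> C\<^sub>2 * \<phi> y r" using pos[OF y r] by (simp add: field_simps)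
      also have "\<dots> \<le> H * \<phi> y r" using H pos[OF y r] by (intro mult_right_mono) auto
      finally show ?thesis .
    qed
    show "(\<phi> x \<longlongrightarrow> 0) at_top"
    proof (rule tendsto_0_if_integrable_against_inverse[where H = H])
      obtain C where "(\<integral>\<^sup>+t\<in>{1<..}. ennreal (\<phi> x t / t) \<partial>lborel) \<le> ennreal (C * \<phi> x 1)"
        using int x zero_less_one by blast
      then show "(\<integral>\<^sup>+t\<in>{1<..}. ennreal (\<phi> x t / t) \<partial>lborel) < \<infinity>"
        by (auto intro: order.strict_trans1)
    qed (use pos dec x H in auto)
  qed
  then show thesis by (rule that)
qed

context orlicz_morrey
begin

lemma om_norm_mod_lessE:
  assumes "om_norm_mod M \<rho> \<Phi> \<phi> \<Omega> f < ennreal l"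
  obtains a g where "g \<in> borel_measurable M" "AE x in M. x \<in> \<Omega> \<longrightarrow> g x = f x + a" "om_bounded g l"
proof -
  obtain a where a: "om_norm_on M \<rho> \<Phi> \<phi> \<Omega> (\<lambda>x. ereal (f x + a)) < ennreal l"
    using assms unfolding om_norm_mod_def INF_less_iff by blast
  then show thesis by (rule om_norm_on_lessE) (rule that, auto)
qed

lemma Limsup_gagliardo_norm_le:
  obtains D where "0 < D"
    "\<And>\<Omega> f s. \<Omega> \<in> sets M \<Longrightarrow> 0 < s \<Longrightarrow> gagliardo_norm M \<rho> \<Phi> \<phi> \<Omega> s q f < \<infinity> \<Longrightarrow>
       gagliardo_measurable M \<rho> \<Omega> q f \<Longrightarrow> om_norm_mod M \<rho> \<Phi> \<phi> \<Omega> f < \<infinity> \<Longrightarrow>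
       Limsup (at_right 0) (\<lambda>s. ennreal (s powr (1 / q)) * gagliardo_norm M \<rho> \<Phi> \<phi> \<Omega> s q f)
         \<le> ennreal D * om_norm_mod M \<rho> \<Phi> \<phi> \<Omega> f"
proof -
  obtain D where D: "0 < D"
    "\<And>\<Omega> f g a s\<^sub>0 l. \<Omega> \<in> sets M \<Longrightarrow> g \<in> borel_measurable M \<Longrightarrow>
       AE y in M. y \<in> \<Omega> \<longrightarrow> g y = f y + a \<Longrightarrow> 0 < l \<Longrightarrow> om_bounded g l \<Longrightarrow>
       0 < s\<^sub>0 \<Longrightarrow> gagliardo_norm M \<rho> \<Phi> \<phi> \<Omega> s\<^sub>0 q f < \<infinity> \<Longrightarrow>
       gagliardo_measurable M \<rho> \<Omega> q f \<Longrightarrow>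
       \<forall>\<^sub>F s in at_right 0.
         ennreal (s powr (1 / q)) * gagliardo_norm M \<rho> \<Phi> \<phi> \<Omega> s q f \<le> ennreal (D * l)"
    by (rule eventually_gagliardo_norm_le) blast
  show thesis
  proof (rule that[OF D(1)])
    fix \<Omega> f s
    assume \<Omega>: "\<Omega> \<in> sets M" and s: "0 < s" "gagliardo_norm M \<rho> \<Phi> \<phi> \<Omega> s q f < \<infinity>"
      "gagliardo_measurable M \<rho> \<Omega> q f" and fin: "om_norm_mod M \<rho> \<Phi> \<phi> \<Omega> f < \<infinity>"
    let ?F = "\<lambda>s. ennreal (s powr (1 / q)) * gagliardo_norm M \<rho> \<Phi> \<phi> \<Omega> s q f"
    obtain n where n: "om_norm_mod M \<rho> \<Phi> \<phi> \<Omega> f = ennreal n" "0 \<le> n"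
      using fin by (cases "om_norm_mod M \<rho> \<Phi> \<phi> \<Omega> f") auto
    show "Limsup (at_right 0) ?F \<le> ennreal D * om_norm_mod M \<rho> \<Phi> \<phi> \<Omega> f"
    proof (rule ennreal_le_epsilon)
      fix e :: real assume e: "0 < e"
      define l where "l = n + e / D"
      have l: "0 < l" "n < l" using n e D(1) by (auto simp: l_def add_nonneg_pos)
      have "om_norm_mod M \<rho> \<Phi> \<phi> \<Omega> f < ennreal l" using l n by (simp add: ennreal_less_iff)
      then obtain a g where "g \<in> borel_measurable M" "AE x in M. x \<in> \<Omega> \<longrightarrow> g x = f x + a" "om_bounded g l"
        by (rule om_norm_mod_lessE)
      then have "\<forall>\<^sub>F s in at_right 0. ?F s \<le> ennreal (D * l)"
        using \<Omega> l(1) s by (intro D(2)) auto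
      then have "Limsup (at_right 0) ?F \<le> ennreal (D * l)" by (rule Limsup_bounded)
      also have "D * l = D * n + e" using D(1) by (simp add: l_def field_simps)
      also have "ennreal (D * n + e) = ennreal D * om_norm_mod M \<rho> \<Phi> \<phi> \<Omega> f + ennreal e"
        using D(1) n e by (simp add: ennreal_mult)
      finally show "Limsup (at_right 0) ?F \<le> ennreal D * om_norm_mod M \<rho> \<Phi> \<phi> \<Omega> f + ennreal e" .
    qed
  qed
qed

text \<open>
  A single constant \<open>a\<close> for which \<open>f + a\<close> has finite norm suffices, since the norm modulo constants
  is at most the norm of \<open>f + a\<close>.
\<close>

lemma Liminf_gagliardo_norm_ge:
  assumes WRD: "WRD M \<rho>" and WMD: "WMD M \<rho> \<Omega>" and \<Omega>: "\<Omega> \<in> sets M"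
  obtains C where "0 < C"
    "\<And>f. om_norm_mod M \<rho> \<Phi> \<phi> \<Omega> f < \<infinity> \<Longrightarrow>
       ennreal C * om_norm_mod M \<rho> \<Phi> \<phi> \<Omega> f \<le>
         Liminf (at_right 0) (\<lambda>s. ennreal (s powr (1 / q)) * gagliardo_norm M \<rho> \<Phi> \<phi> \<Omega> s q f)"
proof -
  obtain C where C: "0 < C"
    "\<And>f g a l v. g \<in> borel_measurable M \<Longrightarrow> AE y in M. y \<in> \<Omega> \<longrightarrow> g y = f y + a \<Longrightarrow>
       0 < l \<Longrightarrow> om_bounded g l \<Longrightarrow> 0 < v \<Longrightarrow>
       \<exists>\<^sub>F s in at_right 0. ennreal (s powr (1 / q)) * gagliardo_norm M \<rho> \<Phi> \<phi> \<Omega> s q f < ennreal v \<Longrightarrow>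
       om_norm_on M \<rho> \<Phi> \<phi> \<Omega> (\<lambda>x. ereal (f x + a)) \<le> ennreal (C * v)"
    using assms by (rule om_norm_on_le_gagliardo_norm) blast
  show thesis
  proof (rule that[of "1 / C"])
    show "0 < 1 / C" using C(1) by simp
    fix f assume fin: "om_norm_mod M \<rho> \<Phi> \<phi> \<Omega> f < \<infinity>"
    let ?F = "\<lambda>s. ennreal (s powr (1 / q)) * gagliardo_norm M \<rho> \<Phi> \<phi> \<Omega> s q f"
    obtain n where n: "om_norm_mod M \<rho> \<Phi> \<phi> \<Omega> f = ennreal n" "0 \<le> n"
      using fin by (cases "om_norm_mod M \<rho> \<Phi> \<phi> \<Omega> f") auto
    have "om_norm_mod M \<rho> \<Phi> \<phi> \<Omega> f < ennreal (n + 1)" using n by (simp add: ennreal_less_iff)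
    then obtain a g where g: "g \<in> borel_measurable M" "AE x in M. x \<in> \<Omega> \<longrightarrow> g x = f x + a"
      "om_bounded g (n + 1)"
      by (rule om_norm_mod_lessE)
    have n1: "0 < n + 1" using n by simp
    show "ennreal (1 / C) * om_norm_mod M \<rho> \<Phi> \<phi> \<Omega> f \<le> Liminf (at_right 0) ?F"
    proof (rule dense_ge)
      fix y assume y: "Liminf (at_right 0) ?F < y"
      show "ennreal (1 / C) * om_norm_mod M \<rho> \<Phi> \<phi> \<Omega> f \<le> y"
      proof (cases y)
        case (real v)
        then have v: "0 < v" using y by (cases "v = 0") auto
        have "\<not> (\<forall>\<^sub>F s in at_right 0. ennreal v \<le> ?F s)"
          using y real Liminf_bounded[of "ennreal v" ?F "at_right 0"] by (auto simp: not_le)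
        then have "\<exists>\<^sub>F s in at_right 0. ?F s < ennreal v" by (simp add: frequently_def not_less)
        then have "om_norm_on M \<rho> \<Phi> \<phi> \<Omega> (\<lambda>x. ereal (f x + a)) \<le> ennreal (C * v)"
          by (intro C(2)[OF g(1,2) n1 g(3) v])
        then have "om_norm_mod M \<rho> \<Phi> \<phi> \<Omega> f \<le> ennreal (C * v)"
          unfolding om_norm_mod_def by (rule INF_lower2[OF UNIV_I])
        then have "ennreal (1 / C) * om_norm_mod M \<rho> \<Phi> \<phi> \<Omega> f \<le> ennreal (1 / C) * ennreal (C * v)"
          by (intro mult_left_mono) auto
        also have "\<dots> = y" using C(1) v real by (simp add: ennreal_mult[symmetric])
        finally show ?thesis .
      qed simp
    qed
  qed
qed

end

theorem theorem4p45:
  fixes M :: "'a measure" and \<rho> :: "'a \<Rightarrow> 'a \<Rightarrow> real" and \<Omega> :: "'a set"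
    and \<Phi> :: "real \<Rightarrow> real" and \<phi> :: "'a \<Rightarrow> real \<Rightarrow> real"
    and r_minus r_plus q :: real
  assumes "homogeneous_type M \<rho>"
    and "WRD M \<rho>"
    and "qopen M \<rho> \<Omega>"
    and "WMD M \<rho> \<Omega>"
    and "orlicz_function \<Phi>"
    and "0 < r_minus" and "lower_type \<Phi> r_minus"
    and "0 < r_plus" and "upper_type \<Phi> r_plus"
    and "strict_mono_on {0..} \<Phi>"
    and "1 \<le> r_minus \<and> r_minus \<le> r_plus \<longrightarrow> convex_on {0..} \<Phi>"
    and "\<phi> \<in> G1_dec M \<rho>"
    and "nearness M \<rho> \<phi>"
    and "\<exists>C\<^sub>1>0. \<forall>x\<in>space M. \<forall>r>0.
           (\<integral>\<^sup>+t\<in>{r<..}. ennreal (\<phi> x t / t) \<partial>lborel) \<le> ennreal (C\<^sub>1 * \<phi> x r)"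
    and "(\<exists>C>0. \<forall>x\<in>space M. \<forall>r>0.
            1 / C \<le> \<phi> x r * measure M (qball M \<rho> x r) \<and>
            \<phi> x r * measure M (qball M \<rho> x r) \<le> C) \<or>
         ((\<forall>x\<^sub>B\<in>space M. \<forall>r\<^sub>B>0.
            filterlim (\<lambda>r. INF x\<in>qball M \<rho> x\<^sub>B r\<^sub>B. \<phi> x r) at_top (at_right 0)) \<and>
          (\<forall>x\<in>space M.
            filterlim (\<lambda>r. \<phi> x r * measure M (qball M \<rho> x r)) at_top at_top))"
    and "0 < q" and "q < r_minus"
  shows "\<exists>C D :: real. 0 < C \<and> 0 < D \<and>
    (\<forall>f \<in> om_space_mod M \<rho> \<Phi> \<phi> \<Omega> \<inter> (\<Union>s\<in>{0<..<1}. sobolev_om M \<rho> \<Phi> \<phi> \<Omega> s q).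
      gagliardo_measurable M \<rho> \<Omega> q f \<longrightarrow>
      ennreal C * om_norm_mod M \<rho> \<Phi> \<phi> \<Omega> f
        \<le> Liminf (at_right 0) (\<lambda>s. ennreal (s powr (1 / q)) * gagliardo_norm M \<rho> \<Phi> \<phi> \<Omega> s q f) \<and>
      Liminf (at_right 0) (\<lambda>s. ennreal (s powr (1 / q)) * gagliardo_norm M \<rho> \<Phi> \<phi> \<Omega> s q f)
        \<le> Limsup (at_right 0) (\<lambda>s. ennreal (s powr (1 / q)) * gagliardo_norm M \<rho> \<Phi> \<phi> \<Omega> s q f) \<and>
      Limsup (at_right 0) (\<lambda>s. ennreal (s powr (1 / q)) * gagliardo_norm M \<rho> \<Phi> \<phi> \<Omega> s q f)
        \<le> ennreal D * om_norm_mod M \<rho> \<Phi> \<phi> \<Omega> f)"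
proof -
  obtain K L where "doubling_space M \<rho> K L"
    using assms(1) by (rule homogeneous_type_doubling_space)
  then obtain H where growth: "growth_space M \<rho> K L \<phi> H"
    using assms(12,13,14) by (rule growth_space_if_G1_dec)
  obtain A where A: "1 \<le> A"
    "\<And>t s. 0 < t \<Longrightarrow> 0 < s \<Longrightarrow> s < 1 \<Longrightarrow> \<Phi> (s * t) \<le> A * s powr r_minus * \<Phi> t"
    using assms(7) unfolding lower_type_def by blast
  have "orlicz_type \<Phi> r_minus q A"
    using assms(5,16,17) A by unfold_locales (auto simp: orlicz_function_def)
  with growth interpret orlicz_morrey M \<rho> K L \<phi> H \<Phi> r_minus q A
    by (intro orlicz_morrey.intro)
  have \<Omega>: "\<Omega> \<in> sets M" using assms(3) by (rule qopen_sets)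
  obtain C where C: "0 < C"
    "\<And>f. om_norm_mod M \<rho> \<Phi> \<phi> \<Omega> f < \<infinity> \<Longrightarrow>
       ennreal C * om_norm_mod M \<rho> \<Phi> \<phi> \<Omega> f \<le>
         Liminf (at_right 0) (\<lambda>s. ennreal (s powr (1 / q)) * gagliardo_norm M \<rho> \<Phi> \<phi> \<Omega> s q f)"
    using assms(2,4) \<Omega> by (rule Liminf_gagliardo_norm_ge) blast
  obtain D where D: "0 < D"
    "\<And>\<Omega> f s. \<Omega> \<in> sets M \<Longrightarrow> 0 < s \<Longrightarrow> gagliardo_norm M \<rho> \<Phi> \<phi> \<Omega> s q f < \<infinity> \<Longrightarrow>
       gagliardo_measurable M \<rho> \<Omega> q f \<Longrightarrow> om_norm_mod M \<rho> \<Phi> \<phi> \<Omega> f < \<infinity> \<Longrightarrow>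
       Limsup (at_right 0) (\<lambda>s. ennreal (s powr (1 / q)) * gagliardo_norm M \<rho> \<Phi> \<phi> \<Omega> s q f)
         \<le> ennreal D * om_norm_mod M \<rho> \<Phi> \<phi> \<Omega> f"
    by (rule Limsup_gagliardo_norm_le) blast
  show ?thesis
  proof (rule exI[of _ C], rule exI[of _ D], intro conjI C(1) D(1) ballI impI)
    fix f
    assume f: "f \<in> om_space_mod M \<rho> \<Phi> \<phi> \<Omega> \<inter> (\<Union>s\<in>{0<..<1}. sobolev_om M \<rho> \<Phi> \<phi> \<Omega> s q)"
      and meas: "gagliardo_measurable M \<rho> \<Omega> q f"
    have fin: "om_norm_mod M \<rho> \<Phi> \<phi> \<Omega> f < \<infinity>" using f by (simp add: om_space_mod_def)
    obtain s where s: "0 < s" "gagliardo_norm M \<rho> \<Phi> \<phi> \<Omega> s q f < \<infinity>"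
      using f by (auto simp: sobolev_om_def)
    let ?F = "\<lambda>s. ennreal (s powr (1 / q)) * gagliardo_norm M \<rho> \<Phi> \<phi> \<Omega> s q f"
    show "ennreal C * om_norm_mod M \<rho> \<Phi> \<phi> \<Omega> f \<le> Liminf (at_right 0) ?F" by (rule C(2)[OF fin])
    show "Liminf (at_right 0) ?F \<le> Limsup (at_right 0) ?F"
      by (rule Liminf_le_Limsup) (rule trivial_limit_at_right_real)
    show "Limsup (at_right 0) ?F \<le> ennreal D * om_norm_mod M \<rho> \<Phi> \<phi> \<Omega> f"
      by (rule D(2)[OF \<Omega> s meas fin])
  qed
qed

end
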